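(* Let $K\ge 1$, let $P=(p_{kl})$ be a substochastic $K\times K$ matrix with spectral radius less than $1$, let $\lambda_k>0$, $\mu_k>0$ ($k=1,\dots,K$), let $\nu=(I-P^T)^{-1}\lambda$, $\rho_k=\nu_k/\mu_k$, and assume $\rho_k<1$ for all $k$ (the Jackson network is ergodic). Let $r\in\mathbb R_+^K$, let $\overline q$ be the fluid trajectory of the dual network with $\overline q(0)=r$, let $T^\ast$ be the first time at which $\overline q$ reaches the origin, and let $q^\ast(t)=\overline q(T^\ast-t)$ for $0\le t\le T^\ast$. Consider the problem of minimizing $$\int_0^T L(q(t),\dot q(t))\,dt$$ over all $T\ge 0$ and all absolutely continuous $q:[0,T]\to\mathbb R_+^K$ with $q(0)=0$ and $q(T)=r$. Then: (i) $(T^\ast,q^\ast)$ is a minimizer, and it is unique up to the time spent at the origin: if $(T,q)$ is any minimizer, then $T\ge T^\ast$, $q(t)=0$ for $0\le t\le T-T^\ast$, and $q(T-T^\ast+t)=q^\ast(t)$ for $0\le t\le T^\ast$. (ii) Motion in an essential face $F_J$ takes place with momentum $\tilde\theta^{(J)}$: for every $J$ such that $F_J$ is essential, $\dot q^\ast(t)\in\partial H_J(\tilde\theta^{(J)})$ for almost every $t\in[0,T^\ast]$ with $q^\ast(t)\in F_J$. (iii) The minimal cost is $$\int_0^{T^\ast}L(q^\ast(t),\dot q^\ast(t))\,dt=\theta^\ast\cdot r .$$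
   Context: Substochastic: nonnegative entries, row sums at most $1$. $\lambda=(\lambda_1,\dots,\lambda_K)^T$, $\mu=(\mu_1,\dots,\mu_K)^T$. For $J\subset\{1,\dots,K\}$, $J^c$ is its complement and $F_J=\{x\in\mathbb R^K: x_i=0 \text{ for } i\in J,\ x_i>0\text{ for } i\notin J\}$; these faces partition $\mathbb R_+^K$. For $\theta\in\mathbb R^K$, $h_k(\theta)=e^{-\theta_k}\bigl(\sum_{l=1}^K(e^{\theta_l}-1)p_{kl}+1\bigr)-1$ and, with $u^+=\max(u,0)$, $$H_J(\theta)=\sum_{k=1}^K(e^{\theta_k}-1)\lambda_k+\sum_{k\in J}h_k(\theta)^+\mu_k+\sum_{k\in J^c}h_k(\theta)\mu_k .$$ $H_J$ is convex and $\partial H_J$ denotes its subdifferential. The Lagrangian is $L(x,y)=\sum_{J}\mathbf 1_{F_J}(x)L_J(y)$ for $x\in\mathbb R_+^K$, $y\in\mathbb R^K$, where $L_J(y)=\sup_{\theta\in\mathbb R^K}(\theta\cdot y-H_J(\theta))$. $\theta^\ast\in\mathbb R^K$ is given by $\theta^\ast_k=-\ln\rho_k$. For each $J$, $\tilde\theta^{(J)}\in\mathbb R^K$ is the vector determined by $\tilde\theta^{(J)}_k=\theta^\ast_k$ for $k\notin J$ and $h_k(\tilde\theta^{(J)})=0$ for $k\in J$. A face $F_J$ is called essential if a trajectory with momentum $\tilde\theta^{(J)}$ passing through $F_J$ exists, i.e. if there is an absolutely continuous function $q$ on a time interval of positive length, with values in $F_J$, such that $\dot q(t)\in\partial H_J(\tilde\theta^{(J)})$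 almost everywhere. The dual network has service rates $\mu_k$, routing matrix $\overline P=(\overline p_{kl})$ with $\overline p_{kl}=\nu_l p_{lk}/\nu_k$, and arrival rates $\overline\lambda_k=\nu_k(1-\sum_{l=1}^K p_{kl})$. Its fluid trajectory started at $r\in\mathbb R_+^K$ is the unique solution $\overline q$ of the oblique reflection problem: $\overline q(t)=r+(\overline\lambda-(I-\overline P^T)\mu)\,t+(I-\overline P^T)\phi(t)\in\mathbb R_+^K$ for $t\ge0$, where $\phi(0)=0$, $\phi$ is absolutely continuous and componentwise nondecreasing, and $\overline q_k(t)\dot\phi_k(t)=0$ for a.e. $t$ and all $k$. Under the ergodicity assumption it reaches the origin in finite time. *)

theory Defs
  imports "HOL-Analysis.Analysis"
begin

definition substochastic :: "real^'n^'n \<Rightarrow> bool" where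
  "substochastic P \<longleftrightarrow> (\<forall>k l. 0 \<le> P$k$l) \<and> (\<forall>k. (\<Sum>l\<in>UNIV. P$k$l) \<le> 1)"

definition complex_eigenvalue :: "real^'n^'n \<Rightarrow> complex \<Rightarrow> bool" where
  "complex_eigenvalue A z \<longleftrightarrow>
     (\<exists>v :: complex^'n. v \<noteq> 0 \<and> (\<chi> i j. complex_of_real (A$i$j)) *v v = z *s v)"

definition spectral_radius :: "real^'n^'n \<Rightarrow> real" where
  "spectral_radius A = Sup {cmod z | z. complex_eigenvalue A z}"

definition abs_cont_on :: "real set \<Rightarrow> (real \<Rightarrow> 'a::real_normed_vector) \<Rightarrow> bool" where
  "abs_cont_on S f \<longleftrightarrow>
     (\<forall>e>0. \<exists>d>0. \<forall>D :: (real \<times> real) set.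
        finite D \<and> (\<forall>(a, b)\<in>D. a \<le> b \<and> {a..b} \<subseteq> S) \<and>
        disjoint_family_on (\<lambda>(a, b). {a<..<b}) D \<and> (\<Sum>(a, b)\<in>D. b - a) < d
        \<longrightarrow> (\<Sum>(a, b)\<in>D. norm (f b - f a)) < e)"

definition subdifferential :: "('a::real_inner \<Rightarrow> real) \<Rightarrow> 'a \<Rightarrow> 'a set" where
  "subdifferential f x = {g. \<forall>y. f x + g \<bullet> (y - x) \<le> f y}"

definition nonneg_orthant :: "(real^'n) set" where
  "nonneg_orthant = {x. \<forall>k. 0 \<le> x$k}"

definition face :: "'n set \<Rightarrow> (real^'n) set" where
  "face J = {x. (\<forall>i\<in>J. x$i = 0) \<and> (\<forall>i\<in>-J. 0 < x$i)}"

definition nu :: "real^'n^'n \<Rightarrow> real^'n \<Rightarrow> real^'n" where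
  "nu P lam = matrix_inv (mat 1 - transpose P) *v lam"

definition rho :: "real^'n^'n \<Rightarrow> real^'n \<Rightarrow> real^'n \<Rightarrow> 'n \<Rightarrow> real" where
  "rho P lam mu k = nu P lam $ k / mu $ k"

definition h :: "real^'n^'n \<Rightarrow> 'n \<Rightarrow> real^'n \<Rightarrow> real" where
  "h P k th = exp (- th$k) * ((\<Sum>l\<in>UNIV. (exp (th$l) - 1) * P$k$l) + 1) - 1"

definition H :: "real^'n^'n \<Rightarrow> real^'n \<Rightarrow> real^'n \<Rightarrow> 'n set \<Rightarrow> real^'n \<Rightarrow> real" where
  "H P lam mu J th =
     (\<Sum>k\<in>UNIV. (exp (th$k) - 1) * lam$k)
     + (\<Sum>k\<in>J. max (h P k th) 0 * mu$k)
     + (\<Sum>k\<in>-J. h P k th * mu$k)"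

definition L_face ::
  "real^'n^'n \<Rightarrow> real^'n \<Rightarrow> real^'n \<Rightarrow> 'n set \<Rightarrow> real^'n \<Rightarrow> ereal" where
  "L_face P lam mu J y = (SUP th. ereal (th \<bullet> y - H P lam mu J th))"

definition Lagrangian ::
  "real^'n^'n \<Rightarrow> real^'n \<Rightarrow> real^'n \<Rightarrow> real^'n \<Rightarrow> real^'n \<Rightarrow> ereal" where
  "Lagrangian P lam mu x y = (\<Sum>J\<in>UNIV. indicator (face J) x * L_face P lam mu J y)"

definition theta_star :: "real^'n^'n \<Rightarrow> real^'n \<Rightarrow> real^'n \<Rightarrow> real^'n" where
  "theta_star P lam mu = (\<chi> k. - ln (rho P lam mu k))"

definition theta_face ::
  "real^'n^'n \<Rightarrow> real^'n \<Rightarrow> real^'n \<Rightarrow> 'n set \<Rightarrow> real^'n" where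
  "theta_face P lam mu J =
     (THE th. (\<forall>k\<in>-J. th$k = theta_star P lam mu $ k) \<and> (\<forall>k\<in>J. h P k th = 0))"

text \<open>A statement about \<open>\<dot>q(t)\<close> for almost every \<open>t\<close> is read as: for almost every \<open>t\<close>,
  the derivative exists and satisfies the statement. Restricting to a compact
  time interval loses nothing in the next definition, since trajectories restrict to subintervals.\<close>

definition essential :: "real^'n^'n \<Rightarrow> real^'n \<Rightarrow> real^'n \<Rightarrow> 'n set \<Rightarrow> bool" where
  "essential P lam mu J \<longleftrightarrow>
     (\<exists>(q :: real \<Rightarrow> real^'n) a b. a < b \<and> abs_cont_on {a..b} q \<and> q ` {a..b} \<subseteq> face J \<and>
        (AE t in lebesgue. t \<in> {a..b} \<longrightarrow>
           (\<exists>v. (q has_vector_derivative v) (at t) \<and>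
                v \<in> subdifferential (H P lam mu J) (theta_face P lam mu J))))"

text \<open>The oblique reflection problem for the network with routing matrix \<open>P\<close>, arrival rates
  \<open>lam\<close> and service rates \<open>mu\<close>. Absolute continuity on the half-line is local. Only the values
  of \<open>q\<close> at nonnegative times are constrained.\<close>

definition fluid_trajectory ::
  "real^'n^'n \<Rightarrow> real^'n \<Rightarrow> real^'n \<Rightarrow> real^'n \<Rightarrow> (real \<Rightarrow> real^'n) \<Rightarrow> bool" where
  "fluid_trajectory P lam mu r q \<longleftrightarrow>
     (\<exists>phi :: real \<Rightarrow> real^'n.
        phi 0 = 0 \<and> (\<forall>T\<ge>0. abs_cont_on {0..T} phi) \<and> (\<forall>k. mono_on {0..} (\<lambda>t. phi t $ k)) \<and>
        (\<forall>t\<ge>0. q t = r + t *\<^sub>R (lam - (mat 1 - transpose P) *v mu)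
                         + (mat 1 - transpose P) *v phi t
               \<and> q t \<in> nonneg_orthant) \<and>
        (AE t in lebesgue. 0 \<le> t \<longrightarrow>
           (\<exists>v. (phi has_vector_derivative v) (at t) \<and> (\<forall>k. q t $ k * v $ k = 0))))"

definition dual_routing :: "real^'n^'n \<Rightarrow> real^'n \<Rightarrow> real^'n^'n" where
  "dual_routing P lam = (\<chi> k l. nu P lam $ l * P$l$k / nu P lam $ k)"

definition dual_arrival :: "real^'n^'n \<Rightarrow> real^'n \<Rightarrow> real^'n" where
  "dual_arrival P lam = (\<chi> k. nu P lam $ k * (1 - (\<Sum>l\<in>UNIV. P$k$l)))"

definition first_time_at_origin :: "(real \<Rightarrow> real^'n) \<Rightarrow> real" where
  "first_time_at_origin q = Inf {t. 0 \<le> t \<and> q t = 0}"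

definition admissible :: "real^'n \<Rightarrow> real \<Rightarrow> (real \<Rightarrow> real^'n) \<Rightarrow> bool" where
  "admissible r T q \<longleftrightarrow>
     0 \<le> T \<and> abs_cont_on {0..T} q \<and> q ` {0..T} \<subseteq> nonneg_orthant \<and> q 0 = 0 \<and> q T = r"

text \<open>The Lagrangian is nonnegative on the orthant because \<open>H\<close> vanishes at \<open>0\<close>, so the
  nonnegative integral below truncates nothing and allows the value \<open>\<infinity>\<close>. The value of
  \<open>vector_derivative\<close> on the null set of points where \<open>q\<close> has no derivative is irrelevant.\<close>

definition cost ::
  "real^'n^'n \<Rightarrow> real^'n \<Rightarrow> real^'n \<Rightarrow> real \<Rightarrow> (real \<Rightarrow> real^'n) \<Rightarrow> ereal" where
  "cost P lam mu T q =
     enn2ereal (\<integral>\<^sup>+t\<in>{0..T}. e2ennreal (Lagrangian P lam mu (q t) (vector_derivative q (at t))) \<partial>lebesgue)"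

definition minimizer ::
  "real^'n^'n \<Rightarrow> real^'n \<Rightarrow> real^'n \<Rightarrow> real^'n \<Rightarrow> real \<Rightarrow> (real \<Rightarrow> real^'n) \<Rightarrow> bool" where
  "minimizer P lam mu r T q \<longleftrightarrow>
     admissible r T q \<and> (\<forall>T' q'. admissible r T' q' \<longrightarrow> cost P lam mu T q \<le> cost P lam mu T' q')"

end

theory Submission
  imports Defs
begin

text \<open>Write \<open>x = exp \<theta> - 1\<close>. On the face \<open>F\<^sub>J\<close> the vector \<open>\<theta>\<^bsub>J\<^esub> = theta_face J\<close> satisfies \<open>H\<^sub>J \<theta>\<^bsub>J\<^esub> = 0\<close>
  and \<open>\<theta>\<^bsub>J\<^esub> \<bullet> y = \<theta>\<^sup>* \<bullet> y\<close> for every velocity \<open>y\<close> tangential to the face. Since an absolutely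
  continuous path in the orthant has tangential velocity almost everywhere,
  \<open>L (q, q') \<ge> \<theta>\<^sup>* \<bullet> q'\<close> almost everywhere, and integration gives the lower bound \<open>\<theta>\<^sup>* \<bullet> r\<close>.
  Equality means \<open>q' \<in> \<partial>H\<^sub>J \<theta>\<^bsub>J\<^esub>\<close> almost everywhere, and the tangential elements of this
  subdifferential are exactly the reversed velocities of the dual fluid network on \<open>F\<^sub>J\<close>. Hence
  optimal paths are the time reversals of solutions of the oblique reflection problem,
  which is uniquely solvable. The dual fluid reaches the origin because its total mass
  decreases at a rate bounded away from \<open>0\<close> off the origin.\<close>

section \<open>Absolutely continuous functions\<close>

text \<open>The obstacle is uniqueness: it needs the tangential part of the subdifferential exactly,
  although H is not smooth on J. Membership follows from tangent bounds on exponentials; the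
  converse from one-sided directional derivatives, in directions found by solving linear systems
  with I - P on J.

  The dictionary with the dual network is w = mu - \<nu> (1 + x), read coordinatewise. Here w is the
  idleness rate of the dual servers: w = 0 off J and zero velocity on J together determine x, and w
  >= 0 on J is the subgradient condition for the positive parts in H.

  With Pbar the dual routing matrix, I - Pbar^T is conjugate to I - P by the diagonal matrix of
  \<nu>. Hence a single minimum principle for P yields the positivity statements and the uniqueness
  of the reflection problem alike.

  Differentiability almost everywhere comes from the epsilon-delta form of absolute continuity
  through Vitali coverings. The fundamental theorem is proved for the gauge integral, which yields
  integrability of the derivative along with its value.\<close>

abbreviation increments :: "(real \<Rightarrow> real) \<Rightarrow> (real \<times> real) set \<Rightarrow> real" where
  "increments F D \<equiv> (\<Sum>(u, v)\<in>D. F v - F u)"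

text \<open>Degenerate intervals are excluded because their open interiors are empty and so disjoint
  from everything; for nondegenerate ones disjointness can be restated as an order between end
  points.\<close>

definition interval_system :: "(real \<times> real) set \<Rightarrow> bool" where
  "interval_system D \<longleftrightarrow> finite D \<and> (\<forall>(u, v)\<in>D. u < v) \<and>
     disjoint_family_on (\<lambda>(u, v). {u<..<v}) D"

lemma open_interval_disjoint_iff:
  fixes a b c d :: real
  assumes "a < b" "c < d"
  shows "{a<..<b} \<inter> {c<..<d} = {} \<longleftrightarrow> b \<le> c \<or> d \<le> a"
proof
  assume *: "{a<..<b} \<inter> {c<..<d} = {}"
  show "b \<le> c \<or> d \<le> a"
  proof (rule ccontr)
    assume "\<not> ?thesis"
    then have "(max a c + min b d) / 2 \<in> {a<..<b} \<inter> {c<..<d}"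
      using assms by (auto simp: min_def max_def)
    then show False using * by blast
  qed
qed auto

lemma interval_systemD:
  assumes "interval_system D" "(a, b) \<in> D" "(c, d) \<in> D" "(a, b) \<noteq> (c, d)"
  shows "b \<le> c \<or> d \<le> a"
proof -
  have "{a<..<b} \<inter> {c<..<d} = {}"
    using assms unfolding interval_system_def disjoint_family_on_def by fastforce
  moreover have "a < b" "c < d" using assms unfolding interval_system_def by auto
  ultimately show ?thesis using open_interval_disjoint_iff by blast
qed

lemma interval_systemI:
  assumes "finite D" "\<And>u v. (u, v) \<in> D \<Longrightarrow> u < v"
    and "\<And>a b c d. (a, b) \<in> D \<Longrightarrow> (c, d) \<in> D \<Longrightarrow> (a, b) \<noteq> (c, d) \<Longrightarrow> b \<le> c \<or> d \<le> a"
  shows "interval_system D"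
  unfolding interval_system_def disjoint_family_on_def
proof (intro conjI ballI impI)
  fix p q assume pq: "p \<in> D" "q \<in> D" "p \<noteq> q"
  obtain a b c d where [simp]: "p = (a, b)" "q = (c, d)" by (metis surj_pair)
  have "{a<..<b} \<inter> {c<..<d} = {}"
    using assms(3)[of a b c d] pq by auto
  then show "(case p of (u, v) \<Rightarrow> {u<..<v}) \<inter> (case q of (u, v) \<Rightarrow> {u<..<v}) = {}" by simp
qed (use assms in auto)

text \<open>D collects the gaps that B leaves in A. The identity holds for every F by telescoping,
  so one D serves both for lengths (F the identity) and for the increments of a given
  function.\<close>

lemma interval_system_gaps:
  assumes A: "interval_system A" and B: "interval_system B"
    and BA: "\<And>u v. (u, v) \<in> B \<Longrightarrow> \<exists>(x, y)\<in>A. x \<le> u \<and> v \<le> y"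
  obtains D where "interval_system D" "\<And>u v. (u, v) \<in> D \<Longrightarrow> \<exists>(x, y)\<in>A. x \<le> u \<and> v \<le> y"
    "\<And>F. increments F A = increments F B + increments F D"
proof -
  have "finite B" using B by (simp add: interval_system_def)
  \<comment> \<open>The covering clause serves the induction only: an interval inside A that misses
    B lies in a single gap, so the next interval of B has a gap to split.\<close>
  then have "\<exists>D. interval_system D \<and> (\<forall>(u, v)\<in>D. \<exists>(x, y)\<in>A. x \<le> u \<and> v \<le> y)
     \<and> (\<forall>s t. s < t \<and> (\<exists>(x, y)\<in>A. x \<le> s \<and> t \<le> y) \<and> (\<forall>(u, v)\<in>B. t \<le> u \<or> v \<le> s)
          \<longrightarrow> (\<exists>(x, y)\<in>D. x \<le> s \<and> t \<le> y))
     \<and> (\<forall>F. increments F A = increments F B + increments F D)"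
    using B BA
  proof (induction B)
    case empty
    show ?case by (rule exI[of _ A]) (use A in auto)
  next
    case (insert b B)
    obtain u v where b: "b = (u, v)" by (cases b)
    have "interval_system B"
      using insert.prems(1) unfolding interval_system_def disjoint_family_on_def by auto
    from insert.IH[OF this] insert.prems(2) obtain D where D: "interval_system D"
      and DA: "\<forall>(u, v)\<in>D. \<exists>(x, y)\<in>A. x \<le> u \<and> v \<le> y"
      and cov0: "\<forall>s t. s < t \<and> (\<exists>(x, y)\<in>A. x \<le> s \<and> t \<le> y) \<and> (\<forall>(u, v)\<in>B. t \<le> u \<or> v \<le> s)
          \<longrightarrow> (\<exists>(x, y)\<in>D. x \<le> s \<and> t \<le> y)"
      and sums: "\<forall>F. increments F A = increments F B + increments F D"
      by blast
    have cov: "\<exists>(x, y)\<in>D. x \<le> s \<and> t \<le> y"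
      if "s < t" "\<exists>(x, y)\<in>A. x \<le> s \<and> t \<le> y" "\<forall>(u, v)\<in>B. t \<le> u \<or> v \<le> s" for s t
      using cov0[rule_format, of s t] that by blast
    have uv: "u < v" using insert.prems(1) b unfolding interval_system_def by auto
    have "\<forall>(u', v')\<in>B. v \<le> u' \<or> v' \<le> u"
      using interval_systemD[OF insert.prems(1), of u v] insert.hyps b by auto
    then obtain x y where xy: "(x, y) \<in> D" "x \<le> u" "v \<le> y"
      using cov[of u v] insert.prems(2)[of u v] uv b by blast
    \<comment> \<open>L and R hold what remains of the gap (x, y) to the left and right of (u, v);
      an empty remainder is omitted to keep all intervals nondegenerate.\<close>
    define L where "L = (if x < u then {(x, u)} else {})"
    define R where "R = (if v < y then {(v, y)} else {})"
    define D' where "D' = (D - {(x, y)}) \<union> (L \<union> R)"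
    have finD: "finite D" using D by (simp add: interval_system_def)
    have ltD: "p < q" if "(p, q) \<in> D" for p q using D that by (auto simp: interval_system_def)
    have far: "q \<le> x \<or> y \<le> p" if "(p, q) \<in> D - {(x, y)}" for p q
      using interval_systemD[OF D, of p q x y] that xy by auto
    have sys: "interval_system D'"
    proof (rule interval_systemI)
      show "finite D'" using finD by (auto simp: D'_def L_def R_def)
      show "p < q" if "(p, q) \<in> D'" for p q
        using that ltD by (auto simp: D'_def L_def R_def split: if_splits)
      show "q \<le> p' \<or> q' \<le> p"
        if pq: "(p, q) \<in> D'" "(p', q') \<in> D'" "(p, q) \<noteq> (p', q')" for p q p' q'
      proof -
        have sub: "x \<le> c \<and> d \<le> y" if "(c, d) \<in> L \<union> R" for c d
          using that xy uv by (auto simp: L_def R_def split: if_splits)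
        consider "(p, q) \<in> D - {(x, y)}" "(p', q') \<in> D - {(x, y)}"
          | "(p, q) \<in> D - {(x, y)}" "(p', q') \<in> L \<union> R"
          | "(p, q) \<in> L \<union> R" "(p', q') \<in> D - {(x, y)}"
          | "(p, q) \<in> L \<union> R" "(p', q') \<in> L \<union> R"
          using pq unfolding D'_def by blast
        then show ?thesis
        proof cases
          case 1
          then show ?thesis using interval_systemD[OF D] pq by blast
        next
          case 2
          then show ?thesis using far[of p q] sub[of p' q'] by linarith
        next
          case 3
          then show ?thesis using far[of p' q'] sub[of p q] by linarith
        next
          case 4
          then show ?thesis using pq(3) uv by (auto simp: L_def R_def split: if_splits)
        qed
      qed
    qed
    have disj: "(D - {(x, y)}) \<inter> (L \<union> R) = {}"
    proof -
      have False if "(p, q) \<in> D - {(x, y)}" "(p, q) \<in> L \<union> R" for p q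
        using far[OF that(1)] that(2) ltD[of p q] that(1) xy uv
        by (auto simp: L_def R_def split: if_splits)
      then show ?thesis by auto
    qed
    have LR: "L \<inter> R = {}" using uv by (auto simp: L_def R_def)
    have incL: "increments F L = F u - F x" and incR: "increments F R = F y - F v" for F
      using xy by (auto simp: L_def R_def)
    have inc: "increments F D = increments F D' + (F v - F u)" for F
    proof -
      have "increments F D' = increments F (D - {(x, y)}) + increments F (L \<union> R)"
        unfolding D'_def by (rule sum.union_disjoint) (use finD disj in \<open>auto simp: L_def R_def\<close>)
      also have "increments F (L \<union> R) = increments F L + increments F R"
        by (rule sum.union_disjoint) (use LR in \<open>auto simp: L_def R_def\<close>)
      also have "increments F (D - {(x, y)}) = increments F D - (F y - F x)"
        using sum.remove[OF finD xy(1), of "\<lambda>(u, v). F v - F u"] by simp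
      finally show ?thesis using incL incR by simp
    qed
    show ?case
    proof (intro exI[of _ D'] conjI allI impI)
      show "interval_system D'" by (rule sys)
      show "\<forall>(u, v)\<in>D'. \<exists>(x, y)\<in>A. x \<le> u \<and> v \<le> y"
      proof safe
        fix p q assume "(p, q) \<in> D'"
        then have *: "(p, q) \<in> D \<or> (x \<le> p \<and> q \<le> y)"
          using xy uv by (auto simp: D'_def L_def R_def split: if_splits)
        obtain x' y' where "(x', y') \<in> A" "x' \<le> x" "y \<le> y'" using DA xy by blast
        from * show "\<exists>(x, y)\<in>A. x \<le> p \<and> q \<le> y"
        proof
          assume "x \<le> p \<and> q \<le> y"
          with \<open>(x', y') \<in> A\<close> \<open>x' \<le> x\<close> \<open>y \<le> y'\<close> show ?thesis by (intro bexI[of _ "(x', y')"]) auto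
        qed (use DA in blast)
      qed
      show "increments F A = increments F (insert b B) + increments F D'" for F
        using insert.hyps inc[of F] sums[rule_format, of F] b by simp
      fix s t
      assume st: "s < t \<and> (\<exists>(x, y)\<in>A. x \<le> s \<and> t \<le> y) \<and> (\<forall>(u, v)\<in>insert b B. t \<le> u \<or> v \<le> s)"
      then obtain x' y' where x'y': "(x', y') \<in> D" "x' \<le> s" "t \<le> y'"
        using cov[of s t] by blast
      show "\<exists>(x, y)\<in>D'. x \<le> s \<and> t \<le> y"
      proof (cases "(x', y') = (x, y)")
        case False
        then show ?thesis using x'y' by (auto simp: D'_def)
      next
        case True
        have "t \<le> u \<or> v \<le> s" using st b by auto
        then show ?thesis
        proof
          assume "t \<le> u"
          then have "(x, u) \<in> D'" using True x'y' st by (auto simp: D'_def L_def)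
          then show ?thesis using True x'y' \<open>t \<le> u\<close> by auto
        next
          assume "v \<le> s"
          then have "(v, y) \<in> D'" using True x'y' st by (auto simp: D'_def R_def)
          then show ?thesis using True x'y' \<open>v \<le> s\<close> by auto
        qed
      qed
    qed
  qed
  then obtain D where "interval_system D" "\<forall>(u, v)\<in>D. \<exists>(x, y)\<in>A. x \<le> u \<and> v \<le> y"
    "\<forall>F. increments F A = increments F B + increments F D"
    by blast
  then show ?thesis using that[of D] by blast
qed

text \<open>Vitali's theorem gives countably many disjoint closed intervals that cover S up to a
  null set. They lie in W, so their union has finite measure and finitely many of them exhaust it up
  to e; N takes the null set and the omitted intervals.\<close>

lemma Vitali_interval_systems:
  fixes K :: "(real \<times> real) set"
  assumes K: "\<And>u v. (u, v) \<in> K \<Longrightarrow> u < v \<and> {u..v} \<subseteq> W"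
    and W: "W \<in> lmeasurable"
    and fine: "\<And>x d. x \<in> S \<Longrightarrow> 0 < d \<Longrightarrow> \<exists>(u, v)\<in>K. u \<le> x \<and> x \<le> v \<and> v - u < d"
    and "0 < e"
  obtains C N where "interval_system C" "C \<subseteq> K" "S \<subseteq> (\<Union>(u, v)\<in>C. {u..v}) \<union> N"
    "N \<in> lmeasurable" "measure lebesgue N < e"
proof -
  let ?a = "\<lambda>(u, v). (u + v) / 2 :: real" and ?r = "\<lambda>(u, v). (v - u) / 2 :: real"
  let ?I = "\<lambda>(u, v). {u..v} :: real set"
  have cb: "cball (?a i) (?r i) = ?I i" for i
    by (cases i) (auto simp: cball_eq_atLeastAtMost field_simps)
  have "0 < ?r i" if "i \<in> K" for i using K that by (cases i) auto
  moreover have "\<exists>i. i \<in> K \<and> x \<in> cball (?a i) (?r i) \<and> ?r i < d" if xd: "x \<in> S" "0 < d" for x d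
  proof -
    obtain u v where "(u, v) \<in> K" "u \<le> x" "x \<le> v" "v - u < d" using fine[OF xd] by blast
    then show ?thesis using K[of u v] unfolding cb by (intro exI[of _ "(u, v)"]) auto
  qed
  ultimately obtain C where C: "countable C" "C \<subseteq> K"
    "pairwise (\<lambda>i j. disjnt (?I i) (?I j)) C" "negligible (S - (\<Union>i\<in>C. ?I i))"
    using Vitali_covering_theorem_cballs[of K ?r S ?a] unfolding cb by metis
  have meas: "d \<in> lmeasurable" if "d \<in> ?I ` C" for d using that by auto
  have sub: "\<Union>(?I ` C) \<subseteq> W" using K C(2) by fastforce
  have le: "measure lebesgue (\<Union>D') \<le> measure lebesgue W" if "D' \<subseteq> ?I ` C" "finite D'" for D'
    using that meas sub by (intro measure_mono_fmeasurable W) (blast intro: fmeasurable.finite_Union fmeasurableD)+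
  have mC: "\<Union>(?I ` C) \<in> lmeasurable"
    by (rule fmeasurableI2[OF W sub]) (use C(1) in \<open>auto intro!: sets.countable_UN'\<close>)
  obtain D' where D': "D' \<subseteq> ?I ` C" "finite D'"
    "measure lebesgue (\<Union>(?I ` C)) - e < measure lebesgue (\<Union>D')"
    using measure_countable_Union_approachable[of "?I ` C" e "measure lebesgue W"] C(1) \<open>0 < e\<close> meas le
    by (metis countable_image)
  obtain C0 where C0: "C0 \<subseteq> C" "finite C0" "D' = ?I ` C0"
    using finite_subset_image[OF D'(2,1)] by auto
  define N where "N = (S - (\<Union>i\<in>C. ?I i)) \<union> (\<Union>(?I ` C) - \<Union>D')"
  have mD: "\<Union>D' \<in> lmeasurable" using D' meas by (auto intro!: fmeasurable.finite_Union)
  have mN: "\<Union>(?I ` C) - \<Union>D' \<in> lmeasurable" using mC mD by (intro fmeasurable.Diff) auto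
  have DC: "\<Union>D' \<subseteq> \<Union>(?I ` C)" using D'(1) by blast
  show thesis
  proof
    show "interval_system C0"
    proof (rule interval_systemI)
      fix a b c d assume *: "(a, b) \<in> C0" "(c, d) \<in> C0" "(a, b) \<noteq> (c, d)"
      then have "disjnt (?I (a, b)) (?I (c, d))" using C(3) C0(1) unfolding pairwise_def by (metis subsetD)
      then have "disjnt {a..b} {c..d}" by simp
      moreover have "a < b" "c < d" using * C0 C(2) K by (meson subsetD)+
      ultimately show "b \<le> c \<or> d \<le> a"
        using open_interval_disjoint_iff[of a b c d] unfolding disjnt_def by fastforce
    next
      show "finite C0" by (rule C0(2))
      show "u < v" if "(u, v) \<in> C0" for u v using that C0(1) C(2) K by blast
    qed
    show "C0 \<subseteq> K" using C0 C by auto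
    show "S \<subseteq> (\<Union>(u, v)\<in>C0. {u..v}) \<union> N" unfolding N_def C0 by auto
    show "N \<in> lmeasurable" unfolding N_def
      using negligible_imp_measurable[OF C(4)] mN by (intro fmeasurable.Un)
    have "measure lebesgue N = measure lebesgue (\<Union>(?I ` C) - \<Union>D')"
      unfolding N_def by (rule measure_negligible_symdiff) (use C(4) mN in \<open>auto intro: negligible_subset\<close>)
    also have "\<dots> = measure lebesgue (\<Union>(?I ` C)) - measure lebesgue (\<Union>D')"
      using mC mD DC by (intro measurable_measure_Diff) auto
    finally show "measure lebesgue N < e" using D'(3) by simp
  qed
qed

section \<open>Interval systems and Lebesgue measure\<close>

lemma increments_le_measure:
  assumes C: "interval_system C" and W: "W \<in> lmeasurable"
    and sub: "\<And>u v. (u, v) \<in> C \<Longrightarrow> {u<..<v} \<subseteq> W"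
  shows "increments (\<lambda>x. x) C \<le> measure lebesgue W"
proof -
  have "increments (\<lambda>x. x) C = (\<Sum>i\<in>C. measure lebesgue (case i of (u, v) \<Rightarrow> {u<..<v}))"
    using C by (intro sum.cong) (auto simp: interval_system_def)
  also have "\<dots> = measure lebesgue (\<Union>i\<in>C. case i of (u, v) \<Rightarrow> {u<..<v})"
    by (rule measure_finite_Union[symmetric])
      (use C in \<open>auto simp: interval_system_def emeasure_lborel_Ioo dest: bspec\<close>)
  also have "\<dots> \<le> measure lebesgue W"
    by (rule measure_mono_fmeasurable) (use sub W C in \<open>auto simp: interval_system_def intro!: sets.finite_UN\<close>)
  finally show ?thesis .
qed

lemma measure_interval_system_le:
  assumes C: "interval_system C"
  shows "(\<Union>(u, v)\<in>C. {u..v}) \<in> lmeasurable"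
    "measure lebesgue (\<Union>(u, v)\<in>C. {u..v}) \<le> increments (\<lambda>x. x) C"
proof -
  have fin: "finite C" using C by (simp add: interval_system_def)
  show "(\<Union>(u, v)\<in>C. {u..v}) \<in> lmeasurable"
    by (rule fmeasurable.finite_UN[OF fin]) auto
  have "measure lebesgue (\<Union>i\<in>C. case i of (u, v) \<Rightarrow> {u..v}) \<le> (\<Sum>i\<in>C. measure lebesgue (case i of (u, v) \<Rightarrow> {u..v}))"
    by (rule measure_UNION_le[OF fin]) auto
  also have "\<dots> = increments (\<lambda>x. x) C"
    using C by (intro sum.cong) (auto simp: interval_system_def)
  finally show "measure lebesgue (\<Union>(u, v)\<in>C. {u..v}) \<le> increments (\<lambda>x. x) C" .
qed

lemma abs_cont_on_systemD:
  fixes F :: "real \<Rightarrow> real"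
  assumes "abs_cont_on S F" "0 < e"
  obtains d where "0 < d"
    "\<And>D. interval_system D \<Longrightarrow> (\<And>u v. (u, v) \<in> D \<Longrightarrow> {u..v} \<subseteq> S)
       \<Longrightarrow> increments (\<lambda>x. x) D < d \<Longrightarrow> (\<Sum>(u, v)\<in>D. \<bar>F v - F u\<bar>) < e"
proof -
  obtain d where d: "0 < d" "\<forall>D. finite D \<and> (\<forall>(a, b)\<in>D. a \<le> b \<and> {a..b} \<subseteq> S) \<and>
        disjoint_family_on (\<lambda>(a, b). {a<..<b}) D \<and> (\<Sum>(a, b)\<in>D. b - a) < d
        \<longrightarrow> (\<Sum>(a, b)\<in>D. norm (F b - F a)) < e"
    using assms(1)[unfolded abs_cont_on_def, THEN spec, THEN mp, OF assms(2)]
    by (elim exE conjE) (rule that)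
  show thesis
  proof (rule that[OF d(1)])
    fix D assume D: "interval_system D" "\<And>u v. (u, v) \<in> D \<Longrightarrow> {u..v} \<subseteq> S"
      "increments (\<lambda>x. x) D < d"
    have "\<forall>(a, b)\<in>D. a \<le> b \<and> {a..b} \<subseteq> S"
      using D(1,2) unfolding interval_system_def by fastforce
    then show "(\<Sum>(u, v)\<in>D. \<bar>F v - F u\<bar>) < e"
      using d(2)[rule_format, of D] D(1,3) by (simp add: interval_system_def)
  qed
qed

lemma abs_increments_le: "\<bar>increments F D\<bar> \<le> (\<Sum>(u, v)\<in>D. \<bar>F v - F u\<bar>)"
  using sum_abs[of "\<lambda>(u, v). F v - F u" D] by (simp add: case_prod_unfold)

text \<open>The intervals may contain x anywhere, end points included. This is the form a Vitali
  cover needs, and its negation controls both one-sided difference quotients at x.\<close>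

definition small_intervals :: "real \<Rightarrow> (real \<Rightarrow> real \<Rightarrow> bool) \<Rightarrow> bool" where
  "small_intervals x Q \<longleftrightarrow> (\<forall>d>0. \<exists>u v. u \<le> x \<and> x \<le> v \<and> u < v \<and> v - u < d \<and> Q u v)"

lemma small_intervals_in_open:
  assumes "small_intervals x Q" "open U" "x \<in> U" "0 < d"
  obtains u v where "u \<le> x" "x \<le> v" "u < v" "v - u < d" "{u..v} \<subseteq> U" "Q u v"
proof -
  obtain r where r: "0 < r" "ball x r \<subseteq> U" using assms openE by blast
  obtain u v where uv: "u \<le> x" "x \<le> v" "u < v" "v - u < min d r" "Q u v"
    using assms(1,4) r(1) unfolding small_intervals_def by (meson min_less_iff_conj)
  have "{u..v} \<subseteq> ball x r" using uv by (auto simp: dist_real_def)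
  then show thesis using that[of u v] uv r by auto
qed

lemma lmeasurable_outer_open:
  fixes S :: "'a::euclidean_space set"
  assumes S: "S \<in> lmeasurable" and e: "0 < e"
  obtains T where "open T" "S \<subseteq> T" "T \<in> lmeasurable" "measure lebesgue T < measure lebesgue S + e"
proof -
  obtain T where T: "open T" "S \<subseteq> T" "T - S \<in> lmeasurable" "emeasure lebesgue (T - S) < ennreal e"
    using sets_lebesgue_outer_open[of S e] S e by (auto simp: fmeasurable_def)
  have eq: "T = S \<union> (T - S)" using T by auto
  have "measure lebesgue (T - S) < e"
    using T(3,4) e by (simp add: emeasure_eq_measure2 ennreal_less_iff)
  moreover have "measure lebesgue T \<le> measure lebesgue S + measure lebesgue (T - S)"
    by (subst eq, rule measure_Un_le) (use S T in auto)
  ultimately show thesis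
    using that[of T] T eq fmeasurable.Un[OF S T(3)] by auto
qed

text \<open>Cover \<open>E\<close>, up to small measure, by disjoint intervals of slope at most \<open>-c\<close> whose total
  length is close to the outer measure \<open>s\<close> of \<open>E\<close>, and then, inside these, by disjoint intervals
  of slope at least \<open>c\<close>. The gaps have small total length but carry an increment of about
  \<open>-2cs\<close>, against absolute continuity.\<close>

lemma abs_cont_oscillation_negligible:
  fixes F :: "real \<Rightarrow> real"
  assumes F: "abs_cont_on {a..b} F" and c: "0 < c" and E: "E \<subseteq> {a<..<b}"
    and low: "\<And>x. x \<in> E \<Longrightarrow> small_intervals x (\<lambda>u v. F v - F u \<le> - c * (v - u))"
    and high: "\<And>x. x \<in> E \<Longrightarrow> small_intervals x (\<lambda>u v. F v - F u \<ge> c * (v - u))"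
  shows "negligible E"
proof -
  \<comment> \<open>E is not known to be measurable, so its outer measure s is taken as an infimum
    over measurable supersets.\<close>
  define M where "M = {measure lebesgue W | W. E \<subseteq> W \<and> W \<in> lmeasurable}"
  define s where "s = Inf M"
  have "E \<subseteq> {a<..<b} \<and> {a<..<b} \<in> lmeasurable" using E by auto
  then have "measure lebesgue {a<..<b} \<in> M" unfolding M_def by blast
  then have M: "M \<noteq> {}" "bdd_below M" by (auto simp: M_def intro!: bdd_belowI[of _ 0])
  have s_le: "s \<le> measure lebesgue W" if "E \<subseteq> W" "W \<in> lmeasurable" for W
    unfolding s_def by (rule cInf_lower[OF _ M(2)]) (use that in \<open>auto simp: M_def\<close>)
  have "s \<ge> 0" unfolding s_def by (rule cInf_greatest[OF M(1)]) (auto simp: M_def)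
  have s_gt: "\<exists>W. E \<subseteq> W \<and> W \<in> lmeasurable \<and> measure lebesgue W < s + e" if "0 < e" for e
    using cInf_lessD[OF M(1), of "s + e"] that unfolding s_def M_def by auto
  show ?thesis
  proof (cases "s = 0")
    case True
    then show ?thesis using s_gt unfolding negligible_outer by auto
  next
    case False
    with \<open>s \<ge> 0\<close> have "s > 0" by simp
    obtain \<delta> where "0 < \<delta>" and \<delta>: "\<And>D. interval_system D \<Longrightarrow> (\<And>u v. (u, v) \<in> D \<Longrightarrow> {u..v} \<subseteq> {a..b})
       \<Longrightarrow> increments (\<lambda>x. x) D < \<delta> \<Longrightarrow> (\<Sum>(u, v)\<in>D. \<bar>F v - F u\<bar>) < c * s"
      using abs_cont_on_systemD[OF F, of "c * s"] \<open>s > 0\<close> c by (metis mult_pos_pos)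
    \<comment> \<open>The gaps have length less than (s + e) - (s - 2e) = 3e, which must stay below
      \<delta>; the two coverings together have length at least 2s - 3e, which must exceed
      s.\<close>
    define e where "e = min (\<delta> / 4) (s / 8)"
    have e: "0 < e" "3 * e < \<delta>" "3 * e < s" using \<open>0 < \<delta>\<close> \<open>s > 0\<close> by (auto simp: e_def min_def)
    obtain W0 where W0: "E \<subseteq> W0" "W0 \<in> lmeasurable" "measure lebesgue W0 < s + e / 2"
      using s_gt[of "e / 2"] e by auto
    obtain W where W: "open W" "W0 \<subseteq> W" "W \<in> lmeasurable" "measure lebesgue W < measure lebesgue W0 + e / 2"
      using lmeasurable_outer_open[OF W0(2), of "e / 2"] e by auto
    define U where "U = W \<inter> {a<..<b}"
    have U: "open U" "E \<subseteq> U" "U \<in> lmeasurable" "U \<subseteq> {a..b}"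
      using W W0 E by (auto simp: U_def intro!: fmeasurable.Int)
    have "measure lebesgue U \<le> measure lebesgue W"
      by (rule measure_mono_fmeasurable) (use U W in \<open>auto simp: U_def\<close>)
    with W W0 have mU: "measure lebesgue U < s + e" by simp
    define K1 where "K1 = {(u, v). u < v \<and> {u..v} \<subseteq> U \<and> F v - F u \<le> - c * (v - u)}"
    have fine1: "\<exists>(u, v)\<in>K1. u \<le> x \<and> x \<le> v \<and> v - u < d" if xd: "x \<in> E" "0 < d" for x d
      using small_intervals_in_open[OF low[OF xd(1)] U(1) _ xd(2)] U(2) xd(1)
      unfolding K1_def by (smt (verit) case_prodI mem_Collect_eq subsetD)
    obtain C1 N1 where C1: "interval_system C1" "C1 \<subseteq> K1" "E \<subseteq> (\<Union>(u, v)\<in>C1. {u..v}) \<union> N1"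
      "N1 \<in> lmeasurable" "measure lebesgue N1 < e"
      by (rule Vitali_interval_systems[OF _ U(3) fine1 e(1)]) (auto simp: K1_def)
    \<comment> \<open>Only interior points of the intervals in \<open>C1\<close> are kept, so that
      short intervals around them stay inside one of these; the finitely many end points are
      restored as a null set in \<open>len2\<close>.\<close>
    define S2 where "S2 = E \<inter> (\<Union>(u, v)\<in>C1. {u<..<v})"
    define K2 where "K2 = {(u, v). u < v \<and> (\<exists>(x, y)\<in>C1. {u..v} \<subseteq> {x<..<y}) \<and> F v - F u \<ge> c * (v - u)}"
    have K2U: "u < v \<and> {u..v} \<subseteq> U" if uv: "(u, v) \<in> K2" for u v
    proof -
      obtain x y where "(x, y) \<in> C1" "{u..v} \<subseteq> {x<..<y}" "u < v" using uv unfolding K2_def by blast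
      moreover from this have "{x..y} \<subseteq> U" using C1(2) unfolding K1_def by auto
      ultimately show ?thesis by force
    qed
    have fine2: "\<exists>(u, v)\<in>K2. u \<le> x \<and> x \<le> v \<and> v - u < d" if xd: "x \<in> S2" "0 < d" for x d
    proof -
      obtain p q where pq: "(p, q) \<in> C1" "x \<in> {p<..<q}" and "x \<in> E" using xd unfolding S2_def by blast
      obtain u v where "u \<le> x" "x \<le> v" "u < v" "v - u < d" "{u..v} \<subseteq> {p<..<q}" "F v - F u \<ge> c * (v - u)"
        by (rule small_intervals_in_open[OF high[OF \<open>x \<in> E\<close>] _ pq(2) xd(2)]) auto
      then show ?thesis using pq(1) unfolding K2_def by (intro bexI[of _ "(u, v)"]) auto
    qed
    obtain C2 N2 where C2: "interval_system C2" "C2 \<subseteq> K2" "S2 \<subseteq> (\<Union>(u, v)\<in>C2. {u..v}) \<union> N2"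
      "N2 \<in> lmeasurable" "measure lebesgue N2 < e"
      by (rule Vitali_interval_systems[OF K2U U(3) fine2 e(1)])
    have in1: "increments F C1 \<le> - c * increments (\<lambda>x. x) C1"
      unfolding sum_distrib_left by (rule sum_mono) (use C1(2) in \<open>auto simp: K1_def\<close>)
    have in2: "increments F C2 \<ge> c * increments (\<lambda>x. x) C2"
      unfolding sum_distrib_left by (rule sum_mono) (use C2(2) in \<open>auto simp: K2_def\<close>)
    have len1: "increments (\<lambda>x. x) C1 < s + e"
    proof -
      have "increments (\<lambda>x. x) C1 \<le> measure lebesgue U"
      proof (rule increments_le_measure[OF C1(1) U(3)])
        fix u v assume "(u, v) \<in> C1"
        then have "{u..v} \<subseteq> U" using C1(2) unfolding K1_def by auto
        then show "{u<..<v} \<subseteq> U" by (meson greaterThanLessThan_subseteq_atLeastAtMost_iff order_trans order_refl)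
      qed
      then show ?thesis using mU by simp
    qed
    have len1': "s \<le> increments (\<lambda>x. x) C1 + e"
    proof -
      have "s \<le> measure lebesgue ((\<Union>(u, v)\<in>C1. {u..v}) \<union> N1)"
        by (rule s_le[OF C1(3)]) (intro fmeasurable.Un measure_interval_system_le C1)
      also have "\<dots> \<le> measure lebesgue (\<Union>(u, v)\<in>C1. {u..v}) + measure lebesgue N1"
        by (rule measure_Un_le) (use C1 measure_interval_system_le(1)[OF C1(1)] in auto)
      finally show ?thesis using measure_interval_system_le(2)[OF C1(1)] C1(5) by simp
    qed
    have len2: "s \<le> increments (\<lambda>x. x) C2 + 2 * e"
    proof -
      let ?P = "(\<lambda>(u, v). u) ` C1 \<union> (\<lambda>(u, v). v) ` C1"
      have "finite ?P" using C1(1) by (auto simp: interval_system_def)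
      then have P: "?P \<in> lmeasurable" "measure lebesgue ?P = 0"
        by (auto intro: negligible_imp_measurable negligible_imp_measure0 negligible_finite)
      have "E \<subseteq> (\<Union>(u, v)\<in>C2. {u..v}) \<union> (N2 \<union> (N1 \<union> ?P))"
      proof
        fix x assume x: "x \<in> E"
        show "x \<in> (\<Union>(u, v)\<in>C2. {u..v}) \<union> (N2 \<union> (N1 \<union> ?P))"
        proof (cases "x \<in> N1")
          case False
          then obtain u v where uv: "(u, v) \<in> C1" "x \<in> {u..v}" using C1(3) x by blast
          show ?thesis
          proof (cases "x = u \<or> x = v")
            case True
            then have "x \<in> ?P" using uv(1) by force
            then show ?thesis by blast
          next
            case False
            then have "x \<in> {u<..<v}" using uv by auto
            then have "x \<in> S2" using x uv(1) unfolding S2_def by blast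
            then show ?thesis using C2(3) by blast
          qed
        qed auto
      qed
      then have "s \<le> measure lebesgue ((\<Union>(u, v)\<in>C2. {u..v}) \<union> (N2 \<union> (N1 \<union> ?P)))"
        by (rule s_le) (intro fmeasurable.Un measure_interval_system_le C1 C2 P)
      also have "\<dots> \<le> measure lebesgue (\<Union>(u, v)\<in>C2. {u..v}) + measure lebesgue (N2 \<union> (N1 \<union> ?P))"
        by (rule measure_Un_le) (use C1 C2 P measure_interval_system_le(1)[OF C2(1)] in \<open>auto intro!: sets.Un\<close>)
      also have "measure lebesgue (N2 \<union> (N1 \<union> ?P)) \<le> measure lebesgue N2 + measure lebesgue (N1 \<union> ?P)"
        by (rule measure_Un_le) (use C1 C2 P in \<open>auto intro!: sets.Un\<close>)
      also have "measure lebesgue (N1 \<union> ?P) \<le> measure lebesgue N1 + measure lebesgue ?P"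
        by (rule measure_Un_le) (use C1 C2 P in auto)
      finally show ?thesis using measure_interval_system_le(2)[OF C2(1)] C1(5) C2(5) P(2) by simp
    qed
    obtain D where D: "interval_system D" "\<And>u v. (u, v) \<in> D \<Longrightarrow> \<exists>(x, y)\<in>C1. x \<le> u \<and> v \<le> y"
      and Dsum: "\<And>G. increments G C1 = increments G C2 + increments G D"
    proof (rule interval_system_gaps[OF C1(1) C2(1)], goal_cases)
      case (1 u v)
      then have "(u, v) \<in> C2" by simp
      then obtain x y where xy: "(x, y) \<in> C1" "{u..v} \<subseteq> {x<..<y}" "u < v" using C2(2) unfolding K2_def by blast
      then have "u \<in> {x<..<y}" "v \<in> {x<..<y}" by (meson atLeastAtMost_iff less_imp_le order_refl subsetD)+
      then have "x < u" "v < y" by auto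
      then show ?case using xy(1) by (intro bexI[of _ "(x, y)"]) auto
    next
      case (2 D)
      show ?case by (rule 2(1)) (use 2 in blast)+
    qed
    have "(\<Sum>(u, v)\<in>D. \<bar>F v - F u\<bar>) < c * s"
    proof (rule \<delta>[OF D(1)])
      fix u v assume "(u, v) \<in> D"
      then obtain x y where xy: "(x, y) \<in> C1" "x \<le> u" "v \<le> y" using D(2) by blast
      then have "{x..y} \<subseteq> U" using C1(2) unfolding K1_def by auto
      then have "{x..y} \<subseteq> {a..b}" using U(4) by (rule order_trans)
      then show "{u..v} \<subseteq> {a..b}" using xy by auto
    next
      show "increments (\<lambda>x. x) D < \<delta>" using Dsum[of "\<lambda>x. x"] len1 len2 e by linarith
    qed
    then have "- (c * s) < increments F D" using abs_increments_le[of F D] by linarith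
    also have "\<dots> \<le> - c * increments (\<lambda>x. x) C1 - c * increments (\<lambda>x. x) C2"
      using Dsum[of F] in1 in2 by linarith
    also have "\<dots> = - c * (increments (\<lambda>x. x) C1 + increments (\<lambda>x. x) C2)" by (simp add: algebra_simps)
    also have "\<dots> \<le> - c * s" using len1' len2 e c by simp
    finally show ?thesis by simp
  qed
qed

text \<open>In a window shorter than \<delta> any interval system has variation below 1. Intervals
  of absolute slope at least 2/e then have total length below e/2, and the part that the Vitali
  cover misses has measure below e/2.\<close>

lemma abs_cont_infinite_slope_negligible:
  fixes F :: "real \<Rightarrow> real"
  assumes F: "abs_cont_on {a..b} F" and E: "E \<subseteq> {a<..<b}"
    and steep: "\<And>x n. x \<in> E \<Longrightarrow> small_intervals x (\<lambda>u v. \<bar>F v - F u\<bar> \<ge> n * (v - u))"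
  shows "negligible E"
proof -
  obtain \<delta> where "0 < \<delta>" and \<delta>: "\<And>D. interval_system D \<Longrightarrow> (\<And>u v. (u, v) \<in> D \<Longrightarrow> {u..v} \<subseteq> {a..b})
       \<Longrightarrow> increments (\<lambda>x. x) D < \<delta> \<Longrightarrow> (\<Sum>(u, v)\<in>D. \<bar>F v - F u\<bar>) < 1"
    using abs_cont_on_systemD[OF F, of 1] by auto
  have "\<exists>V. openin (top_of_set E) V \<and> x \<in> V \<and> negligible V" if "x \<in> E" for x
  proof (intro exI[of _ "E \<inter> ({x - \<delta>/4<..<x + \<delta>/4} \<inter> {a<..<b})"] conjI)
    let ?U = "{x - \<delta>/4<..<x + \<delta>/4} \<inter> {a<..<b}"
    have U: "open ?U" "?U \<in> lmeasurable" by (auto intro!: fmeasurable.Int)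
    show "openin (top_of_set E) (E \<inter> ?U)" using U(1) by blast
    show "x \<in> E \<inter> ?U" using that E \<open>0 < \<delta>\<close> by auto
    have "measure lebesgue ?U \<le> measure lebesgue {x - \<delta>/4<..<x + \<delta>/4}"
      by (rule measure_mono_fmeasurable) auto
    with \<open>0 < \<delta>\<close> have mU: "measure lebesgue ?U < \<delta>" by simp
    show "negligible (E \<inter> ?U)" unfolding negligible_outer
    proof (intro allI impI)
      fix e :: real assume "e > 0"
      define K where "K = {(u, v). u < v \<and> {u..v} \<subseteq> ?U \<and> \<bar>F v - F u\<bar> \<ge> 2 / e * (v - u)}"
      have fine: "\<exists>(u, v)\<in>K. u \<le> x \<and> x \<le> v \<and> v - u < d" if xd: "x \<in> E \<inter> ?U" "0 < d" for x d
      proof -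
        have xE: "x \<in> E" and xU: "x \<in> ?U" using xd(1) by auto
        obtain u v where "u \<le> x" "x \<le> v" "u < v" "v - u < d" "{u..v} \<subseteq> ?U" "\<bar>F v - F u\<bar> \<ge> 2 / e * (v - u)"
          by (rule small_intervals_in_open[OF steep[OF xE, of "2 / e"] U(1) xU xd(2)])
        then show ?thesis unfolding K_def by (intro bexI[of _ "(u, v)"]) auto
      qed
      have "0 < e / 2" using \<open>e > 0\<close> by simp
      have KU: "u < v \<and> {u..v} \<subseteq> ?U" if "(u, v) \<in> K" for u v
        using that unfolding K_def by blast
      obtain C N where C: "interval_system C" "C \<subseteq> K" "E \<inter> ?U \<subseteq> (\<Union>(u, v)\<in>C. {u..v}) \<union> N"
        "N \<in> lmeasurable" "measure lebesgue N < e / 2"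
        by (rule Vitali_interval_systems[where S = "E \<inter> ?U", OF KU U(2) fine \<open>0 < e / 2\<close>])
      have CU: "{u..v} \<subseteq> ?U" if "(u, v) \<in> C" for u v
        using C(2) that unfolding K_def by auto
      have "increments (\<lambda>x. x) C \<le> measure lebesgue ?U"
        by (rule increments_le_measure[OF C(1) U(2)])
          (meson CU greaterThanLessThan_subseteq_atLeastAtMost_iff order_trans order_refl)
      then have "increments (\<lambda>x. x) C < \<delta>" using mU by simp
      then have "(\<Sum>(u, v)\<in>C. \<bar>F v - F u\<bar>) < 1"
        by (intro \<delta>[OF C(1)] order_trans[OF CU]) auto
      moreover have "2 / e * increments (\<lambda>x. x) C \<le> (\<Sum>(u, v)\<in>C. \<bar>F v - F u\<bar>)"
        unfolding sum_distrib_left by (rule sum_mono) (use C(2) in \<open>auto simp: K_def\<close>)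
      ultimately have "2 / e * increments (\<lambda>x. x) C < 1" by linarith
      then have len: "increments (\<lambda>x. x) C < e / 2" using \<open>e > 0\<close> by (simp add: field_simps)
      show "\<exists>T. E \<inter> ?U \<subseteq> T \<and> T \<in> lmeasurable \<and> measure lebesgue T < e"
      proof (intro exI conjI)
        show "E \<inter> ?U \<subseteq> (\<Union>(u, v)\<in>C. {u..v}) \<union> N" by (rule C(3))
        show "(\<Union>(u, v)\<in>C. {u..v}) \<union> N \<in> lmeasurable"
          by (intro fmeasurable.Un measure_interval_system_le C)
        have "measure lebesgue ((\<Union>(u, v)\<in>C. {u..v}) \<union> N)
              \<le> measure lebesgue (\<Union>(u, v)\<in>C. {u..v}) + measure lebesgue N"
          by (rule measure_Un_le) (use C measure_interval_system_le(1)[OF C(1)] in auto)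
        then show "measure lebesgue ((\<Union>(u, v)\<in>C. {u..v}) \<union> N) < e"
          using measure_interval_system_le(2)[OF C(1)] len C(5) by linarith
      qed
    qed
  qed
  then show ?thesis using locally_negligible_alt by blast
qed

section \<open>Operations that preserve absolute continuity\<close>

lemma abs_cont_on_lipschitz_image:
  fixes f :: "real \<Rightarrow> 'a::real_normed_vector" and g :: "real \<Rightarrow> 'b::real_normed_vector"
  assumes f: "abs_cont_on S f" and B: "0 \<le> B"
    and le: "\<And>u v. u \<in> S \<Longrightarrow> v \<in> S \<Longrightarrow> u \<le> v \<Longrightarrow> norm (g v - g u) \<le> B * (norm (f v - f u) + (v - u))"
  shows "abs_cont_on S g"
  unfolding abs_cont_on_def
proof (intro allI impI)
  fix e :: real assume "0 < e"
  \<comment> \<open>The two halves of e pay for the variation of f and for the total length; the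
    length term in \<open>le\<close> is what admits affine terms in t. The summand 1 allows B =
    0.\<close>
  define e' where "e' = e / (2 * (B + 1))"
  have "0 < e'" using \<open>0 < e\<close> B by (simp add: e'_def)
  then obtain d where d: "0 < d" "\<forall>D. finite D \<and> (\<forall>(a, b)\<in>D. a \<le> b \<and> {a..b} \<subseteq> S) \<and>
        disjoint_family_on (\<lambda>(a, b). {a<..<b}) D \<and> (\<Sum>(a, b)\<in>D. b - a) < d
        \<longrightarrow> (\<Sum>(a, b)\<in>D. norm (f b - f a)) < e'"
    using f[unfolded abs_cont_on_def, THEN spec, THEN mp, OF \<open>0 < e'\<close>] by blast
  show "\<exists>d>0. \<forall>D. finite D \<and> (\<forall>(a, b)\<in>D. a \<le> b \<and> {a..b} \<subseteq> S) \<and>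
        disjoint_family_on (\<lambda>(a, b). {a<..<b}) D \<and> (\<Sum>(a, b)\<in>D. b - a) < d
        \<longrightarrow> (\<Sum>(a, b)\<in>D. norm (g b - g a)) < e"
  proof (intro exI[of _ "min d e'"] conjI allI impI)
    show "0 < min d e'" using d \<open>0 < e'\<close> by simp
    fix D assume D: "finite D \<and> (\<forall>(a, b)\<in>D. a \<le> b \<and> {a..b} \<subseteq> S) \<and>
        disjoint_family_on (\<lambda>(a, b). {a<..<b}) D \<and> (\<Sum>(a, b)\<in>D. b - a) < min d e'"
    then have small: "(\<Sum>(a, b)\<in>D. norm (f b - f a)) < e'" "(\<Sum>(a, b)\<in>D. b - a) < e'"
      using d(2) by auto
    have "(\<Sum>(a, b)\<in>D. norm (g b - g a)) \<le> (\<Sum>(a, b)\<in>D. B * (norm (f b - f a) + (b - a)))"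
      by (rule sum_mono) (use D le in fastforce)
    also have "\<dots> = B * ((\<Sum>(a, b)\<in>D. norm (f b - f a)) + (\<Sum>(a, b)\<in>D. b - a))"
      by (simp add: sum_distrib_left sum.distrib distrib_left case_prod_unfold)
    also have "\<dots> \<le> B * (e' + e')"
      using small B by (intro mult_left_mono) auto
    also have "\<dots> < (B + 1) * (e' + e')" using \<open>0 < e'\<close> by simp
    also have "\<dots> = e"
    proof -
      have "c \<noteq> 0 \<Longrightarrow> c * (e / (2 * c) + e / (2 * c)) = e" for c by (simp add: field_simps)
      from this[of "B + 1"] show ?thesis unfolding e'_def using B by linarith
    qed
    finally show "(\<Sum>(a, b)\<in>D. norm (g b - g a)) < e" .
  qed
qed

lemma abs_cont_on_bounded_linear:
  assumes "bounded_linear L" "abs_cont_on S f"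
  shows "abs_cont_on S (\<lambda>t. c + t *\<^sub>R w + L (f t))"
proof -
  obtain K where K: "0 < K" "\<And>x. norm (L x) \<le> norm x * K"
    using bounded_linear.pos_bounded[OF assms(1)] by blast
  show ?thesis
  proof (rule abs_cont_on_lipschitz_image[OF assms(2), of "K + norm w"])
    fix u v assume "u \<in> S" "v \<in> S" "u \<le> v"
    have "norm (c + v *\<^sub>R w + L (f v) - (c + u *\<^sub>R w + L (f u))) = norm ((v - u) *\<^sub>R w + L (f v - f u))"
      by (simp add: bounded_linear.linear[OF assms(1)] linear_diff scaleR_left_diff_distrib algebra_simps)
    also have "\<dots> \<le> (v - u) * norm w + norm (f v - f u) * K"
      using norm_triangle_ineq[of "(v - u) *\<^sub>R w" "L (f v - f u)"] K(2)[of "f v - f u"] \<open>u \<le> v\<close> by simp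
    also have "\<dots> \<le> (K + norm w) * (norm (f v - f u) + (v - u))"
    proof -
      have "0 \<le> K * (v - u) + norm w * norm (f v - f u)" using K(1) \<open>u \<le> v\<close> by simp
      moreover have "(K + norm w) * (norm (f v - f u) + (v - u)) =
          (v - u) * norm w + norm (f v - f u) * K + (K * (v - u) + norm w * norm (f v - f u))"
        by algebra
      ultimately show ?thesis by linarith
    qed
    finally show "norm (c + v *\<^sub>R w + L (f v) - (c + u *\<^sub>R w + L (f u)))
        \<le> (K + norm w) * (norm (f v - f u) + (v - u))" .
  qed (use K in simp)
qed

lemma abs_cont_on_linear_image:
  assumes "bounded_linear L" "abs_cont_on S f"
  shows "abs_cont_on S (\<lambda>t. L (f t))"
  using abs_cont_on_bounded_linear[OF assms, of 0 0] by simp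

lemma abs_cont_on_subset:
  assumes "abs_cont_on S f" "T \<subseteq> S"
  shows "abs_cont_on T f"
  unfolding abs_cont_on_def
proof (intro allI impI)
  fix e :: real assume "0 < e"
  obtain d where d: "0 < d" "\<forall>D. finite D \<and> (\<forall>(a, b)\<in>D. a \<le> b \<and> {a..b} \<subseteq> S) \<and>
        disjoint_family_on (\<lambda>(a, b). {a<..<b}) D \<and> (\<Sum>(a, b)\<in>D. b - a) < d
        \<longrightarrow> (\<Sum>(a, b)\<in>D. norm (f b - f a)) < e"
    using assms(1)[unfolded abs_cont_on_def, THEN spec, THEN mp, OF \<open>0 < e\<close>] by blast
  show "\<exists>d>0. \<forall>D. finite D \<and> (\<forall>(a, b)\<in>D. a \<le> b \<and> {a..b} \<subseteq> T) \<and>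
        disjoint_family_on (\<lambda>(a, b). {a<..<b}) D \<and> (\<Sum>(a, b)\<in>D. b - a) < d
        \<longrightarrow> (\<Sum>(a, b)\<in>D. norm (f b - f a)) < e"
  proof (intro exI[of _ d] conjI allI impI)
    fix D assume D: "finite D \<and> (\<forall>(a, b)\<in>D. a \<le> b \<and> {a..b} \<subseteq> T) \<and>
        disjoint_family_on (\<lambda>(a, b). {a<..<b}) D \<and> (\<Sum>(a, b)\<in>D. b - a) < d"
    then have "\<forall>(a, b)\<in>D. a \<le> b \<and> {a..b} \<subseteq> S" using assms(2) by fast
    with D d(2) show "(\<Sum>(a, b)\<in>D. norm (f b - f a)) < e" by blast
  qed (rule d(1))
qed

lemma abs_cont_on_cong:
  assumes "abs_cont_on S f" "\<And>t. t \<in> S \<Longrightarrow> f t = g t"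
  shows "abs_cont_on S g"
  by (rule abs_cont_on_lipschitz_image[OF assms(1), of 1]) (use assms(2) in auto)

lemma abs_cont_on_Pair:
  assumes "abs_cont_on S f" "abs_cont_on S g"
  shows "abs_cont_on S (\<lambda>t. (f t, g t))"
  unfolding abs_cont_on_def
proof (intro allI impI)
  fix e :: real assume "0 < e"
  then have e2: "0 < e / 2" by simp
  obtain d1 where d1: "0 < d1" "\<forall>D. finite D \<and> (\<forall>(a, b)\<in>D. a \<le> b \<and> {a..b} \<subseteq> S) \<and>
        disjoint_family_on (\<lambda>(a, b). {a<..<b}) D \<and> (\<Sum>(a, b)\<in>D. b - a) < d1
        \<longrightarrow> (\<Sum>(a, b)\<in>D. norm (f b - f a)) < e / 2"
    using assms(1)[unfolded abs_cont_on_def, THEN spec, THEN mp, OF e2] by blast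
  obtain d2 where d2: "0 < d2" "\<forall>D. finite D \<and> (\<forall>(a, b)\<in>D. a \<le> b \<and> {a..b} \<subseteq> S) \<and>
        disjoint_family_on (\<lambda>(a, b). {a<..<b}) D \<and> (\<Sum>(a, b)\<in>D. b - a) < d2
        \<longrightarrow> (\<Sum>(a, b)\<in>D. norm (g b - g a)) < e / 2"
    using assms(2)[unfolded abs_cont_on_def, THEN spec, THEN mp, OF e2] by blast
  show "\<exists>d>0. \<forall>D. finite D \<and> (\<forall>(a, b)\<in>D. a \<le> b \<and> {a..b} \<subseteq> S) \<and>
        disjoint_family_on (\<lambda>(a, b). {a<..<b}) D \<and> (\<Sum>(a, b)\<in>D. b - a) < d
        \<longrightarrow> (\<Sum>(a, b)\<in>D. norm ((f b, g b) - (f a, g a))) < e"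
  proof (intro exI[of _ "min d1 d2"] conjI allI impI)
    fix D assume D: "finite D \<and> (\<forall>(a, b)\<in>D. a \<le> b \<and> {a..b} \<subseteq> S) \<and>
        disjoint_family_on (\<lambda>(a, b). {a<..<b}) D \<and> (\<Sum>(a, b)\<in>D. b - a) < min d1 d2"
    have "(\<Sum>(a, b)\<in>D. norm ((f b, g b) - (f a, g a)))
        \<le> (\<Sum>(a, b)\<in>D. norm (f b - f a) + norm (g b - g a))"
      by (rule sum_mono) (auto intro: norm_Pair_le)
    also have "\<dots> = (\<Sum>(a, b)\<in>D. norm (f b - f a)) + (\<Sum>(a, b)\<in>D. norm (g b - g a))"
      by (simp add: sum.distrib case_prod_unfold)
    also have "\<dots> < e / 2 + e / 2"
      using d1(2)[THEN spec[of _ D]] d2(2)[THEN spec[of _ D]] D by (intro add_strict_mono) simp_all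
    finally show "(\<Sum>(a, b)\<in>D. norm ((f b, g b) - (f a, g a))) < e" by simp
  qed (use d1 d2 in simp)
qed

lemma abs_cont_on_reverse:
  fixes f :: "real \<Rightarrow> 'a::real_normed_vector"
  assumes "abs_cont_on {0..T} f"
  shows "abs_cont_on {0..T} (\<lambda>t. f (T - t))"
  unfolding abs_cont_on_def
proof (intro allI impI)
  fix e :: real assume "0 < e"
  obtain d where d: "0 < d" "\<forall>D. finite D \<and> (\<forall>(a, b)\<in>D. a \<le> b \<and> {a..b} \<subseteq> {0..T}) \<and>
        disjoint_family_on (\<lambda>(a, b). {a<..<b}) D \<and> (\<Sum>(a, b)\<in>D. b - a) < d
        \<longrightarrow> (\<Sum>(a, b)\<in>D. norm (f b - f a)) < e"
    using assms(1)[unfolded abs_cont_on_def, THEN spec, THEN mp, OF \<open>0 < e\<close>] by blast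
  show "\<exists>d>0. \<forall>D. finite D \<and> (\<forall>(a, b)\<in>D. a \<le> b \<and> {a..b} \<subseteq> {0..T}) \<and>
        disjoint_family_on (\<lambda>(a, b). {a<..<b}) D \<and> (\<Sum>(a, b)\<in>D. b - a) < d
        \<longrightarrow> (\<Sum>(a, b)\<in>D. norm (f (T - b) - f (T - a))) < e"
  proof (intro exI[of _ d] conjI allI impI)
    fix D assume D: "finite D \<and> (\<forall>(a, b)\<in>D. a \<le> b \<and> {a..b} \<subseteq> {0..T}) \<and>
        disjoint_family_on (\<lambda>(a, b). {a<..<b}) D \<and> (\<Sum>(a, b)\<in>D. b - a) < d"
    define R where "R = (\<lambda>(a, b). (T - b, T - a) :: real \<times> real)"
    have inj: "inj_on R D" by (auto simp: R_def inj_on_def)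
    have 1: "\<forall>(a, b)\<in>R ` D. a \<le> b \<and> {a..b} \<subseteq> {0..T}"
      using D by (fastforce simp: R_def)
    have 2: "disjoint_family_on (\<lambda>(a, b). {a<..<b}) (R ` D)"
      unfolding disjoint_family_on_def
    proof (intro ballI impI)
      fix p q assume "p \<in> R ` D" "q \<in> R ` D" "p \<noteq> q"
      then obtain a b a' b' where *: "(a, b) \<in> D" "p = (T - b, T - a)" "(a', b') \<in> D" "q = (T - b', T - a')"
        "(a, b) \<noteq> (a', b')" by (auto simp: R_def)
      then have dj: "{a<..<b} \<inter> {a'<..<b'} = {}"
        using D unfolding disjoint_family_on_def by fastforce
      have "x \<notin> {T - b<..<T - a} \<inter> {T - b'<..<T - a'}" for x
      proof
        assume "x \<in> {T - b<..<T - a} \<inter> {T - b'<..<T - a'}"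
        then have "T - x \<in> {a<..<b} \<inter> {a'<..<b'}" by auto
        then show False using dj by blast
      qed
      then show "(case p of (a, b) \<Rightarrow> {a<..<b}) \<inter> (case q of (a, b) \<Rightarrow> {a<..<b}) = {}"
        unfolding * by blast
    qed
    have 3: "(\<Sum>(a, b)\<in>R ` D. b - a) = (\<Sum>(a, b)\<in>D. b - a)"
      by (subst sum.reindex[OF inj]) (auto simp: R_def case_prod_unfold intro!: sum.cong)
    have 4: "(\<Sum>(a, b)\<in>R ` D. norm (f b - f a)) = (\<Sum>(a, b)\<in>D. norm (f (T - b) - f (T - a)))"
      by (subst sum.reindex[OF inj]) (auto simp: R_def case_prod_unfold norm_minus_commute intro!: sum.cong)
    have "finite (R ` D)" using D by simp
    then show "(\<Sum>(a, b)\<in>D. norm (f (T - b) - f (T - a))) < e"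
      using d(2)[rule_format, of "R ` D"] D 1 2 unfolding 3 4 by blast
  qed (rule d(1))
qed

lemma abs_cont_on_imp_continuous_on:
  fixes f :: "real \<Rightarrow> 'a::real_normed_vector"
  assumes "abs_cont_on {a..b} f"
  shows "continuous_on {a..b} f"
  unfolding continuous_on_iff
proof (intro ballI allI impI)
  fix x and e :: real assume x: "x \<in> {a..b}" and "0 < e"
  obtain d where d: "0 < d" "\<forall>D. finite D \<and> (\<forall>(u, v)\<in>D. u \<le> v \<and> {u..v} \<subseteq> {a..b}) \<and>
        disjoint_family_on (\<lambda>(u, v). {u<..<v}) D \<and> (\<Sum>(u, v)\<in>D. v - u) < d
        \<longrightarrow> (\<Sum>(u, v)\<in>D. norm (f v - f u)) < e"
    using assms(1)[unfolded abs_cont_on_def, THEN spec, THEN mp, OF \<open>0 < e\<close>] by blast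
  have *: "norm (f v - f u) < e" if "u \<le> v" "u \<in> {a..b}" "v \<in> {a..b}" "v - u < d" for u v
    using d(2)[rule_format, of "{(u, v)}"] that by (simp add: disjoint_family_on_def)
  show "\<exists>d>0. \<forall>x'\<in>{a..b}. dist x' x < d \<longrightarrow> dist (f x') (f x) < e"
  proof (intro exI[of _ d] conjI ballI impI)
    fix y assume "y \<in> {a..b}" "dist y x < d"
    then show "dist (f y) (f x) < e"
      using *[of x y] *[of y x] x by (cases "x \<le> y") (auto simp: dist_norm norm_minus_commute)
  qed (rule d(1))
qed

section \<open>Differentiability almost everywhere and the fundamental theorem\<close>

lemma abs_cont_real_differentiable_AE:
  fixes F :: "real \<Rightarrow> real"
  assumes F: "abs_cont_on {a..b} F"
  shows "negligible {x\<in>{a..b}. \<not> F differentiable (at x)}"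
proof -
  \<comment> \<open>At a bad interior point the difference quotients are either unbounded
    (\<open>E0\<close>) or oscillate across a rational gap (\<open>E p q\<close> with rational p <
    q). Elsewhere they converge.\<close>
  define E0 where "E0 = {x\<in>{a<..<b}. \<forall>n. small_intervals x (\<lambda>u v. \<bar>F v - F u\<bar> \<ge> n * (v - u))}"
  define E where "E p q = {x\<in>{a<..<b}. small_intervals x (\<lambda>u v. F v - F u \<le> p * (v - u)) \<and>
       small_intervals x (\<lambda>u v. F v - F u \<ge> q * (v - u))}" for p q
  have negE0: "negligible E0"
    by (rule abs_cont_infinite_slope_negligible[OF F]) (auto simp: E0_def)
  have negE: "negligible (E p q)" if "p < q" for p q
  proof -
    \<comment> \<open>Subtracting the mean slope turns the bounds p and q into -c and c with c = (q
      - p) / 2.\<close>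
    define G where "G x = F x - (p + q) / 2 * x" for x
    have "abs_cont_on {a..b} (\<lambda>t. 0 + t *\<^sub>R (- ((p + q) / 2)) + F t)"
      by (rule abs_cont_on_bounded_linear[OF bounded_linear_ident F])
    then have G: "abs_cont_on {a..b} G" by (rule abs_cont_on_cong) (simp add: G_def)
    have low: "F v - F u \<le> p * (v - u) \<longleftrightarrow> G v - G u \<le> - ((q - p) / 2) * (v - u)"
      and high: "F v - F u \<ge> q * (v - u) \<longleftrightarrow> G v - G u \<ge> ((q - p) / 2) * (v - u)" for u v
    proof -
      have 1: "G v - G u = F v - F u - (p + q) / 2 * (v - u)" unfolding G_def by algebra
      have 2: "- ((q - p) / 2) * (v - u) = p * (v - u) - (p + q) / 2 * (v - u)"
        and 3: "((q - p) / 2) * (v - u) = q * (v - u) - (p + q) / 2 * (v - u)"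
        by (simp_all add: field_simps)
      have cancel: "(x \<le> y) = (x - z \<le> y - z)" for x y z :: real by simp
      show "F v - F u \<le> p * (v - u) \<longleftrightarrow> G v - G u \<le> - ((q - p) / 2) * (v - u)"
        "F v - F u \<ge> q * (v - u) \<longleftrightarrow> G v - G u \<ge> ((q - p) / 2) * (v - u)"
        unfolding 1 2 3 by (rule cancel)+
    qed
    show ?thesis
      by (rule abs_cont_oscillation_negligible[OF G, of "(q - p) / 2"])
        (use that in \<open>auto simp: E_def low high\<close>)
  qed
  define N where "N = E0 \<union> (\<Union>(p, q)\<in>{(p, q). p \<in> \<rat> \<and> q \<in> \<rat> \<and> p < q}. E p q) \<union> {a, b}"
  have "countable ((\<rat> :: real set) \<times> (\<rat> :: real set))" by (intro countable_SIGMA countable_rat)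
  then have "countable {(p, q). p \<in> (\<rat> :: real set) \<and> q \<in> \<rat> \<and> p < q}"
    by (rule countable_subset[rotated]) auto
  then have "negligible N" unfolding N_def
    by (intro negligible_Un negE0 negligible_countable_Union) (auto intro: negE)
  moreover have "F differentiable (at x)" if x: "x \<in> {a..b}" "x \<notin> N" for x
  proof -
    have xab: "x \<in> {a<..<b}" using x by (auto simp: N_def)
    \<comment> \<open>The rationals strictly below all quotients over sufficiently short intervals
      around x; their supremum will be the derivative.\<close>
    define S where "S = {p\<in>\<rat>. \<not> small_intervals x (\<lambda>u v. F v - F u \<le> p * (v - u))}"
    have "x \<notin> E0" using x by (auto simp: N_def)
    then obtain n0 where "\<not> small_intervals x (\<lambda>u v. \<bar>F v - F u\<bar> \<ge> n0 * (v - u))"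
      using xab by (auto simp: E0_def)
    then obtain d0 where d0: "0 < d0"
      "\<And>u v. u \<le> x \<Longrightarrow> x \<le> v \<Longrightarrow> u < v \<Longrightarrow> v - u < d0 \<Longrightarrow> \<bar>F v - F u\<bar> < n0 * (v - u)"
      unfolding small_intervals_def by force
    \<comment> \<open>Rounded up to a rational, because S contains rationals only.\<close>
    define n :: real where "n = of_int \<lceil>n0\<rceil>"
    have n: "n \<in> \<rat>" "n0 \<le> n" by (auto simp: n_def)
    have dn: "\<bar>F v - F u\<bar> < n * (v - u)" if "u \<le> x" "x \<le> v" "u < v" "v - u < d0" for u v
    proof -
      have "n0 * (v - u) \<le> n * (v - u)" using n that by (intro mult_right_mono) auto
      then show ?thesis using d0(2)[OF that] by linarith
    qed
    have "- n \<in> S"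
    proof -
      have "\<not> (F v - F u \<le> - n * (v - u))" if "u \<le> x" "x \<le> v" "u < v" "v - u < d0" for u v
        using dn[OF that] by auto
      then have "\<not> small_intervals x (\<lambda>u v. F v - F u \<le> - n * (v - u))"
        using d0(1) unfolding small_intervals_def by metis
      moreover have "- n \<in> \<rat>" using n by simp
      ultimately show ?thesis unfolding S_def by blast
    qed
    have ub: "p \<le> n" if pS: "p \<in> S" for p
    proof -
      have ns: "\<not> small_intervals x (\<lambda>u v. F v - F u \<le> p * (v - u))" using pS by (simp add: S_def)
      obtain d where d: "0 < d"
        "\<And>u v. u \<le> x \<Longrightarrow> x \<le> v \<Longrightarrow> u < v \<Longrightarrow> v - u < d \<Longrightarrow> \<not> (F v - F u \<le> p * (v - u))"
        using ns unfolding small_intervals_def by metis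
      define v where "v = x + min d d0 / 2"
      have v: "x < v" "v - x < d" "v - x < d0" using d(1) d0(1) by (auto simp: v_def min_def)
      have "p * (v - x) < n * (v - x)" using d(2)[of x v] dn[of x v] v by linarith
      then show ?thesis using v by simp
    qed
    have bdd: "S \<noteq> {}" "bdd_above S" using \<open>- n \<in> S\<close> ub by (auto intro!: bdd_aboveI[of _ n])
    define L where "L = Sup S"
    have "(F has_vector_derivative L) (at x)"
      unfolding has_vector_derivative_def has_derivative_at_alt
    proof (intro conjI allI impI)
      show "bounded_linear (\<lambda>h. h *\<^sub>R L)" by (rule bounded_linear_scaleR_left)
      fix e :: real assume "0 < e"
      obtain p where p: "p \<in> S" "L - e < p"
        using less_cSupD[OF bdd(1), of "L - e"] \<open>0 < e\<close> unfolding L_def by auto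
      obtain q where q: "q \<in> \<rat>" "L < q" "q < L + e" using Rats_dense_in_real[of L "L + e"] \<open>0 < e\<close> by auto
      \<comment> \<open>A rational r between L and q is not in S, so slopes at most r occur at all
        scales; since x is not in \<open>E r q\<close>, slopes at least q then cease at small
        scales.\<close>
      obtain r where r: "r \<in> \<rat>" "L < r" "r < q" using Rats_dense_in_real[OF q(2)] by auto
      have "r \<notin> S" using cSup_upper[OF _ bdd(2)] r(2) unfolding L_def by fastforce
      then have "small_intervals x (\<lambda>u v. F v - F u \<le> r * (v - u))" using r by (auto simp: S_def)
      moreover have "x \<notin> E r q" using x(2) r q unfolding N_def by blast
      ultimately have "\<not> small_intervals x (\<lambda>u v. F v - F u \<ge> q * (v - u))"
        using xab by (auto simp: E_def)
      then obtain d1 where d1: "0 < d1"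
        "\<And>u v. u \<le> x \<Longrightarrow> x \<le> v \<Longrightarrow> u < v \<Longrightarrow> v - u < d1 \<Longrightarrow> F v - F u < q * (v - u)"
        unfolding small_intervals_def by force
      obtain d2 where d2: "0 < d2"
        "\<And>u v. u \<le> x \<Longrightarrow> x \<le> v \<Longrightarrow> u < v \<Longrightarrow> v - u < d2 \<Longrightarrow> F v - F u > p * (v - u)"
        using p(1) unfolding S_def small_intervals_def by force
      have est: "\<bar>F v - F u - (v - u) * L\<bar> \<le> e * (v - u)"
        if "u \<le> x" "x \<le> v" "u < v" "v - u < min d1 d2" for u v
      proof -
        have "F v - F u < q * (v - u)" "p * (v - u) < F v - F u" using d1(2) d2(2) that by auto
        moreover have "q * (v - u) \<le> (L + e) * (v - u)" "(L - e) * (v - u) \<le> p * (v - u)"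
          using p q that by (intro mult_right_mono; simp)+
        ultimately show ?thesis by (auto simp: abs_le_iff algebra_simps)
      qed
      show "\<exists>d>0. \<forall>y. norm (y - x) < d \<longrightarrow> norm (F y - F x - (y - x) *\<^sub>R L) \<le> e * norm (y - x)"
      proof (intro exI[of _ "min d1 d2"] conjI allI impI)
        fix y assume y: "norm (y - x) < min d1 d2"
        consider "y = x" | "x < y" | "y < x" by linarith
        then show "norm (F y - F x - (y - x) *\<^sub>R L) \<le> e * norm (y - x)"
        proof cases
          case 2
          then show ?thesis using est[of x y] y by simp
        next
          case 3
          then have "\<bar>F x - F y - (x - y) * L\<bar> \<le> e * (x - y)" using est[of y x] y by simp
          moreover have "F y - F x - (y - x) * L = - (F x - F y - (x - y) * L)" by (simp add: algebra_simps)
          ultimately show ?thesis using 3 by simp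
        qed simp
      qed (use d1 d2 in simp)
    qed
    then show ?thesis using vector_derivative_works differentiableI_vector by blast
  qed
  ultimately show ?thesis by (blast intro: negligible_subset)
qed

lemma abs_cont_differentiable_AE:
  fixes f :: "real \<Rightarrow> real^'n"
  assumes f: "abs_cont_on {a..b} f"
  shows "AE t in lebesgue. t \<in> {a..b} \<longrightarrow> (f has_vector_derivative vector_derivative f (at t)) (at t)"
proof -
  define N where "N = (\<Union>i. {x\<in>{a..b}. \<not> (\<lambda>t. f t $ i) differentiable (at x)})"
  have "negligible N" unfolding N_def
    using abs_cont_real_differentiable_AE[OF abs_cont_on_linear_image[OF bounded_linear_vec_nth f]]
    by (intro negligible_Union) auto
  moreover have "(f has_vector_derivative vector_derivative f (at t)) (at t)" if t: "t \<in> {a..b}" "t \<notin> N" for t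
  proof -
    have d: "(\<lambda>t. f t $ i) differentiable (at t)" for i using t by (auto simp: N_def)
    have "f differentiable (at t)"
      by (subst differentiable_componentwise_within) (use d in \<open>auto simp: Basis_vec_def inner_axis\<close>)
    then show ?thesis by (simp add: vector_derivative_works)
  qed
  ultimately show ?thesis
    by (intro AE_I'[of N]) (auto simp: negligible_iff_null_sets)
qed

text \<open>The gauge comes from differentiability at points off N, and from an open U of measure
  below \<delta> at points of N. The division intervals tagged in N then form a system of total
  length below \<delta>, and absolute continuity makes their increments small.\<close>

lemma abs_cont_FTC:
  fixes F :: "real \<Rightarrow> real"
  assumes F: "abs_cont_on {a..b} F" and ab: "a \<le> b" and N: "negligible N"
    and deriv: "\<And>x. x \<in> {a..b} \<Longrightarrow> x \<notin> N \<Longrightarrow> (F has_vector_derivative f x) (at x)"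
  shows "(f has_integral (F b - F a)) {a..b}"
proof -
  \<comment> \<open>With value 0 on N the Riemann terms tagged there vanish and only the increments
    of F are left.\<close>
  define g where "g x = (if x \<in> N then 0 else f x)" for x
  have "(g has_integral (F b - F a)) (cbox a b)"
    unfolding has_integral
  proof (intro allI impI)
    fix e :: real assume "0 < e"
    obtain \<delta> where "0 < \<delta>" and \<delta>: "\<And>D. interval_system D \<Longrightarrow> (\<And>u v. (u, v) \<in> D \<Longrightarrow> {u..v} \<subseteq> {a..b})
       \<Longrightarrow> increments (\<lambda>x. x) D < \<delta> \<Longrightarrow> (\<Sum>(u, v)\<in>D. \<bar>F v - F u\<bar>) < e / 2"
      using abs_cont_on_systemD[OF F, of "e / 2"] \<open>0 < e\<close> by auto
    obtain U where U: "open U" "N \<subseteq> U" "U \<in> lmeasurable" "measure lebesgue U < \<delta>"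
      using lmeasurable_outer_open[OF negligible_imp_measurable[OF N] \<open>0 < \<delta>\<close>] negligible_imp_measure0[OF N]
      by auto
    \<comment> \<open>The 1 in the denominator covers a = b.\<close>
    define e' where "e' = e / (4 * (b - a + 1))"
    have e': "0 < e'" "e' * (b - a) < e / 2"
    proof -
      show "0 < e'" using \<open>0 < e\<close> ab by (simp add: e'_def)
      then have "e' * (b - a) < e' * (b - a + 1)" by simp
      also have "\<dots> = e / 4"
      proof -
        have "c \<noteq> 0 \<Longrightarrow> e / (4 * c) * c = e / 4" for c by simp
        then show ?thesis unfolding e'_def using ab by (metis add_diff_eq diff_add_cancel diff_ge_0_iff_ge less_add_one not_less)
      qed
      finally show "e' * (b - a) < e / 2" using \<open>0 < e\<close> by simp
    qed
    have "\<exists>r>0. (x \<in> N \<longrightarrow> ball x r \<subseteq> U) \<and> (x \<in> {a..b} \<longrightarrow> x \<notin> N \<longrightarrow>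
        (\<forall>y. norm (y - x) < r \<longrightarrow> norm (F y - F x - (y - x) *\<^sub>R f x) \<le> e' * norm (y - x)))" for x
    proof (cases "x \<in> N \<or> x \<notin> {a..b}")
      case True
      then show ?thesis using U openE[OF U(1), of x]
        by (metis (no_types, lifting) subsetD zero_less_one)
    next
      case False
      then have "(F has_derivative (\<lambda>h. h *\<^sub>R f x)) (at x)"
        using deriv[of x] by (simp add: has_vector_derivative_def)
      then show ?thesis using False e'(1) unfolding has_derivative_at_alt by blast
    qed
    then obtain r where r: "\<And>x. 0 < r x" "\<And>x. x \<in> N \<Longrightarrow> ball x (r x) \<subseteq> U"
      "\<And>x y. x \<in> {a..b} \<Longrightarrow> x \<notin> N \<Longrightarrow> norm (y - x) < r x \<Longrightarrow>
         norm (F y - F x - (y - x) *\<^sub>R f x) \<le> e' * norm (y - x)"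
      by metis
    show "\<exists>\<gamma>. gauge \<gamma> \<and> (\<forall>p. p tagged_division_of cbox a b \<and> \<gamma> fine p
        \<longrightarrow> norm ((\<Sum>(x, k)\<in>p. measure lborel k *\<^sub>R g x) - (F b - F a)) < e)"
    proof (intro exI[of _ "\<lambda>x. ball x (r x)"] conjI allI impI)
      show "gauge (\<lambda>x. ball x (r x))" using r(1) by (simp add: gauge_def)
      fix p assume p: "p tagged_division_of cbox a b \<and> (\<lambda>x. ball x (r x)) fine p"
      then have tag: "p tagged_division_of {a..b}" and fin: "finite p" by auto
      have pk: "\<exists>u v. k = {u..v} \<and> u \<le> x \<and> x \<le> v \<and> {u..v} \<subseteq> {a..b} \<and> {u..v} \<subseteq> ball x (r x)"
        if xk: "(x, k) \<in> p" for x k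
      proof -
        obtain u v where k: "k = cbox u v" using tagged_division_ofD(4)[OF tag xk] by blast
        then have "x \<in> {u..v}" "{u..v} \<subseteq> {a..b}" using tagged_division_ofD(2,3)[OF tag xk] by auto
        moreover have "{u..v} \<subseteq> ball x (r x)" using p xk k unfolding fine_def by auto
        ultimately show ?thesis using k by auto
      qed
      define \<Delta> where "\<Delta> k = F (Sup k) - F (Inf k)" for k :: "real set"
      have "(\<Sum>(x, k)\<in>p. \<Delta> k) = F b - F a"
        unfolding \<Delta>_def by (rule additive_tagged_division_1[OF ab tag])
      then have "(\<Sum>(x, k)\<in>p. measure lborel k *\<^sub>R g x) - (F b - F a) = (\<Sum>(x, k)\<in>p. measure lborel k * g x - \<Delta> k)"
        by (simp add: sum_subtractf case_prod_unfold)
      also have "\<dots> = (\<Sum>(x, k)\<in>{(x, k)\<in>p. x \<in> N}. measure lborel k * g x - \<Delta> k)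
                    + (\<Sum>(x, k)\<in>{(x, k)\<in>p. x \<notin> N}. measure lborel k * g x - \<Delta> k)"
        by (subst sum.union_disjoint[symmetric]) (use fin in \<open>auto intro!: sum.cong elim!: finite_subset[rotated]\<close>)
      finally have split: "(\<Sum>(x, k)\<in>p. measure lborel k *\<^sub>R g x) - (F b - F a) =
          (\<Sum>(x, k)\<in>{(x, k)\<in>p. x \<in> N}. measure lborel k * g x - \<Delta> k)
          + (\<Sum>(x, k)\<in>{(x, k)\<in>p. x \<notin> N}. measure lborel k * g x - \<Delta> k)" .
      have reg: "\<bar>\<Sum>(x, k)\<in>{(x, k)\<in>p. x \<notin> N}. measure lborel k * g x - \<Delta> k\<bar> < e / 2"
      proof -
        have "\<bar>\<Sum>(x, k)\<in>{(x, k)\<in>p. x \<notin> N}. measure lborel k * g x - \<Delta> k\<bar>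
            \<le> (\<Sum>(x, k)\<in>{(x, k)\<in>p. x \<notin> N}. \<bar>measure lborel k * g x - \<Delta> k\<bar>)"
          using sum_abs[of "\<lambda>(x, k). measure lborel k * g x - \<Delta> k"] by (simp add: case_prod_unfold)
        also have "\<dots> \<le> (\<Sum>(x, k)\<in>{(x, k)\<in>p. x \<notin> N}. e' * measure lborel k)"
        proof (rule sum_mono, clarify)
          fix x k assume xk: "(x, k) \<in> p" "x \<notin> N"
          obtain u v where k: "k = {u..v}" "u \<le> x" "x \<le> v" "{u..v} \<subseteq> {a..b}" "{u..v} \<subseteq> ball x (r x)"
            using pk[OF xk(1)] by blast
          have "u \<in> {u..v}" "v \<in> {u..v}" "x \<in> {u..v}" using k by auto
          then have "u \<in> ball x (r x)" "v \<in> ball x (r x)" "x \<in> {a..b}" using k(4,5) by blast+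
          then have "\<bar>F u - F x - (u - x) * f x\<bar> \<le> e' * \<bar>u - x\<bar>" "\<bar>F v - F x - (v - x) * f x\<bar> \<le> e' * \<bar>v - x\<bar>"
            using r(3)[of x u] r(3)[of x v] xk(2) by (auto simp: dist_real_def abs_minus_commute)
          then have *: "\<bar>F u - F x - (u - x) * f x\<bar> \<le> e' * (x - u)" "\<bar>F v - F x - (v - x) * f x\<bar> \<le> e' * (v - x)"
            using k by auto
          have "measure lborel k * g x - \<Delta> k = (F u - F x - (u - x) * f x) - (F v - F x - (v - x) * f x)"
            using k xk(2) by (simp add: \<Delta>_def g_def algebra_simps)
          then have "\<bar>measure lborel k * g x - \<Delta> k\<bar> \<le> e' * (x - u) + e' * (v - x)" using * by linarith
          also have "\<dots> = e' * measure lborel k" using k by (simp add: algebra_simps)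
          finally show "\<bar>measure lborel k * g x - \<Delta> k\<bar> \<le> e' * measure lborel k" .
        qed
        also have "\<dots> \<le> (\<Sum>(x, k)\<in>p. e' * measure lborel k)"
          by (rule sum_mono2) (use fin e' in \<open>auto intro!: mult_nonneg_nonneg\<close>)
        also have "\<dots> = e' * (\<Sum>(x, k)\<in>p. measure lborel k)" by (simp add: sum_distrib_left case_prod_unfold)
        also have "(\<Sum>(x, k)\<in>p. measure lborel k) = b - a"
          using additive_content_tagged_division[of p a b] p ab by simp
        finally show ?thesis using e'(2) by linarith
      qed
      have null: "\<bar>\<Sum>(x, k)\<in>{(x, k)\<in>p. x \<in> N}. measure lborel k * g x - \<Delta> k\<bar> < e / 2"
      proof -
        \<comment> \<open>Tagged divisions may contain one-point intervals. They contribute nothing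
          and are dropped, since an interval system must be nondegenerate; on the rest non-overlap
          makes \<open>R\<close> injective.\<close>
        define q where "q = {(x, k)\<in>p. x \<in> N \<and> Inf k < Sup k}"
        define R where "R = (\<lambda>(x :: real, k :: real set). (Inf k, Sup k))"
        have finq: "finite q" using fin by (auto simp: q_def elim!: finite_subset[rotated])
        have R: "{u..v} \<subseteq> U" "{u..v} \<subseteq> {a..b}" "u < v" if "(u, v) \<in> R ` q" for u v
        proof -
          obtain x k where xk: "(x, k) \<in> p" "x \<in> N" "Inf k < Sup k" "u = Inf k" "v = Sup k"
            using \<open>(u, v) \<in> R ` q\<close> by (auto simp: q_def R_def)
          obtain u' v' where "k = {u'..v'}" "u' \<le> x" "x \<le> v'" "{u'..v'} \<subseteq> {a..b}" "{u'..v'} \<subseteq> ball x (r x)"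
            using pk[OF xk(1)] by blast
          with xk r(2)[OF xk(2)] show "{u..v} \<subseteq> U" "{u..v} \<subseteq> {a..b}" "u < v" by auto
        qed
        have sep: "Sup k \<le> Inf k' \<or> Sup k' \<le> Inf k"
          if "(x, k) \<in> q" "(x', k') \<in> q" "(x, k) \<noteq> (x', k')" for x k x' k'
        proof -
          have xk: "(x, k) \<in> p" "(x', k') \<in> p" "Inf k < Sup k" "Inf k' < Sup k'" using that by (auto simp: q_def)
          obtain u v u' v' where "k = {u..v}" "u \<le> v" "k' = {u'..v'}" "u' \<le> v'"
            using pk[OF xk(1)] pk[OF xk(2)] by (metis order_trans)
          moreover have "interior k \<inter> interior k' = {}"
            by (rule tagged_division_ofD(5)[OF tag xk(1,2) that(3)])
          ultimately show ?thesis using xk open_interval_disjoint_iff[of u v u' v'] by auto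
        qed
        have inj: "inj_on R q"
        proof (rule inj_onI)
          fix i j assume ij: "i \<in> q" "j \<in> q" "R i = R j"
          show "i = j"
          proof (rule ccontr)
            assume "i \<noteq> j"
            with ij sep[of "fst i" "snd i" "fst j" "snd j"] show False
              by (auto simp: R_def q_def case_prod_unfold)
          qed
        qed
        have sys: "interval_system (R ` q)"
        proof (rule interval_systemI)
          show "finite (R ` q)" using finq by simp
          show "u < v" if "(u, v) \<in> R ` q" for u v using R(3)[OF that] .
          fix a b c d assume "(a, b) \<in> R ` q" "(c, d) \<in> R ` q" "(a, b) \<noteq> (c, d)"
          then show "b \<le> c \<or> d \<le> a" using sep unfolding R_def by fastforce
        qed
        have "increments (\<lambda>x. x) (R ` q) \<le> measure lebesgue U"
        proof (rule increments_le_measure[OF sys U(3)])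
          fix u v assume "(u, v) \<in> R ` q"
          then show "{u<..<v} \<subseteq> U" using R(1)[of u v] by (meson greaterThanLessThan_subseteq_atLeastAtMost_iff order_trans order_refl)
        qed
        then have "(\<Sum>(u, v)\<in>R ` q. \<bar>F v - F u\<bar>) < e / 2"
          using U(4) R(2) by (intro \<delta>[OF sys]) auto
        also have "(\<Sum>(u, v)\<in>R ` q. \<bar>F v - F u\<bar>) = (\<Sum>(x, k)\<in>q. \<bar>\<Delta> k\<bar>)"
          by (subst sum.reindex[OF inj]) (auto simp: R_def \<Delta>_def case_prod_unfold intro!: sum.cong)
        also have "(\<Sum>(x, k)\<in>q. \<bar>\<Delta> k\<bar>) = (\<Sum>(x, k)\<in>{(x, k)\<in>p. x \<in> N}. \<bar>measure lborel k * g x - \<Delta> k\<bar>)"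
        proof (rule sum.mono_neutral_cong_left)
          show "finite {(x, k)\<in>p. x \<in> N}" using fin by (auto elim!: finite_subset[rotated])
          show "q \<subseteq> {(x, k)\<in>p. x \<in> N}" by (auto simp: q_def)
          show "\<forall>i\<in>{(x, k)\<in>p. x \<in> N} - q. (case i of (x, k) \<Rightarrow> \<bar>measure lborel k * g x - \<Delta> k\<bar>) = 0"
          proof clarify
            fix x k assume xk: "(x, k) \<in> p" "x \<in> N" "(x, k) \<notin> q"
            then obtain u v where "k = {u..v}" "u \<le> x" "x \<le> v" using pk by blast
            then have "Sup k = Inf k" using xk by (auto simp: q_def)
            then show "\<bar>measure lborel k * g x - \<Delta> k\<bar> = 0" using xk(2) by (simp add: g_def \<Delta>_def)
          qed
        qed (auto simp: q_def g_def)
        finally have "(\<Sum>(x, k)\<in>{(x, k)\<in>p. x \<in> N}. \<bar>measure lborel k * g x - \<Delta> k\<bar>) < e / 2" .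
        moreover have "\<bar>\<Sum>(x, k)\<in>{(x, k)\<in>p. x \<in> N}. measure lborel k * g x - \<Delta> k\<bar>
            \<le> (\<Sum>(x, k)\<in>{(x, k)\<in>p. x \<in> N}. \<bar>measure lborel k * g x - \<Delta> k\<bar>)"
          using sum_abs[of "\<lambda>(x, k). measure lborel k * g x - \<Delta> k"] by (simp add: case_prod_unfold)
        ultimately show ?thesis by linarith
      qed
      show "norm ((\<Sum>(x, k)\<in>p. measure lborel k *\<^sub>R g x) - (F b - F a)) < e"
        unfolding split real_norm_def using reg null by linarith
    qed
  qed
  then show ?thesis
    by (intro has_integral_spike[OF N, of _ f g]) (auto simp: g_def)
qed

section \<open>The network and its Hamiltonians\<close>

lemma finite_type_maximum:
  fixes f :: "'a::finite \<Rightarrow> 'b::linorder"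
  shows "\<exists>k. \<forall>l. f l \<le> f k"
proof -
  have "Max (range f) \<in> range f" by (intro Max_in) auto
  then obtain k where "f k = Max (range f)" by force
  then show ?thesis by (intro exI[of _ k]) simp
qed

lemma finite_type_minimum:
  fixes f :: "'a::finite \<Rightarrow> 'b::linorder"
  shows "\<exists>k. \<forall>l. f k \<le> f l"
proof -
  have "Min (range f) \<in> range f" by (intro Min_in) auto
  then obtain k where "f k = Min (range f)" by force
  then show ?thesis by (intro exI[of _ k]) simp
qed

locale jackson_network =
  fixes P :: "real^'n^'n" and lam mu :: "real^'n"
  assumes substoch: "substochastic P" and radius: "spectral_radius P < 1"
    and lam_pos: "\<And>k. 0 < lam $ k" and mu_pos: "\<And>k. 0 < mu $ k"
    and rho_lt_1: "\<And>k. rho P lam mu k < 1"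
begin

section \<open>Potential theory of the substochastic matrix P\<close>

lemma P_nonneg: "0 \<le> P $ k $ l"
  using substoch by (simp add: substochastic_def)

lemma P_row_sum: "(\<Sum>l\<in>UNIV. P $ k $ l) \<le> 1"
  using substoch by (simp add: substochastic_def)

lemma Pv: "(P *v v) $ k = (\<Sum>l\<in>UNIV. P $ k $ l * v $ l)"
  by (simp add: matrix_vector_mult_def)

lemma P_mono: "(\<And>l. v $ l \<le> v' $ l) \<Longrightarrow> (P *v v) $ k \<le> (P *v v') $ k"
  unfolding Pv by (intro sum_mono mult_left_mono P_nonneg)

text \<open>Compares moduli at a coordinate where v is largest. The bound makes the set in
  \<open>spectral_radius\<close> bounded above, so that its \<open>Sup\<close> can be compared with
  an eigenvalue.\<close>

lemma eigenvalue_le_1: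
  assumes "complex_eigenvalue P z"
  shows "cmod z \<le> 1"
proof -
  obtain v :: "complex^'n" where v: "v \<noteq> 0" "(\<chi> i j. complex_of_real (P$i$j)) *v v = z *s v"
    using assms unfolding complex_eigenvalue_def by blast
  obtain k where max: "\<And>l. cmod (v $ l) \<le> cmod (v $ k)"
    using finite_type_maximum[of "\<lambda>k. cmod (v $ k)"] by blast
  have "cmod (v $ k) \<noteq> 0"
  proof
    assume "cmod (v $ k) = 0"
    then have "v $ l = 0" for l using max[of l] by simp
    then show False using v(1) by (simp add: vec_eq_iff)
  qed
  have "z * v $ k = (\<Sum>l\<in>UNIV. complex_of_real (P $ k $ l) * v $ l)"
    using arg_cong[OF v(2), of "\<lambda>u. u $ k"] by (simp add: matrix_vector_mult_def)
  then have "cmod z * cmod (v $ k) = cmod (\<Sum>l\<in>UNIV. complex_of_real (P $ k $ l) * v $ l)"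
    by (simp flip: norm_mult)
  also have "\<dots> \<le> (\<Sum>l\<in>UNIV. P $ k $ l * cmod (v $ l))"
    by (rule order_trans[OF norm_sum]) (simp add: norm_mult P_nonneg)
  also have "\<dots> \<le> (\<Sum>l\<in>UNIV. P $ k $ l * cmod (v $ k))"
    by (intro sum_mono mult_left_mono max P_nonneg)
  also have "\<dots> \<le> 1 * cmod (v $ k)"
    unfolding sum_distrib_right[symmetric] by (intro mult_right_mono P_row_sum) simp
  finally show ?thesis using \<open>cmod (v $ k) \<noteq> 0\<close> by simp
qed

text \<open>A nonzero fixed vector would make 1 an eigenvalue. This is where the assumption on the
  spectral radius enters.\<close>

lemma P_fixpoint_zero:
  assumes e: "P *v e = e"
  shows "e = 0"
proof (rule ccontr)
  assume "e \<noteq> 0"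
  have "complex_eigenvalue P 1"
    unfolding complex_eigenvalue_def
  proof (intro exI[of _ "\<chi> i. complex_of_real (e $ i)"] conjI)
    show "(\<chi> i. complex_of_real (e $ i)) \<noteq> 0" using \<open>e \<noteq> 0\<close> by (simp add: vec_eq_iff)
    have "(\<Sum>l\<in>UNIV. P $ k $ l * e $ l) = e $ k" for k
      using arg_cong[OF e, of "\<lambda>u. u $ k"] by (simp add: Pv)
    then show "(\<chi> i j. complex_of_real (P $ i $ j)) *v (\<chi> i. complex_of_real (e $ i))
        = 1 *s (\<chi> i. complex_of_real (e $ i))"
      by (simp add: matrix_vector_mult_def vec_eq_iff flip: of_real_mult of_real_sum)
  qed
  then have "cmod 1 \<le> spectral_radius P"
    unfolding spectral_radius_def
    by (intro cSup_upper) (auto intro!: bdd_aboveI[of _ 1] eigenvalue_le_1 exI[of _ 1])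
  then show False using radius by simp
qed

text \<open>\<open>P\<^sup>n 1\<close> decreases to a fixed point of \<open>P\<close>, that is, to \<open>0\<close>; the partial sums
  of \<open>\<Sum>n. P\<^sup>n 1\<close> are then eventually strictly superharmonic.\<close>

lemma superharmonic_vector:
  obtains w :: "real^'n" where "\<And>k. 0 < w $ k" "\<And>k. (P *v w) $ k < w $ k"
proof -
  define s where "s n = ((\<lambda>v. P *v v) ^^ n) (\<chi> k. 1)" for n
  have s0: "s 0 $ k = 1" and sSuc: "s (Suc n) = P *v s n" for n k by (simp_all add: s_def)
  have dec: "s (Suc n) $ k \<le> s n $ k" for n k
  proof (induction n arbitrary: k)
    case 0
    show ?case using P_row_sum[of k] unfolding sSuc Pv s0 by simp
  next
    case (Suc n)
    show ?case unfolding sSuc[of "Suc n"] by (subst (2) sSuc) (rule P_mono[OF Suc])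
  qed
  have nonneg: "0 \<le> s n $ k" for n k
  proof (induction n arbitrary: k)
    case (Suc n)
    then show ?case unfolding sSuc Pv by (intro sum_nonneg mult_nonneg_nonneg P_nonneg)
  qed (simp add: s0)
  have "\<exists>l. (\<lambda>n. s n $ k) \<longlonglongrightarrow> l" for k
    using decseq_convergent[of "\<lambda>n. s n $ k" 0] dec nonneg by (metis decseq_SucI)
  then obtain e where e: "\<And>k. (\<lambda>n. s n $ k) \<longlonglongrightarrow> e k" by metis
  define v where "v = (\<chi> k. e k)"
  have sv: "s \<longlonglongrightarrow> v" by (rule vec_tendstoI) (simp add: v_def e)
  then have "(\<lambda>n. P *v s n) \<longlonglongrightarrow> P *v v"
    by (rule bounded_linear.tendsto[OF matrix_vector_mul_bounded_linear])
  moreover have "(\<lambda>n. P *v s n) \<longlonglongrightarrow> v"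
    using LIMSEQ_Suc[OF sv] unfolding sSuc .
  ultimately have "P *v v = v" by (rule LIMSEQ_unique)
  then have "v = 0" by (rule P_fixpoint_zero)
  then have "(\<lambda>n. s n $ k) \<longlonglongrightarrow> 0" for k using e[of k] by (simp add: v_def vec_eq_iff)
  then have "eventually (\<lambda>n. s n $ k < 1) sequentially" for k
    by (rule order_tendstoD) simp
  then have "eventually (\<lambda>n. \<forall>k. s n $ k < 1) sequentially"
    by (simp add: eventually_all_finite)
  then obtain n where n: "\<And>k. s n $ k < 1" by (auto simp: eventually_sequentially)
  have n0: "n \<noteq> 0" using n[of undefined] s0 by (metis less_irrefl)
  \<comment> \<open>Telescoping gives w - P w = 1 - P^n 1, which is positive in every coordinate by
    the choice of n.\<close>
  define w where "w = (\<Sum>m<n. s m)"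
  have wk: "w $ k = (\<Sum>m<n. s m $ k)" for k by (simp add: w_def)
  show thesis
  proof
    fix k
    have "s 0 $ k \<le> w $ k" unfolding wk by (rule member_le_sum) (use n0 nonneg in auto)
    then show "0 < w $ k" by (simp add: s0)
    have "P *v w = (\<Sum>m<n. s (Suc m))"
      unfolding w_def sSuc by (rule linear_sum[OF matrix_vector_mul_linear])
    then have "(P *v w) $ k = (\<Sum>m<n. s (Suc m) $ k)" by simp
    also have "\<dots> = w $ k + (s n $ k - s 0 $ k)"
      unfolding wk using sum_lessThan_telescope[of "\<lambda>m. s m $ k" n] by (simp add: sum_subtractf)
    finally show "(P *v w) $ k < w $ k" using n[of k] by (simp add: s0)
  qed
qed

text \<open>Compares v with the positive, strictly superharmonic w. If the least ratio m = v_i / w_i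
  is negative, then i lies in J and v_i >= (P v)_i >= m (P w)_i > m w_i = v_i.\<close>

lemma minimum_principle:
  assumes J: "\<And>k. k \<in> J \<Longrightarrow> (P *v v) $ k \<le> v $ k" and nJ: "\<And>k. k \<notin> J \<Longrightarrow> 0 \<le> v $ k"
  shows "0 \<le> v $ k"
proof (rule ccontr)
  assume neg: "\<not> 0 \<le> v $ k"
  obtain w where w: "\<And>k. 0 < w $ k" "\<And>k. (P *v w) $ k < w $ k" using superharmonic_vector by blast
  obtain i where min: "\<And>l. v $ i / w $ i \<le> v $ l / w $ l"
    using finite_type_minimum[of "\<lambda>k. v $ k / w $ k"] by blast
  define m where "m = v $ i / w $ i"
  have "v $ k / w $ k < 0" using neg w(1)[of k] by (simp add: divide_neg_pos)
  then have m: "m < 0" using min[of k] by (simp add: m_def)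
  have vi: "v $ i = m * w $ i" using w(1)[of i] by (simp add: m_def)
  then have "i \<in> J" using nJ[of i] m w(1)[of i] mult_neg_pos[of m "w $ i"] by auto
  have "m * w $ l \<le> v $ l" for l
    using min[of l] w(1)[of l] by (simp add: m_def[symmetric] pos_le_divide_eq)
  then have "(P *v (m *\<^sub>R w)) $ i \<le> (P *v v) $ i" by (intro P_mono) simp
  also have "\<dots> \<le> v $ i" by (rule J[OF \<open>i \<in> J\<close>])
  finally have "m * (P *v w) $ i \<le> m * w $ i" by (simp add: matrix_vector_mult_scaleR vi)
  then show False using m w(2)[of i] by simp
qed

lemma face_system_unique:
  assumes "\<And>k. k \<in> J \<Longrightarrow> e $ k - (P *v e) $ k = e' $ k - (P *v e') $ k"
    and "\<And>k. k \<notin> J \<Longrightarrow> e $ k = e' $ k"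
  shows "e = e'"
proof -
  have le: "u $ k \<le> v $ k" if "\<And>k. k \<in> J \<Longrightarrow> u $ k - (P *v u) $ k = v $ k - (P *v v) $ k"
    "\<And>k. k \<notin> J \<Longrightarrow> u $ k = v $ k" for u v :: "real^'n" and k
  proof -
    have "0 \<le> (v - u) $ k"
    proof (rule minimum_principle[of J])
      fix k assume "k \<in> J"
      then show "(P *v (v - u)) $ k \<le> (v - u) $ k"
        using that(1)[of k] by (simp add: matrix_vector_mult_diff_distrib)
    qed (simp add: that)
    then show ?thesis by simp
  qed
  have "e $ k \<le> e' $ k" "e' $ k \<le> e $ k" for k by (rule le; simp add: assms)+
  then show ?thesis by (simp add: vec_eq_iff order_antisym)
qed

text \<open>The operator that is the identity off J and I - P on J is injective by uniqueness, hence
  onto in finite dimension.\<close>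

lemma face_system_solvable:
  obtains e where "\<And>k. k \<in> J \<Longrightarrow> e $ k - (P *v e) $ k = b $ k" "\<And>k. k \<notin> J \<Longrightarrow> e $ k = b $ k"
proof -
  define A where "A e = (\<chi> k. if k \<in> J then e $ k - (P *v e) $ k else e $ k)" for e
  have A: "linear A"
    by (rule linearI) (auto simp: A_def vec_eq_iff matrix_vector_right_distrib matrix_vector_mult_scaleR algebra_simps)
  have "inj A"
  proof (rule injI)
    fix e e' assume "A e = A e'"
    then have *: "A e $ k = A e' $ k" for k by simp
    show "e = e'"
    proof (rule face_system_unique)
      show "e $ k - (P *v e) $ k = e' $ k - (P *v e') $ k" if "k \<in> J" for k
        using *[of k] that by (simp add: A_def)
      show "e $ k = e' $ k" if "k \<notin> J" for k using *[of k] that by (simp add: A_def)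
    qed
  qed
  then have "surj A" using linear_injective_imp_surjective[OF A] by blast
  then obtain e where "A e = b" by (metis surjD)
  then have Ae: "A e $ k = b $ k" for k by simp
  show thesis
  proof (rule that)
    show "e $ k - (P *v e) $ k = b $ k" if "k \<in> J" for k using Ae[of k] that by (simp add: A_def)
    show "e $ k = b $ k" if "k \<notin> J" for k using Ae[of k] that by (simp add: A_def)
  qed
qed

section \<open>The traffic equation\<close>

abbreviation \<nu> :: "real^'n" where "\<nu> \<equiv> nu P lam"

lemma nu_traffic: "\<nu> - transpose P *v \<nu> = lam"
proof -
  have inj: "inj ((*v) (mat 1 - P))"
  proof (rule injI)
    fix x y assume "(mat 1 - P) *v x = (mat 1 - P) *v y"
    then have "x - P *v x = y - P *v y" by (simp add: matrix_vector_mult_diff_rdistrib)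
    then have "x $ k - (P *v x) $ k = y $ k - (P *v y) $ k" for k by (metis vector_minus_component)
    then show "x = y" by (rule face_system_unique[of UNIV]) auto
  qed
  then have "invertible (mat 1 - P)" by (simp add: invertible_left_inverse matrix_left_invertible_injective)
  then have "invertible (mat 1 - transpose P)"
  proof -
    assume "invertible (mat 1 - P)"
    moreover have "transpose (mat 1 - P) = mat 1 - transpose P"
      by (simp add: transpose_def vec_eq_iff mat_def)
    ultimately show ?thesis using transpose_invertible[of "mat 1 - P"] by simp
  qed
  then have "(mat 1 - transpose P) ** matrix_inv (mat 1 - transpose P) = mat 1"
    unfolding invertible_def matrix_inv_def by (rule someI2_ex) simp
  then have "(mat 1 - transpose P) *v \<nu> = lam"
    by (simp add: nu_def matrix_vector_mul_assoc)
  then show ?thesis by (simp add: matrix_vector_mult_diff_rdistrib)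
qed

text \<open>The traffic equation tested against m: the form in which it later cancels arrivals
  against routing in H.\<close>

lemma nu_adjoint: "lam \<bullet> m + \<nu> \<bullet> (P *v m) = \<nu> \<bullet> m"
proof -
  have "\<nu> \<bullet> (P *v m) = (transpose P *v \<nu>) \<bullet> m"
    by (simp add: dot_lmul_matrix)
  moreover have "lam \<bullet> m = (\<nu> - transpose P *v \<nu>) \<bullet> m" by (simp only: nu_traffic)
  ultimately show ?thesis by (simp add: inner_diff_left)
qed

text \<open>\<nu>_k = lam . x for the potential x of site k, the solution of x - P x =
  \<open>axis k 1\<close>; the minimum principle gives x >= 0, and then x_k >= 1.\<close>

lemma nu_pos: "0 < \<nu> $ k"
proof -
  obtain x where x: "\<And>l. x $ l - (P *v x) $ l = axis k 1 $ l"
    by (rule face_system_solvable[of UNIV "axis k 1"]) auto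
  have x0: "0 \<le> x $ l" for l
  proof (rule minimum_principle[of UNIV])
    fix l show "(P *v x) $ l \<le> x $ l" using x[of l] by (simp add: axis_def split: if_splits)
  qed simp
  have "0 \<le> (P *v x) $ k" unfolding Pv by (intro sum_nonneg mult_nonneg_nonneg x0 P_nonneg)
  then have "0 < x $ k" using x[of k] by simp
  have "x - P *v x = axis k 1" using x by (simp add: vec_eq_iff)
  then have "\<nu> $ k = \<nu> \<bullet> (x - P *v x)" by (simp add: inner_axis)
  also have "\<dots> = lam \<bullet> x" using nu_adjoint[of x] by (simp add: inner_diff_right)
  also have "\<dots> > 0"
    unfolding inner_vec_def
    by (rule sum_pos2[of _ k]) (use x0 lam_pos \<open>0 < x $ k\<close> in \<open>auto simp: less_imp_le\<close>)
  finally show ?thesis .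
qed

section \<open>The momentum attached to a face\<close>

lemma rho_pos: "0 < rho P lam mu k"
  using nu_pos mu_pos by (simp add: rho_def)

text \<open>In the variables \<open>x = exp \<theta> - 1\<close> the conditions \<open>h\<^sub>k \<theta> = 0\<close> are linear: \<open>x\<^sub>k = (P x)\<^sub>k\<close>.\<close>

lemma h_eq_0_iff: "h P k th = 0 \<longleftrightarrow> exp (th $ k) - 1 = (P *v (\<chi> l. exp (th $ l) - 1)) $ k"
  unfolding h_def Pv by (auto simp: exp_minus field_simps)

text \<open>A discrete Dirichlet problem: harmonic for P on J, with the boundary values of
  \<open>exp\<close> of \<open>theta_star\<close> minus 1 off J.\<close>

definition xface :: "'n set \<Rightarrow> real^'n" where
  "xface J = (SOME x. (\<forall>k\<in>J. x $ k = (P *v x) $ k) \<and> (\<forall>k\<in>-J. x $ k = 1 / rho P lam mu k - 1))"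

lemma xface: "k \<in> J \<Longrightarrow> xface J $ k = (P *v xface J) $ k"
  "k \<notin> J \<Longrightarrow> xface J $ k = 1 / rho P lam mu k - 1"
proof -
  obtain x where "\<And>k. k \<in> J \<Longrightarrow> x $ k - (P *v x) $ k = (\<chi> k. if k \<in> J then 0 else 1 / rho P lam mu k - 1) $ k"
    "\<And>k. k \<notin> J \<Longrightarrow> x $ k = (\<chi> k. if k \<in> J then 0 else 1 / rho P lam mu k - 1) $ k"
    by (rule face_system_solvable[of J "\<chi> k. if k \<in> J then 0 else 1 / rho P lam mu k - 1"]) blast
  then have "\<exists>x. (\<forall>k\<in>J. x $ k = (P *v x) $ k) \<and> (\<forall>k\<in>-J. x $ k = 1 / rho P lam mu k - 1)"
    by (intro exI[of _ x]) auto
  from someI_ex[OF this]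
  show "k \<in> J \<Longrightarrow> xface J $ k = (P *v xface J) $ k"
    "k \<notin> J \<Longrightarrow> xface J $ k = 1 / rho P lam mu k - 1"
    unfolding xface_def by blast+
qed

lemma xface_unique:
  assumes "\<And>k. k \<in> J \<Longrightarrow> x $ k = (P *v x) $ k"
    and "\<And>k. k \<notin> J \<Longrightarrow> x $ k = 1 / rho P lam mu k - 1"
  shows "x = xface J"
proof (rule face_system_unique[of J])
  fix k assume "k \<in> J"
  then show "x $ k - (P *v x) $ k = xface J $ k - (P *v xface J) $ k"
    using assms(1)[of k] xface(1)[of k J] by linarith
qed (simp add: assms xface)

lemma xface_off_pos: "k \<notin> J \<Longrightarrow> 0 < xface J $ k"
  using rho_lt_1[of k] rho_pos[of k] by (simp add: xface)

lemma xface_nonneg: "0 \<le> xface J $ k"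
proof (rule minimum_principle[of J])
  fix k assume "k \<in> J"
  then show "(P *v xface J) $ k \<le> xface J $ k" using xface(1)[of k J] by linarith
qed (use xface_off_pos in force)

text \<open>Since 1 + x_k = 1 / rho_k = mu_k / \<nu>_k off J. Service rates thus become weights
  containing \<nu>, to which the traffic equation applies.\<close>

lemma xface_off: "k \<notin> J \<Longrightarrow> \<nu> $ k * (1 + xface J $ k) = mu $ k"
  using nu_pos[of k] mu_pos[of k] by (simp add: xface rho_def)

text \<open>In the variable \<open>exp th - 1\<close> the conditions in the definition are the
  Dirichlet problem of \<open>xface\<close>. Its solution is nonnegative, so the logarithm is
  legitimate, and unique, so \<open>THE\<close> is well defined.\<close>

lemma theta_face: "theta_face P lam mu J = (\<chi> k. ln (1 + xface J $ k))"
proof -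
  have pos: "0 < 1 + xface J $ k" for k using xface_nonneg[of J k] by simp
  have lnrho: "- ln (rho P lam mu k) = ln (1 / rho P lam mu k)" for k
    using rho_pos[of k] by (simp add: ln_div)
  show ?thesis
    unfolding theta_face_def
  proof (rule the_equality, intro conjI ballI)
    fix k assume "k \<in> - J"
    then show "(\<chi> k. ln (1 + xface J $ k)) $ k = theta_star P lam mu $ k"
      by (simp add: theta_star_def lnrho xface)
  next
    fix k assume "k \<in> J"
    have "(\<chi> l. exp ((\<chi> k. ln (1 + xface J $ k)) $ l) - 1) = xface J"
      using pos by (simp add: vec_eq_iff)
    then show "h P k (\<chi> k. ln (1 + xface J $ k)) = 0"
      unfolding h_eq_0_iff using xface(1)[OF \<open>k \<in> J\<close>] pos[of k] by (metis add_diff_cancel_left' exp_ln vec_lambda_beta)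
  next
    fix th assume th: "(\<forall>k\<in>-J. th $ k = theta_star P lam mu $ k) \<and> (\<forall>k\<in>J. h P k th = 0)"
    have "(\<chi> l. exp (th $ l) - 1) = xface J"
    proof (rule xface_unique)
      fix k assume "k \<notin> J"
      then have "th $ k = ln (1 / rho P lam mu k)" using th by (simp add: theta_star_def lnrho)
      then show "(\<chi> l. exp (th $ l) - 1) $ k = 1 / rho P lam mu k - 1" using rho_pos[of k] by simp
    qed (use th h_eq_0_iff in simp)
    then have "exp (th $ l) = 1 + xface J $ l" for l by (auto simp: vec_eq_iff algebra_simps)
    then have "th $ l = ln (1 + xface J $ l)" for l by (metis ln_exp)
    then show "th = (\<chi> k. ln (1 + xface J $ k))" by (simp add: vec_eq_iff)
  qed
qed

lemma exp_theta_face: "exp (theta_face P lam mu J $ k) = 1 + xface J $ k"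
  using xface_nonneg[of J k] by (simp add: theta_face)

lemma theta_face_off: "k \<notin> J \<Longrightarrow> theta_face P lam mu J $ k = theta_star P lam mu $ k"
  using rho_pos[of k] by (simp add: theta_face theta_star_def xface ln_div)

lemma theta_face_inner:
  assumes "\<And>k. k \<in> J \<Longrightarrow> y $ k = 0"
  shows "theta_face P lam mu J \<bullet> y = theta_star P lam mu \<bullet> y"
  unfolding inner_vec_def
proof (rule sum.cong[OF refl])
  fix k show "theta_face P lam mu J $ k \<bullet> y $ k = theta_star P lam mu $ k \<bullet> y $ k"
    by (cases "k \<in> J") (simp_all add: assms theta_face_off)
qed

lemma H_alt:
  "H P lam mu J th = (\<Sum>k\<in>UNIV. (exp (th$k) - 1) * lam$k)
     + (\<Sum>k\<in>UNIV. (if k \<in> J then max (h P k th) 0 else h P k th) * mu$k)"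
proof -
  have "(\<Sum>k\<in>UNIV. (if k \<in> J then max (h P k th) 0 else h P k th) * mu$k)
     = (\<Sum>k\<in>UNIV. if k \<in> J then max (h P k th) 0 * mu$k else h P k th * mu$k)"
    by (rule sum.cong) auto
  also have "\<dots> = (\<Sum>k\<in>J. max (h P k th) 0 * mu$k) + (\<Sum>k\<in>-J. h P k th * mu$k)"
    by (subst sum.If_cases) (auto simp: Compl_eq)
  finally show ?thesis by (simp add: H_def)
qed

text \<open>The time-reversed fluid velocity on the face \<open>J\<close>, where \<open>xface J = exp \<theta> - 1\<close> for
  \<open>\<theta> = theta_face J\<close>.\<close>

definition yface :: "'n set \<Rightarrow> real^'n" where
  "yface J = (\<chi> k. \<nu> $ k * (xface J $ k - (P *v xface J) $ k))"

text \<open>Multiplying by 1 + x_k, the exponential of the face momentum, clears the denominator.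
  Then d occurs only in exponentials with nonnegative coefficients, the last being the exit
  probability, and both the convexity bound and the derivative along d can be read off.\<close>

lemma h_shift:
  "(1 + xface J $ k) * h P k (theta_face P lam mu J + d) =
     (\<Sum>l\<in>UNIV. P $ k $ l * ((1 + xface J $ l) * exp (d $ l - d $ k)))
     + (1 - (\<Sum>l\<in>UNIV. P $ k $ l)) * exp (- d $ k) - (1 + xface J $ k)"
proof -
  let ?th = "theta_face P lam mu J" and ?z = "\<lambda>l. 1 + xface J $ l"
  have z: "?z k \<noteq> 0" using xface_nonneg[of J k] by simp
  have e: "?z k * exp (- (?th + d) $ k) = exp (- d $ k)"
  proof -
    have "exp (- (?th + d) $ k) = exp (- d $ k) / exp (?th $ k)" by (simp flip: exp_diff)
    then show ?thesis using z by (simp add: exp_theta_face)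
  qed
  have "?z k * h P k (?th + d) =
      (?z k * exp (- (?th + d) $ k)) * ((\<Sum>l\<in>UNIV. (exp ((?th + d) $ l) - 1) * P $ k $ l) + 1) - ?z k"
    unfolding h_def by (simp add: algebra_simps)
  also have "\<dots> = exp (- d $ k) * ((\<Sum>l\<in>UNIV. (?z l * exp (d $ l) - 1) * P $ k $ l) + 1) - ?z k"
    unfolding e by (simp add: exp_add exp_theta_face)
  also have "exp (- d $ k) * ((\<Sum>l\<in>UNIV. (?z l * exp (d $ l) - 1) * P $ k $ l) + 1) =
      (\<Sum>l\<in>UNIV. exp (- d $ k) * ((?z l * exp (d $ l)) * P $ k $ l)) - exp (- d $ k) * (\<Sum>l\<in>UNIV. P $ k $ l)
      + exp (- d $ k)"
    by (simp add: left_diff_distrib sum_subtractf distrib_left right_diff_distrib sum_distrib_left)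
  also have "(\<Sum>l\<in>UNIV. exp (- d $ k) * ((?z l * exp (d $ l)) * P $ k $ l))
      = (\<Sum>l\<in>UNIV. P $ k $ l * (?z l * exp (d $ l - d $ k)))"
    by (rule sum.cong) (simp_all add: exp_diff exp_minus field_simps)
  finally show ?thesis by (simp add: algebra_simps)
qed

text \<open>Off J the term mu_k h_k equals \<nu>_k ((P x)_k - x_k), and on J both are 0. What
  remains is lam . x + \<nu> . P x - \<nu> . x, which the traffic equation cancels.\<close>

lemma H_theta_face: "H P lam mu J (theta_face P lam mu J) = 0"
proof -
  let ?th = "theta_face P lam mu J" and ?x = "xface J"
  have zh: "(1 + ?x $ k) * h P k ?th = (P *v ?x) $ k - ?x $ k" for k
    using h_shift[of J k 0] by (simp add: Pv algebra_simps sum.distrib)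
  have J: "h P k ?th = 0" if "k \<in> J" for k
  proof -
    have "(1 + ?x $ k) * h P k ?th = 0" using zh[of k] xface(1)[OF that] by simp
    then show ?thesis using xface_nonneg[of J k] by auto
  qed
  have "(if k \<in> J then max (h P k ?th) 0 else h P k ?th) * mu $ k = \<nu> $ k * ((P *v ?x) $ k - ?x $ k)" for k
  proof (cases "k \<in> J")
    case True
    then show ?thesis using J xface(1)[OF True] by simp
  next
    case False
    then have "h P k ?th * mu $ k = \<nu> $ k * ((1 + ?x $ k) * h P k ?th)" by (simp flip: xface_off)
    then show ?thesis using False by (simp add: zh)
  qed
  then have "H P lam mu J ?th = lam \<bullet> ?x + \<nu> \<bullet> (P *v ?x) - \<nu> \<bullet> ?x"
    by (simp add: H_alt exp_theta_face inner_vec_def right_diff_distrib sum_subtractf mult.commute)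
  then show ?thesis by (simp add: nu_adjoint)
qed


section \<open>The subdifferential at the face momentum\<close>

lemma yface_zero: "k \<in> J \<Longrightarrow> yface J $ k = 0"
  using xface(1)[of k J] by (simp add: yface_def)

lemma yface_inner: "yface J \<bullet> d = \<nu> \<bullet> (\<chi> k. d $ k * (xface J $ k - (P *v xface J) $ k))"
  by (simp add: yface_def inner_vec_def algebra_simps)

text \<open>This will be the rate at which the dual fluid loses mass; it is positive unless J is the
  whole index set.\<close>

lemma sum_yface: "(\<Sum>k\<in>UNIV. yface J $ k) = lam \<bullet> xface J"
  using nu_adjoint[of "xface J"] by (simp add: yface_def inner_vec_def right_diff_distrib sum_subtractf)

text \<open>\<open>\<nu>\<^sub>k (1 + x\<^sub>k)\<close> equals \<open>\<mu>\<^sub>k\<close> off \<open>J\<close> and is a subgradient weight of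
  \<open>u \<mapsto> \<mu>\<^sub>k u\<^sup>+\<close> at \<open>0\<close> on \<open>J\<close>. The inequality is then the tangent bound \<open>1 + u \<le> exp u\<close>
  applied to every exponential in \<open>H\<close>.\<close>

lemma yface_subgradient:
  assumes le: "\<And>k. k \<in> J \<Longrightarrow> \<nu> $ k * (1 + xface J $ k) \<le> mu $ k"
  shows "yface J \<in> subdifferential (H P lam mu J) (theta_face P lam mu J)"
  unfolding subdifferential_def
proof (intro CollectI allI)
  fix th
  let ?x = "xface J" and ?t = "theta_face P lam mu J"
  define d where "d = th - ?t"
  have th: "th = ?t + d" by (simp add: d_def)
  \<comment> \<open>The linearisation of \<open>exp th - 1 = (1 + x) exp d - 1\<close> at d =
    0.\<close>
  define m where "m = (\<chi> k. ?x $ k + (1 + ?x $ k) * d $ k)"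
  have tangent: "1 + u \<le> exp u" for u :: real by (rule exp_ge_add_one_self)
  have x0: "0 \<le> ?x $ k" for k by (rule xface_nonneg)
  have 1: "lam $ k * m $ k \<le> (exp (th $ k) - 1) * lam $ k" for k
  proof -
    have "(1 + ?x $ k) * (1 + d $ k) \<le> (1 + ?x $ k) * exp (d $ k)"
      using x0[of k] by (intro mult_left_mono tangent) simp
    then have "m $ k \<le> exp (th $ k) - 1"
      by (simp add: m_def th exp_add exp_theta_face algebra_simps)
    then show ?thesis using lam_pos[of k] by (simp add: mult.commute)
  qed
  have 2: "(P *v m) $ k - ?x $ k - d $ k - d $ k * (P *v ?x) $ k \<le> (1 + ?x $ k) * h P k th" for k
  proof -
    have "(\<Sum>l\<in>UNIV. P $ k $ l * ((1 + ?x $ l) * (1 + (d $ l - d $ k))))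
        + (1 - (\<Sum>l\<in>UNIV. P $ k $ l)) * (1 + (- d $ k)) - (1 + ?x $ k) \<le> (1 + ?x $ k) * h P k th"
      unfolding th h_shift
      using x0 P_row_sum[of k]
      by (intro diff_right_mono add_mono sum_mono mult_left_mono tangent P_nonneg) auto
    moreover have "(\<Sum>l\<in>UNIV. P $ k $ l * ((1 + ?x $ l) * (1 + (d $ l - d $ k))))
        = (\<Sum>l\<in>UNIV. P $ k $ l * m $ l + P $ k $ l - d $ k * P $ k $ l - d $ k * (P $ k $ l * ?x $ l))"
      by (rule sum.cong) (simp_all add: m_def algebra_simps)
    moreover have "\<dots> = (P *v m) $ k + (\<Sum>l\<in>UNIV. P $ k $ l) - d $ k * (\<Sum>l\<in>UNIV. P $ k $ l)
        - d $ k * (P *v ?x) $ k"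
      by (simp add: Pv sum.distrib sum_subtractf sum_distrib_left)
    ultimately show ?thesis by (simp add: algebra_simps)
  qed
  have 3: "\<nu> $ k * ((1 + ?x $ k) * h P k th) \<le> (if k \<in> J then max (h P k th) 0 else h P k th) * mu $ k" for k
  proof (cases "k \<in> J")
    case True
    have "\<nu> $ k * (1 + ?x $ k) * h P k th \<le> \<nu> $ k * (1 + ?x $ k) * max (h P k th) 0"
      using nu_pos[of k] x0[of k] by (intro mult_left_mono) auto
    also have "\<dots> \<le> mu $ k * max (h P k th) 0" by (intro mult_right_mono le True) simp
    finally show ?thesis using True by (simp add: algebra_simps)
  next
    case False
    then show ?thesis by (simp flip: xface_off)
  qed
  \<comment> \<open>Here m - x - d - d (P x) = d (x - P x) coordinatewise. The traffic equation
    splits \<nu> . m into lam . m and \<nu> . P m, the parts bounded by \<open>1\<close> and by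
    \<open>2\<close> with \<open>3\<close>.\<close>
  have "yface J \<bullet> d = \<nu> \<bullet> (\<chi> k. m $ k - ?x $ k - d $ k - d $ k * (P *v ?x) $ k)"
    unfolding yface_inner by (rule arg_cong[of _ _ "(\<bullet>) \<nu>"]) (simp add: vec_eq_iff m_def algebra_simps)
  also have "\<dots> = \<nu> \<bullet> m - \<nu> \<bullet> (\<chi> k. ?x $ k + d $ k + d $ k * (P *v ?x) $ k)"
    unfolding inner_diff_right[symmetric] by (rule arg_cong[of _ _ "(\<bullet>) \<nu>"]) (simp add: vec_eq_iff)
  also have "\<dots> = lam \<bullet> m + \<nu> \<bullet> (P *v m - (\<chi> k. ?x $ k + d $ k + d $ k * (P *v ?x) $ k))"
    using nu_adjoint[of m] by (simp add: inner_diff_right)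
  also have "\<dots> = (\<Sum>k\<in>UNIV. lam $ k * m $ k)
      + (\<Sum>k\<in>UNIV. \<nu> $ k * ((P *v m) $ k - ?x $ k - d $ k - d $ k * (P *v ?x) $ k))"
    by (simp add: inner_vec_def algebra_simps)
  also have "\<dots> \<le> H P lam mu J th"
    unfolding H_alt
  proof (intro add_mono sum_mono 1)
    fix k
    have "\<nu> $ k * ((P *v m) $ k - ?x $ k - d $ k - d $ k * (P *v ?x) $ k)
        \<le> \<nu> $ k * ((1 + ?x $ k) * h P k th)"
      using nu_pos[of k] by (intro mult_left_mono 2) simp
    then show "\<nu> $ k * ((P *v m) $ k - ?x $ k - d $ k - d $ k * (P *v ?x) $ k)
        \<le> (if k \<in> J then max (h P k th) 0 else h P k th) * mu $ k"
      using 3[of k] by linarith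
  qed
  finally show "H P lam mu J ?t + yface J \<bullet> (th - ?t) \<le> H P lam mu J th"
    by (simp add: H_theta_face d_def)
qed

text \<open>The left-hand side is the pairing of \<open>y\<close> with the direction \<open>d\<^sub>k = e\<^sub>k / (1 + x\<^sub>k)\<close>, the right-hand
  side the directional derivative of \<open>H\<close>; in the variables \<open>e\<close> the derivatives of \<open>h\<^sub>k\<close>
  can be prescribed freely on \<open>J\<close>.\<close>

lemma subgradient_directional:
  assumes y: "y \<in> subdifferential (H P lam mu J) (theta_face P lam mu J)"
  shows "(\<Sum>k\<in>UNIV. y $ k * (e $ k / (1 + xface J $ k)))
    \<le> (\<Sum>k\<in>UNIV. yface J $ k * (e $ k / (1 + xface J $ k)))
      + (\<Sum>k\<in>J. max (((P *v e) $ k - e $ k) / (1 + xface J $ k)) 0 * mu $ k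
          - \<nu> $ k * ((P *v e) $ k - e $ k))"
proof -
  let ?x = "xface J" and ?t = "theta_face P lam mu J"
  have z: "0 < 1 + ?x $ k" for k using xface_nonneg[of J k] by simp
  define d where "d = (\<chi> k. e $ k / (1 + ?x $ k))"
  have zd: "(1 + ?x $ k) * d $ k = e $ k" for k using z[of k] by (simp add: d_def)
  \<comment> \<open>The derivative of h_k along d at the face momentum, obtained from
    \<open>h_shift\<close>.\<close>
  define g where "g k = ((P *v e) $ k - d $ k * (1 + (P *v ?x) $ k)) / (1 + ?x $ k)" for k
  have zg: "(1 + ?x $ k) * g k = (P *v e) $ k - d $ k * (1 + (P *v ?x) $ k)" for k
    using z[of k] by (simp add: g_def)
  define f where "f k s = h P k (?t + s *\<^sub>R d)" for k s
  have f_shift: "(1 + ?x $ k) * f k s =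
     (\<Sum>l\<in>UNIV. P $ k $ l * ((1 + ?x $ l) * exp (s * d $ l - s * d $ k)))
     + (1 - (\<Sum>l\<in>UNIV. P $ k $ l)) * exp (- (s * d $ k)) - (1 + ?x $ k)" for k s
    using h_shift[of J k "s *\<^sub>R d"] by (simp add: f_def)
  have f0: "(1 + ?x $ k) * f k 0 = (P *v ?x) $ k - ?x $ k" for k
    unfolding f_shift[of k 0] by (simp add: Pv distrib_left sum.distrib)
  have f0J: "f k 0 = 0" if "k \<in> J" for k
  proof -
    have "(1 + ?x $ k) * f k 0 = 0" using f0[of k] xface(1)[OF that] by simp
    then show ?thesis using z[of k] by simp
  qed
  have fderiv: "(f k has_real_derivative g k) (at 0)" for k
  proof -
    have "((\<lambda>s. ((\<Sum>l\<in>UNIV. P $ k $ l * ((1 + ?x $ l) * exp (s * d $ l - s * d $ k)))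
       + (1 - (\<Sum>l\<in>UNIV. P $ k $ l)) * exp (- (s * d $ k)) - (1 + ?x $ k)) / (1 + ?x $ k))
       has_real_derivative ((\<Sum>l\<in>UNIV. P $ k $ l * ((1 + ?x $ l) * (d $ l - d $ k)))
       + (1 - (\<Sum>l\<in>UNIV. P $ k $ l)) * (- d $ k)) / (1 + ?x $ k)) (at 0)"
      by (rule DERIV_cdivide) (auto intro!: derivative_eq_intros sum.cong simp: algebra_simps)
    also have "(\<lambda>s. ((\<Sum>l\<in>UNIV. P $ k $ l * ((1 + ?x $ l) * exp (s * d $ l - s * d $ k)))
       + (1 - (\<Sum>l\<in>UNIV. P $ k $ l)) * exp (- (s * d $ k)) - (1 + ?x $ k)) / (1 + ?x $ k)) = f k"
      unfolding f_shift[symmetric] using z[of k] by auto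
    also have "((\<Sum>l\<in>UNIV. P $ k $ l * ((1 + ?x $ l) * (d $ l - d $ k)))
       + (1 - (\<Sum>l\<in>UNIV. P $ k $ l)) * (- d $ k)) = (P *v e) $ k - d $ k * (1 + (P *v ?x) $ k)"
    proof -
      have "(\<Sum>l\<in>UNIV. P $ k $ l * ((1 + ?x $ l) * (d $ l - d $ k)))
          = (\<Sum>l\<in>UNIV. P $ k $ l * e $ l - d $ k * P $ k $ l - d $ k * (P $ k $ l * ?x $ l))"
        by (rule sum.cong) (simp_all add: zd[symmetric] algebra_simps)
      also have "\<dots> = (P *v e) $ k - d $ k * (\<Sum>l\<in>UNIV. P $ k $ l) - d $ k * (P *v ?x) $ k"
        by (simp add: Pv sum_subtractf sum_distrib_left)
      finally show ?thesis by (simp add: algebra_simps)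
    qed
    finally show ?thesis by (simp add: g_def)
  qed
  have quot: "((\<lambda>s. (f k s - f k 0) / s) \<longlongrightarrow> g k) (at_right 0)" for k
  proof -
    have "(\<lambda>s. (f k s - f k 0) / s) \<midarrow>0\<rightarrow> g k" using fderiv[of k] by (simp add: DERIV_def)
    then show ?thesis by (simp add: filterlim_at_split)
  qed
  have equot: "((\<lambda>s. (exp (?t $ k + s * d $ k) - exp (?t $ k)) / s) \<longlongrightarrow> e $ k) (at_right 0)" for k
  proof -
    have "((\<lambda>s. exp (?t $ k + s * d $ k)) has_real_derivative exp (?t $ k) * d $ k) (at 0)"
      by (auto intro!: derivative_eq_intros)
    then have "((\<lambda>s. exp (?t $ k + s * d $ k)) has_real_derivative e $ k) (at 0)"
      by (simp add: exp_theta_face zd)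
    then have "(\<lambda>s. (exp (?t $ k + s * d $ k) - exp (?t $ k)) / s) \<midarrow>0\<rightarrow> e $ k"
      by (simp add: DERIV_def)
    then show ?thesis by (simp add: filterlim_at_split)
  qed
  \<comment> \<open>The difference quotient of H along d. On J, division by s > 0 passes inside the
    positive part because f_k vanishes at 0.\<close>
  define R where "R s = (\<Sum>k\<in>UNIV. (exp (?t $ k + s * d $ k) - exp (?t $ k)) / s * lam $ k)
    + (\<Sum>k\<in>UNIV. (if k \<in> J then max ((f k s - f k 0) / s) 0 else (f k s - f k 0) / s) * mu $ k)" for s
  have "(R \<longlongrightarrow> (\<Sum>k\<in>UNIV. e $ k * lam $ k) + (\<Sum>k\<in>UNIV. (if k \<in> J then max (g k) 0 else g k) * mu $ k))
      (at_right 0)"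
    unfolding R_def
  proof (intro tendsto_add tendsto_sum tendsto_mult tendsto_const equot)
    show "((\<lambda>s. if k \<in> J then max ((f k s - f k 0) / s) 0 else (f k s - f k 0) / s)
        \<longlongrightarrow> (if k \<in> J then max (g k) 0 else g k)) (at_right 0)" for k
      by (cases "k \<in> J") (auto intro: tendsto_max quot tendsto_const)
  qed
  moreover have "eventually (\<lambda>s. y \<bullet> d \<le> R s) (at_right 0)"
    unfolding eventually_at_right_field
  proof (intro exI[of _ 1] conjI allI impI)
    fix s :: real assume s: "0 < s" "s < 1"
    have "(if k \<in> J then max (f k s) 0 else f k s) * mu $ k - (if k \<in> J then max (f k 0) 0 else f k 0) * mu $ k
        = s * ((if k \<in> J then max ((f k s - f k 0) / s) 0 else (f k s - f k 0) / s) * mu $ k)" for k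
      using s f0J[of k] by (auto simp: max_def field_simps zero_less_divide_iff not_le)
    then have 1: "(\<Sum>k\<in>UNIV. (if k \<in> J then max (f k s) 0 else f k s) * mu $ k)
         - (\<Sum>k\<in>UNIV. (if k \<in> J then max (f k 0) 0 else f k 0) * mu $ k)
        = s * (\<Sum>k\<in>UNIV. (if k \<in> J then max ((f k s - f k 0) / s) 0 else (f k s - f k 0) / s) * mu $ k)"
      unfolding sum_subtractf[symmetric] sum_distrib_left by (intro sum.cong) auto
    have "(exp ((?t + s *\<^sub>R d) $ k) - 1) * lam $ k - (exp (?t $ k) - 1) * lam $ k
        = s * ((exp (?t $ k + s * d $ k) - exp (?t $ k)) / s * lam $ k)" for k
      using s by (simp add: left_diff_distrib)
    then have 2: "(\<Sum>k\<in>UNIV. (exp ((?t + s *\<^sub>R d) $ k) - 1) * lam $ k) - (\<Sum>k\<in>UNIV. (exp (?t $ k) - 1) * lam $ k)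
        = s * (\<Sum>k\<in>UNIV. (exp (?t $ k + s * d $ k) - exp (?t $ k)) / s * lam $ k)"
      unfolding sum_subtractf[symmetric] sum_distrib_left by (intro sum.cong) auto
    have "H P lam mu J ?t + y \<bullet> (?t + s *\<^sub>R d - ?t) \<le> H P lam mu J (?t + s *\<^sub>R d)"
      using y unfolding subdifferential_def by blast
    then have "s * (y \<bullet> d) \<le> H P lam mu J (?t + s *\<^sub>R d) - H P lam mu J ?t" by simp
    also have "\<dots> = s * R s"
    proof -
      have "H P lam mu J (?t + s *\<^sub>R d) = (\<Sum>k\<in>UNIV. (exp ((?t + s *\<^sub>R d) $ k) - 1) * lam $ k)
          + (\<Sum>k\<in>UNIV. (if k \<in> J then max (f k s) 0 else f k s) * mu $ k)"
        by (simp only: H_alt f_def)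
      moreover have "H P lam mu J ?t = (\<Sum>k\<in>UNIV. (exp (?t $ k) - 1) * lam $ k)
          + (\<Sum>k\<in>UNIV. (if k \<in> J then max (f k 0) 0 else f k 0) * mu $ k)"
        by (simp only: H_alt f_def scaleR_zero_left add_0_right)
      ultimately show ?thesis using 1 2 unfolding R_def distrib_left by linarith
    qed
    finally show "y \<bullet> d \<le> R s" using s by simp
  qed simp
  ultimately have "y \<bullet> d \<le> (\<Sum>k\<in>UNIV. e $ k * lam $ k) + (\<Sum>k\<in>UNIV. (if k \<in> J then max (g k) 0 else g k) * mu $ k)"
    by (intro tendsto_lowerbound) auto
  \<comment> \<open>Off J, mu_k is \<nu>_k (1 + x_k); adding and subtracting the same weight on J
    yields a sum over all k, ready for the traffic equation, and a correction on J.\<close>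
  also have "(\<Sum>k\<in>UNIV. (if k \<in> J then max (g k) 0 else g k) * mu $ k)
      = (\<Sum>k\<in>UNIV. \<nu> $ k * ((1 + ?x $ k) * g k) + (if k \<in> J then max (g k) 0 * mu $ k - \<nu> $ k * ((1 + ?x $ k) * g k) else 0))"
    by (rule sum.cong) (auto simp: xface_off[symmetric] algebra_simps)
  also have "\<dots> = \<nu> \<bullet> (\<chi> k. (P *v e) $ k - d $ k * (1 + (P *v ?x) $ k))
      + (\<Sum>k\<in>J. max (g k) 0 * mu $ k - \<nu> $ k * ((1 + ?x $ k) * g k))"
    unfolding sum.distrib by (simp add: sum.If_cases zg inner_vec_def)
  also have "(\<Sum>k\<in>UNIV. e $ k * lam $ k) = lam \<bullet> e" by (simp add: inner_vec_def mult.commute)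
  also have "lam \<bullet> e + (\<nu> \<bullet> (\<chi> k. (P *v e) $ k - d $ k * (1 + (P *v ?x) $ k))
      + (\<Sum>k\<in>J. max (g k) 0 * mu $ k - \<nu> $ k * ((1 + ?x $ k) * g k)))
     = yface J \<bullet> d + (\<Sum>k\<in>J. max (g k) 0 * mu $ k - \<nu> $ k * ((1 + ?x $ k) * g k))"
  proof -
    have "lam \<bullet> e + \<nu> \<bullet> (\<chi> k. (P *v e) $ k - d $ k * (1 + (P *v ?x) $ k))
       = lam \<bullet> e + \<nu> \<bullet> (P *v e) - \<nu> \<bullet> (\<chi> k. d $ k * (1 + (P *v ?x) $ k))"
      unfolding add_diff_eq[symmetric] inner_diff_right[symmetric]
      by (rule arg_cong[of _ _ "\<lambda>u. lam \<bullet> e + \<nu> \<bullet> u"]) (simp add: vec_eq_iff)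
    also have "\<dots> = \<nu> \<bullet> (\<chi> k. e $ k - d $ k * (1 + (P *v ?x) $ k))"
      unfolding nu_adjoint inner_diff_right[symmetric]
      by (rule arg_cong[of _ _ "\<lambda>u. \<nu> \<bullet> u"]) (simp add: vec_eq_iff)
    also have "\<dots> = yface J \<bullet> d"
      unfolding yface_inner
      by (rule arg_cong[of _ _ "\<lambda>u. \<nu> \<bullet> u"]) (simp add: vec_eq_iff zd[symmetric] algebra_simps)
    finally show ?thesis by simp
  qed
  also have "(\<Sum>k\<in>J. max (g k) 0 * mu $ k - \<nu> $ k * ((1 + ?x $ k) * g k))
    = (\<Sum>k\<in>J. max (((P *v e) $ k - e $ k) / (1 + ?x $ k)) 0 * mu $ k - \<nu> $ k * ((P *v e) $ k - e $ k))"
  proof (rule sum.cong[OF refl])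
    fix k assume "k \<in> J"
    \<comment> \<open>By harmonicity on J, d_k (1 + (P x)_k) = d_k (1 + x_k) = e_k.\<close>
    then have "(1 + ?x $ k) * g k = (P *v e) $ k - e $ k"
      using zg[of k] zd[of k] xface(1)[of k J] by (simp add: mult.commute)
    moreover from this have "g k = ((P *v e) $ k - e $ k) / (1 + ?x $ k)" using z[of k] by (simp add: field_simps)
    ultimately show "max (g k) 0 * mu $ k - \<nu> $ k * ((1 + ?x $ k) * g k)
      = max (((P *v e) $ k - e $ k) / (1 + ?x $ k)) 0 * mu $ k - \<nu> $ k * ((P *v e) $ k - e $ k)" by simp
  qed
  finally show ?thesis by (simp add: inner_vec_def d_def)
qed

text \<open>Both claims test \<open>subgradient_directional\<close> with a direction that isolates
  one coordinate. For i off J, e is harmonic on J and c times a unit vector off J, and c = 1, -1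
  give equality. For i in J, e vanishes off J and P e - e is supported at i within J, which leaves 0
  <= mu_i - \<nu>_i (1 + x_i).\<close>

lemma subgradient_tangential:
  assumes y: "y \<in> subdifferential (H P lam mu J) (theta_face P lam mu J)"
    and y0: "\<And>k. k \<in> J \<Longrightarrow> y $ k = 0"
  shows "y = yface J" and "\<And>k. k \<in> J \<Longrightarrow> \<nu> $ k * (1 + xface J $ k) \<le> mu $ k"
proof -
  let ?x = "xface J"
  have z: "0 < 1 + ?x $ k" for k using xface_nonneg[of J k] by simp
  have single: "(\<Sum>k\<in>UNIV. u $ k * (e $ k / (1 + ?x $ k))) = u $ i * (c / (1 + ?x $ i))"
    if "\<And>k. k \<in> J \<Longrightarrow> u $ k = 0" "\<And>k. k \<notin> J \<Longrightarrow> e $ k = c * axis i 1 $ k" "i \<notin> J"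
    for u e :: "real^'n" and c i
  proof -
    have "u $ k * (e $ k / (1 + ?x $ k)) = (if k = i then u $ i * (c / (1 + ?x $ i)) else 0)" for k
      using that by (cases "k \<in> J") (auto simp: axis_def)
    then show ?thesis by simp
  qed
  have le: "c * (y $ i) \<le> c * (yface J $ i)" if i: "i \<notin> J" for i c
  proof -
    obtain e where e: "\<And>k. k \<in> J \<Longrightarrow> e $ k - (P *v e) $ k = (if k \<in> J then 0 else c * axis i 1 $ k)"
      "\<And>k. k \<notin> J \<Longrightarrow> e $ k = (if k \<in> J then 0 else c * axis i 1 $ k)"
      using face_system_solvable[of J "\<chi> k. if k \<in> J then 0 else c * axis i 1 $ k"] by auto
    have "(\<Sum>k\<in>J. max (((P *v e) $ k - e $ k) / (1 + ?x $ k)) 0 * mu $ k - \<nu> $ k * ((P *v e) $ k - e $ k)) = 0"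
      using e(1) by (intro sum.neutral) auto
    with subgradient_directional[OF y, of e]
    have "y $ i * (c / (1 + ?x $ i)) \<le> yface J $ i * (c / (1 + ?x $ i))"
      using single[of y e c i] single[of "yface J" e c i] y0 yface_zero e(2) i by simp
    then have "(c * y $ i) / (1 + ?x $ i) \<le> (c * yface J $ i) / (1 + ?x $ i)" by (simp add: mult.commute)
    then show ?thesis using z[of i] by (simp add: divide_le_cancel del: times_divide_eq_right)
  qed
  show "y = yface J"
  proof (intro vec_eq_iff[THEN iffD2] allI)
    fix i show "y $ i = yface J $ i"
      using le[of i 1] le[of i "-1"] y0[of i] yface_zero[of i J] by (cases "i \<in> J") auto
  qed
  fix i assume i: "i \<in> J"
  obtain e where e: "\<And>k. k \<in> J \<Longrightarrow> e $ k - (P *v e) $ k = (if k = i then - (1 + ?x $ i) else 0)"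
    "\<And>k. k \<notin> J \<Longrightarrow> e $ k = 0"
  proof (rule face_system_solvable[of J "\<chi> k. if k = i then - (1 + ?x $ i) else 0"])
    fix e assume *: "\<And>k. k \<in> J \<Longrightarrow> e $ k - (P *v e) $ k = (\<chi> k. if k = i then - (1 + ?x $ i) else 0) $ k"
      "\<And>k. k \<notin> J \<Longrightarrow> e $ k = (\<chi> k. if k = i then - (1 + ?x $ i) else 0) $ k"
    show thesis by (rule that[of e]) (use * i in auto)
  qed
  have zero: "(\<Sum>k\<in>UNIV. u $ k * (e $ k / (1 + ?x $ k))) = 0"
    if "\<And>k. k \<in> J \<Longrightarrow> u $ k = 0" for u :: "real^'n"
    by (rule sum.neutral) (use that e(2) in force)
  have "(\<Sum>k\<in>J. max (((P *v e) $ k - e $ k) / (1 + ?x $ k)) 0 * mu $ k - \<nu> $ k * ((P *v e) $ k - e $ k))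
      = (\<Sum>k\<in>J. if k = i then mu $ i - \<nu> $ i * (1 + ?x $ i) else 0)"
  proof (rule sum.cong[OF refl])
    fix k assume "k \<in> J"
    then have "(P *v e) $ k - e $ k = (if k = i then 1 + ?x $ i else 0)" using e(1)[of k] by (auto split: if_splits)
    then show "max (((P *v e) $ k - e $ k) / (1 + ?x $ k)) 0 * mu $ k - \<nu> $ k * ((P *v e) $ k - e $ k)
       = (if k = i then mu $ i - \<nu> $ i * (1 + ?x $ i) else 0)"
      using z[of k] by auto
  qed
  also have "\<dots> = mu $ i - \<nu> $ i * (1 + ?x $ i)" using i by (simp add: sum.delta)
  finally have "(\<Sum>k\<in>J. max (((P *v e) $ k - e $ k) / (1 + ?x $ k)) 0 * mu $ k - \<nu> $ k * ((P *v e) $ k - e $ k))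
      = mu $ i - \<nu> $ i * (1 + ?x $ i)" .
  with subgradient_directional[OF y, of e] zero[OF y0] zero[of "yface J"] yface_zero
  show "\<nu> $ i * (1 + ?x $ i) \<le> mu $ i" by simp
qed

subsection \<open>The dual network\<close>

definition reflection :: "real^'n^'n" where
  "reflection = mat 1 - transpose (dual_routing P lam)"

text \<open>Conjugation by the diagonal matrix of \<nu> carries I - P to the reflection matrix of
  the dual network, so the minimum principle for P is available for the latter.\<close>

lemma reflection_apply:
  "(reflection *v u) $ l = \<nu> $ l * (u $ l / \<nu> $ l - (P *v (\<chi> k. u $ k / \<nu> $ k)) $ l)"
proof -
  have "(transpose (dual_routing P lam) *v u) $ l = (\<Sum>k\<in>UNIV. \<nu> $ l * P $ l $ k / \<nu> $ k * u $ k)"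
    by (simp add: matrix_vector_mult_def transpose_def dual_routing_def)
  also have "\<dots> = \<nu> $ l * (P *v (\<chi> k. u $ k / \<nu> $ k)) $ l"
    by (simp add: Pv sum_distrib_left algebra_simps)
  finally show ?thesis
    using nu_pos[of l] by (simp add: reflection_def matrix_vector_mult_diff_rdistrib right_diff_distrib)
qed

lemma reflection_inj:
  assumes "reflection *v u = reflection *v v"
  shows "u = v"
proof -
  have "(\<chi> k. u $ k / \<nu> $ k) = (\<chi> k. v $ k / \<nu> $ k)"
  proof (rule face_system_unique[of UNIV])
    fix l
    have "(reflection *v u) $ l = (reflection *v v) $ l" using assms by simp
    then show "(\<chi> k. u $ k / \<nu> $ k) $ l - (P *v (\<chi> k. u $ k / \<nu> $ k)) $ l
        = (\<chi> k. v $ k / \<nu> $ k) $ l - (P *v (\<chi> k. v $ k / \<nu> $ k)) $ l"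
      using nu_pos[of l] unfolding reflection_apply by simp
  qed simp
  then have "u $ k / \<nu> $ k = v $ k / \<nu> $ k" for k by (simp add: vec_eq_iff)
  then show ?thesis using nu_pos by (simp add: vec_eq_iff) (metis less_irrefl)
qed

definition drift :: "real^'n" where
  "drift = dual_arrival P lam - reflection *v mu"

text \<open>With w as idleness rates, mu - w = \<nu> (1 + x) are the effective service rates; the
  constant 1 is cancelled by the dual arrivals \<nu> (1 - P 1).\<close>

lemma drift_reflection_apply:
  assumes x: "\<And>k. w $ k = mu $ k - \<nu> $ k * (1 + x $ k)"
  shows "(drift + reflection *v w) $ l = - (\<nu> $ l * (x $ l - (P *v x) $ l))"
proof -
  have "drift + reflection *v w = dual_arrival P lam - reflection *v (mu - w)"
    by (simp add: drift_def matrix_vector_mult_diff_distrib)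
  moreover have "(\<chi> k. (mu - w) $ k / \<nu> $ k) = (\<chi> k. 1 + x $ k)"
    using nu_pos by (auto simp: x vec_eq_iff less_imp_neq[symmetric])
  moreover have "(mu - w) $ l / \<nu> $ l = 1 + x $ l" using nu_pos[of l] by (simp add: x)
  ultimately show ?thesis
    by (simp only: vector_minus_component reflection_apply)
      (simp add: dual_arrival_def Pv algebra_simps sum.distrib)
qed

text \<open>Absence of push off J fixes the boundary values of x and zero velocity on J makes x
  harmonic there, so x solves the Dirichlet problem of \<open>xface J\<close>; w >= 0 then gives the
  hypothesis of \<open>yface_subgradient\<close>.\<close>

lemma fluid_velocity:
  assumes w: "\<And>k. 0 \<le> w $ k" "\<And>k. k \<notin> J \<Longrightarrow> w $ k = 0"
    and v0: "\<And>k. k \<in> J \<Longrightarrow> (drift + reflection *v w) $ k = 0"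
  shows "drift + reflection *v w = - yface J"
    and "yface J \<in> subdifferential (H P lam mu J) (theta_face P lam mu J)"
proof -
  define x where "x = (\<chi> k. (mu $ k - w $ k) / \<nu> $ k - 1)"
  have wx: "w $ k = mu $ k - \<nu> $ k * (1 + x $ k)" for k
    using nu_pos[of k] by (simp add: x_def)
  have "x = xface J"
  proof (rule xface_unique)
    fix k assume "k \<in> J"
    then have "\<nu> $ k * (x $ k - (P *v x) $ k) = 0"
      using v0[of k] drift_reflection_apply[OF wx, of k] by simp
    then show "x $ k = (P *v x) $ k" using nu_pos[of k] by simp
  next
    fix k assume "k \<notin> J"
    then show "x $ k = 1 / rho P lam mu k - 1" by (simp add: x_def w(2) rho_def)
  qed
  with wx have wx: "w $ k = mu $ k - \<nu> $ k * (1 + xface J $ k)" for k by simp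
  show "drift + reflection *v w = - yface J"
    using drift_reflection_apply[OF wx] by (simp add: vec_eq_iff yface_def)
  show "yface J \<in> subdifferential (H P lam mu J) (theta_face P lam mu J)"
  proof (rule yface_subgradient)
    show "\<nu> $ k * (1 + xface J $ k) \<le> mu $ k" for k using wx[of k] w(1)[of k] by simp
  qed
qed

text \<open>Converse of \<open>fluid_velocity\<close>: the weight inequality on J is the
  nonnegativity of the push.\<close>

lemma subgradient_fluid_velocity:
  assumes y: "y \<in> subdifferential (H P lam mu J) (theta_face P lam mu J)"
    and y0: "\<And>k. k \<in> J \<Longrightarrow> y $ k = 0"
  obtains w where "\<And>k. 0 \<le> w $ k" "\<And>k. k \<notin> J \<Longrightarrow> w $ k = 0" "- y = drift + reflection *v w"
proof
  define w where "w = (\<chi> k. mu $ k - \<nu> $ k * (1 + xface J $ k))"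
  have wx: "w $ k = mu $ k - \<nu> $ k * (1 + xface J $ k)" for k by (simp add: w_def)
  show "0 \<le> w $ k" for k
    using subgradient_tangential(2)[OF y y0, of k] xface_off[of k J] wx[of k] by (cases "k \<in> J") auto
  show "w $ k = 0" if "k \<notin> J" for k using xface_off[OF that] wx[of k] by simp
  have "- yface J = drift + reflection *v w"
    using drift_reflection_apply[OF wx] by (simp add: vec_eq_iff yface_def)
  with subgradient_tangential(1)[OF y y0] show "- y = drift + reflection *v w" by (simp only:)
qed

end

section \<open>The oblique reflection problem\<close>

lemma AE_lebesgue_negligible:
  assumes "AE t in lebesgue. Q t"
  obtains N where "negligible N" "\<And>t. t \<notin> N \<Longrightarrow> Q t"
proof -
  obtain N where "N \<in> null_sets lebesgue" "{t. \<not> Q t} \<subseteq> N"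
    using assms unfolding eventually_ae_filter by auto
  then show thesis using that[of N] by (auto simp: negligible_iff_null_sets)
qed

lemma AE_lebesgue_interior:
  fixes a b :: real
  shows "AE t in lebesgue. t \<in> {a..b} \<longrightarrow> t \<in> {a<..<b}"
proof -
  have "negligible {a, b}" by (rule negligible_finite) simp
  then show ?thesis by (intro AE_I'[of "{a, b}"]) (auto simp: negligible_iff_null_sets)
qed

lemma AE_lebesgue_reverse:
  fixes T :: real
  assumes "AE t in lebesgue. Q t"
  shows "AE t in lebesgue. Q (T - t)"
proof -
  obtain N where N: "negligible N" "\<And>t. t \<notin> N \<Longrightarrow> Q t" by (rule AE_lebesgue_negligible[OF assms]) blast
  have "negligible ((\<lambda>t. T - t) ` N)"
    by (rule negligible_differentiable_image_negligible[OF _ N(1)])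
      (auto intro!: differentiable_on_diff)
  moreover have "Q (T - t)" if "t \<notin> (\<lambda>t. T - t) ` N" for t
  proof (rule N(2))
    show "T - t \<notin> N"
    proof
      assume "T - t \<in> N"
      then have "T - (T - t) \<in> (\<lambda>t. T - t) ` N" by (rule imageI)
      then show False using that by simp
    qed
  qed
  ultimately show ?thesis
    by (intro AE_I'[of "(\<lambda>t. T - t) ` N"]) (auto simp: negligible_iff_null_sets)
qed

lemma abs_cont_increment_le:
  fixes F :: "real \<Rightarrow> real"
  assumes F: "abs_cont_on {a..b} F" and ab: "a \<le> b"
    and D: "AE t in lebesgue. t \<in> {a..b} \<longrightarrow> (\<exists>D. (F has_vector_derivative D) (at t) \<and> D \<le> c)"
  shows "F b - F a \<le> c * (b - a)"
proof -
  obtain N where N: "negligible N"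
    "\<And>t. t \<notin> N \<Longrightarrow> t \<in> {a..b} \<longrightarrow> (\<exists>D. (F has_vector_derivative D) (at t) \<and> D \<le> c)"
    by (rule AE_lebesgue_negligible[OF D]) blast
  define f where "f t = (if t \<in> N then c else vector_derivative F (at t))" for t
  have "(f has_integral (F b - F a)) {a..b}"
  proof (rule abs_cont_FTC[OF F ab N(1)])
    fix t assume "t \<in> {a..b}" "t \<notin> N"
    then show "(F has_vector_derivative f t) (at t)"
      using N(2)[of t] by (auto simp: f_def vector_derivative_works[symmetric] intro: differentiableI_vector)
  qed
  moreover have "((\<lambda>t. c) has_integral (b - a) *\<^sub>R c) {a..b}"
    using has_integral_const_real[of c a b] ab by simp
  moreover have "f t \<le> c" if "t \<in> {a..b}" for t
    using N(2)[of t] that by (auto simp: f_def vector_derivative_at)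
  ultimately have "F b - F a \<le> (b - a) *\<^sub>R c" by (rule has_integral_le)
  then show ?thesis by (simp add: mult.commute)
qed

lemma nn_integral_has_integral_AE_nonneg:
  fixes g :: "real \<Rightarrow> real"
  assumes g: "(g has_integral I) {a..b}"
    and nonneg: "AE t in lebesgue. t \<in> {a..b} \<longrightarrow> 0 \<le> g t"
  shows "(\<integral>\<^sup>+t\<in>{a..b}. ennreal (g t) \<partial>lebesgue) = ennreal I" and "0 \<le> I"
proof -
  obtain N where N: "negligible N" "\<And>t. t \<notin> N \<Longrightarrow> t \<in> {a..b} \<longrightarrow> 0 \<le> g t"
    by (rule AE_lebesgue_negligible[OF nonneg]) blast
  define g' where "g' t = (if t \<in> {a..b} then max (g t) 0 else 0)" for t
  have "((\<lambda>t. max (g t) 0) has_integral I) {a..b}"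
    by (rule has_integral_spike[OF N(1) _ g]) (use N(2) in \<open>force simp: max_def\<close>)
  then have "(g' has_integral I) UNIV"
    unfolding g'_def by (subst has_integral_restrict_UNIV)
  then have *: "integral\<^sup>N lebesgue g' = ennreal I" "0 \<le> I"
    by (subst (asm) has_integral_iff_nn_integral_lebesgue; simp add: g'_def)+
  show "0 \<le> I" by fact
  have "(\<integral>\<^sup>+t\<in>{a..b}. ennreal (g t) \<partial>lebesgue) = integral\<^sup>N lebesgue g'"
    by (rule nn_integral_cong) (auto simp: g'_def indicator_def max_def ennreal_neg)
  then show "(\<integral>\<^sup>+t\<in>{a..b}. ennreal (g t) \<partial>lebesgue) = ennreal I" using * by simp
qed

text \<open>g may take negative values. If its positive part has infinite integral, nothing is to be
  shown; otherwise the positive part is gauge integrable and dominates g.\<close>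

lemma has_integral_le_nn_integral:
  fixes g :: "real \<Rightarrow> real"
  assumes g: "(g has_integral I) {a..b}"
    and le: "AE t in lebesgue. t \<in> {a..b} \<longrightarrow> ennreal (g t) \<le> F t"
  shows "ennreal I \<le> (\<integral>\<^sup>+t\<in>{a..b}. F t \<partial>lebesgue)"
proof -
  define g' where "g' t = max (g t * indicator {a..b} t) 0" for t
  have meas: "g' \<in> borel_measurable lebesgue"
    unfolding g'_def
    by (intro borel_measurable_max borel_measurable_const has_integral_implies_lebesgue_measurable_real[OF g])
  have "ennreal I \<le> integral\<^sup>N lebesgue g'"
  proof (cases "integral\<^sup>N lebesgue g'")
    case (real R)
    then have R: "(g' has_integral R) UNIV"
      by (subst has_integral_iff_nn_integral_lebesgue) (simp_all add: meas g'_def)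
    have I: "((\<lambda>t. if t \<in> {a..b} then g t else 0) has_integral I) UNIV"
      using g by (subst has_integral_restrict_UNIV)
    have "I \<le> R" by (rule has_integral_le[OF I R]) (auto simp: g'_def)
    then show ?thesis using real by (simp add: ennreal_leI)
  qed simp
  also have "\<dots> \<le> (\<integral>\<^sup>+t\<in>{a..b}. F t \<partial>lebesgue)"
  proof (rule nn_integral_mono_AE)
    show "AE t in lebesgue. ennreal (g' t) \<le> F t * indicator {a..b} t"
      using le by eventually_elim (auto simp: g'_def indicator_def max_def ennreal_neg)
  qed
  finally show ?thesis .
qed

text \<open>The equality case of the preceding comparison: F is finite almost everywhere, so its
  real version minus g is nonnegative almost everywhere and has integral 0.\<close>

lemma nn_integral_eq_has_integral_AE_eq:
  fixes g :: "real \<Rightarrow> real"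
  assumes g: "(g has_integral I) {a..b}"
    and le: "AE t in lebesgue. t \<in> {a..b} \<longrightarrow> ennreal (g t) \<le> F t"
    and meas: "(\<lambda>t. F t * indicator {a..b} t) \<in> borel_measurable lebesgue"
    and eq: "(\<integral>\<^sup>+t\<in>{a..b}. F t \<partial>lebesgue) = ennreal I" and "0 \<le> I"
  shows "AE t in lebesgue. t \<in> {a..b} \<longrightarrow> F t = ennreal (g t) \<and> 0 \<le> g t"
proof -
  define L where "L t = enn2real (F t * indicator {a..b} t)" for t
  have fin: "AE t in lebesgue. F t * indicator {a..b} t \<noteq> \<infinity>"
    by (rule nn_integral_PInf_AE[OF meas]) (simp add: eq)
  have L0: "0 \<le> L t" for t by (simp add: L_def)
  have Lm: "L \<in> borel_measurable lebesgue" unfolding L_def using meas by simp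
  have "integral\<^sup>N lebesgue L = (\<integral>\<^sup>+t\<in>{a..b}. F t \<partial>lebesgue)"
  proof (rule nn_integral_cong_AE)
    show "AE t in lebesgue. ennreal (L t) = F t * indicator {a..b} t"
      using fin by eventually_elim (simp add: L_def less_top)
  qed
  then have Lint: "(L has_integral I) UNIV"
    by (subst has_integral_iff_nn_integral_lebesgue) (simp_all add: L0 Lm eq \<open>0 \<le> I\<close>)
  have "((\<lambda>t. if t \<in> {a..b} then g t else 0) has_integral I) UNIV"
    using g by (subst has_integral_restrict_UNIV)
  from has_integral_diff[OF Lint this]
  have diff: "((\<lambda>t. L t - (if t \<in> {a..b} then g t else 0)) has_integral 0) UNIV" by simp
  have le': "AE t in lebesgue. (if t \<in> {a..b} then g t else 0) \<le> L t"
    using le fin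
  proof eventually_elim
    case (elim t)
    show ?case
    proof (cases "t \<in> {a..b}")
      case True
      then have "ennreal (g t) \<le> ennreal (L t)" using elim by (simp add: L_def less_top)
      then show ?thesis using True L0[of t] by (cases "0 \<le> g t") (auto simp: ennreal_le_iff)
    qed (use L0 in auto)
  qed
  obtain N where N: "negligible N" "\<And>t. t \<notin> N \<Longrightarrow> (if t \<in> {a..b} then g t else 0) \<le> L t"
    by (rule AE_lebesgue_negligible[OF le']) blast
  define k where "k t = max (L t - (if t \<in> {a..b} then g t else 0)) 0" for t
  have "(k has_integral 0) UNIV"
  proof (rule has_integral_spike[OF N(1) _ diff])
    fix t assume "t \<in> UNIV - N"
    then show "k t = L t - (if t \<in> {a..b} then g t else 0)"
      using N(2)[of t] unfolding k_def by (intro max_absorb1) simp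
  qed
  then have km: "k \<in> borel_measurable lebesgue" and k0: "integral\<^sup>N lebesgue k = 0"
    by (subst (asm) has_integral_iff_nn_integral_lebesgue; simp add: k_def)+
  have "(\<lambda>t. ennreal (k t)) \<in> borel_measurable lebesgue" using km by (rule measurable_compose) simp
  then have "AE t in lebesgue. ennreal (k t) = 0"
    using k0 nn_integral_0_iff_AE by blast
  with le' fin show ?thesis
  proof eventually_elim
    case (elim t)
    show ?case
    proof
      assume t: "t \<in> {a..b}"
      have "k t \<le> 0" using elim(3) by (simp add: ennreal_eq_0_iff)
      then have "L t = g t" using elim(1) t by (simp add: k_def)
      then show "F t = ennreal (g t) \<and> 0 \<le> g t" using elim(2) t L0[of t]
        by (auto simp: L_def less_top simp flip: \<open>L t = g t\<close>)
    qed
  qed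
qed

text \<open>At an interior time a vanishing coordinate of a path in the orthant has a local
  minimum.\<close>

lemma deriv_zero_on_face:
  fixes q :: "real \<Rightarrow> real^'n"
  assumes q: "q ` {a..b} \<subseteq> nonneg_orthant" and t: "t \<in> {a<..<b}"
    and v: "(q has_vector_derivative v) (at t)" and k: "q t $ k = 0"
  shows "v $ k = 0"
proof (rule DERIV_local_min)
  show "((\<lambda>s. q s $ k) has_real_derivative v $ k) (at t)"
    using bounded_linear.has_vector_derivative[OF bounded_linear_vec_nth v]
    by (simp add: has_real_derivative_iff_has_vector_derivative)
  show "0 < min (t - a) (b - t)" using t by simp
  show "\<forall>s. \<bar>t - s\<bar> < min (t - a) (b - t) \<longrightarrow> q t $ k \<le> q s $ k"
  proof (intro allI impI)
    fix s assume "\<bar>t - s\<bar> < min (t - a) (b - t)"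
    then have "s \<in> {a..b}" by (auto simp: abs_less_iff)
    then have "q s \<in> nonneg_orthant" using q by blast
    then show "q t $ k \<le> q s $ k" using k by (simp add: nonneg_orthant_def)
  qed
qed

section \<open>Uniqueness for the reflection problem\<close>

context jackson_network
begin

text \<open>A finite horizon, with monotonicity of \<open>phi\<close> expressed by the sign of its
  derivative: the form that a reversed minimizer delivers directly.\<close>

definition solves_reflection ::
  "real \<Rightarrow> real^'n \<Rightarrow> (real \<Rightarrow> real^'n) \<Rightarrow> (real \<Rightarrow> real^'n) \<Rightarrow> bool" where
  "solves_reflection T r q phi \<longleftrightarrow> phi 0 = 0 \<and> abs_cont_on {0..T} phi \<and>
     (\<forall>t\<in>{0..T}. q t = r + t *\<^sub>R drift + reflection *v phi t \<and> q t \<in> nonneg_orthant) \<and>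
     (AE t in lebesgue. t \<in> {0..T} \<longrightarrow>
        (\<exists>v. (phi has_vector_derivative v) (at t) \<and> (\<forall>k. 0 \<le> v $ k \<and> q t $ k * v $ k = 0)))"

lemma solves_reflectionD:
  assumes "solves_reflection T r q phi"
  shows "phi 0 = 0" and "abs_cont_on {0..T} phi"
    and "t \<in> {0..T} \<Longrightarrow> q t = r + t *\<^sub>R drift + reflection *v phi t"
    and "t \<in> {0..T} \<Longrightarrow> q t \<in> nonneg_orthant"
    and "AE t in lebesgue. t \<in> {0..T} \<longrightarrow>
        (\<exists>v. (phi has_vector_derivative v) (at t) \<and> (\<forall>k. 0 \<le> v $ k \<and> q t $ k * v $ k = 0))"
  using assms unfolding solves_reflection_def by blast+

lemma solves_reflection_abs_cont:
  assumes "solves_reflection T r q phi"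
  shows "abs_cont_on {0..T} q"
proof (rule abs_cont_on_cong)
  show "abs_cont_on {0..T} (\<lambda>t. r + t *\<^sub>R drift + reflection *v phi t)"
    by (rule abs_cont_on_bounded_linear[OF matrix_vector_mul_bounded_linear])
      (rule solves_reflectionD(2)[OF assms])
qed (rule solves_reflectionD(3)[OF assms, symmetric])

text \<open>At the first maximum \<open>\<tau>\<close> of \<open>\<phi>1\<^sub>k - \<phi>2\<^sub>k\<close> the pushing process \<open>\<phi>1\<^sub>k\<close> is active, so
  \<open>q1\<^sub>k \<tau> = 0 \<le> q2\<^sub>k \<tau>\<close>.\<close>

lemma reflection_comparison:
  assumes 1: "solves_reflection T r q1 phi1" and 2: "solves_reflection T r q2 phi2"
    and M: "\<And>s l. s \<in> {0..T} \<Longrightarrow> \<bar>phi1 s $ l - phi2 s $ l\<bar> \<le> M l" and s: "s \<in> {0..T}"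
  shows "phi1 s $ k - phi2 s $ k \<le> \<nu> $ k * (P *v (\<chi> l. M l / \<nu> $ l)) $ k"
proof -
  define d where "d s = phi1 s $ k - phi2 s $ k" for s
  have ac1: "abs_cont_on {0..T} phi1" and ac2: "abs_cont_on {0..T} phi2"
    by (rule solves_reflectionD(2)[OF 1], rule solves_reflectionD(2)[OF 2])
  have c1: "continuous_on {0..T} phi1" and c2: "continuous_on {0..T} phi2"
    by (intro abs_cont_on_imp_continuous_on ac1 ac2)+
  have cd: "continuous_on {0..T} d" unfolding d_def by (intro continuous_intros c1 c2)
  have M0: "0 \<le> M l" for l using M[OF s, of l] by linarith
  have rhs0: "0 \<le> \<nu> $ k * (P *v (\<chi> l. M l / \<nu> $ l)) $ k"
    unfolding Pv using nu_pos M0 P_nonneg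
    by (intro mult_nonneg_nonneg sum_nonneg) (auto simp: less_imp_le)
  obtain t0 where t0: "t0 \<in> {0..T}" "\<And>t. t \<in> {0..T} \<Longrightarrow> d t \<le> d t0"
    using continuous_attains_sup[OF _ _ cd] s by (metis compact_Icc emptyE)
  show ?thesis
  proof (cases "d t0 \<le> 0")
    case True
    then have "d s \<le> 0" using t0(2)[OF s] by linarith
    then show ?thesis using rhs0 by (simp add: d_def)
  next
    case False
    define A where "A = {t\<in>{0..T}. d t = d t0}"
    have "closed A"
      unfolding A_def by (rule continuous_closed_preimage_constant[OF cd]) simp
    then have "compact A" using compact_Icc by (metis A_def compact_Int_closed inf.absorb_iff2 mem_Collect_eq subsetI)
    moreover have "A \<noteq> {}" using t0(1) by (auto simp: A_def)
    ultimately obtain \<tau> where \<tau>: "\<tau> \<in> A" "\<And>t. t \<in> A \<Longrightarrow> \<tau> \<le> t"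
      using compact_attains_inf[of A] by blast
    have \<tau>T: "\<tau> \<in> {0..T}" "d \<tau> = d t0" using \<tau>(1) by (auto simp: A_def)
    have d0: "d 0 = 0" using solves_reflectionD(1)[OF 1] solves_reflectionD(1)[OF 2] by (simp add: d_def)
    have "\<tau> > 0" using \<tau>T d0 False by (cases "\<tau> = 0") auto
    \<comment> \<open>If this coordinate were positive at \<tau>, it would be so on an interval
      before \<tau>. There the derivative of \<open>phi1\<close> is 0 and that of
      \<open>phi2\<close> nonnegative in coordinate k, so d does not increase and attains its
      maximum earlier.\<close>
    have q1: "q1 \<tau> $ k = 0"
    proof (rule ccontr)
      assume "q1 \<tau> $ k \<noteq> 0"
      moreover have "q1 \<tau> \<in> nonneg_orthant" by (rule solves_reflectionD(4)[OF 1 \<tau>T(1)])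
      ultimately have pos: "q1 \<tau> $ k > 0" by (simp add: nonneg_orthant_def order_less_le)
      have "continuous_on {0..T} (\<lambda>t. q1 t $ k)"
        by (intro continuous_intros abs_cont_on_imp_continuous_on solves_reflection_abs_cont[OF 1])
      then obtain \<delta> where \<delta>: "\<delta> > 0" "\<And>t. t \<in> {0..T} \<Longrightarrow> dist t \<tau> < \<delta> \<Longrightarrow> dist (q1 t $ k) (q1 \<tau> $ k) < q1 \<tau> $ k"
        using \<tau>T(1) pos unfolding continuous_on_iff by metis
      define \<sigma> where "\<sigma> = max 0 (\<tau> - \<delta> / 2)"
      have \<sigma>: "0 \<le> \<sigma>" "\<sigma> < \<tau>" "\<tau> - \<sigma> < \<delta>" using \<delta>(1) \<open>\<tau> > 0\<close> by (auto simp: \<sigma>_def max_def)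
      have sub: "{\<sigma>..\<tau>} \<subseteq> {0..T}" using \<sigma> \<tau>T by auto
      have qpos: "q1 t $ k > 0" if "t \<in> {\<sigma>..\<tau>}" for t
      proof -
        have "t \<in> {0..T}" "dist t \<tau> < \<delta>" using that sub \<sigma> by (auto simp: dist_real_def)
        then show ?thesis using \<delta>(2)[of t] by (auto simp: dist_real_def abs_less_iff)
      qed
      have acd: "abs_cont_on {\<sigma>..\<tau>} d"
      proof (rule abs_cont_on_lipschitz_image[of _ "\<lambda>t. (phi1 t, phi2 t)" 2])
        show "abs_cont_on {\<sigma>..\<tau>} (\<lambda>t. (phi1 t, phi2 t))"
          by (rule abs_cont_on_subset[OF abs_cont_on_Pair[OF ac1 ac2] sub])
        fix u v :: real assume "u \<le> v"
        have "norm (d v - d u) \<le> \<bar>(phi1 v - phi1 u) $ k\<bar> + \<bar>(phi2 v - phi2 u) $ k\<bar>"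
          by (simp add: d_def)
        also have "\<dots> \<le> norm (phi1 v - phi1 u) + norm (phi2 v - phi2 u)"
          by (intro add_mono component_le_norm_cart)
        also have "\<dots> \<le> 2 * norm (phi1 v - phi1 u, phi2 v - phi2 u)"
          using norm_fst_le[of "phi1 v - phi1 u" "phi2 v - phi2 u"] norm_snd_le[of "phi2 v - phi2 u" "phi1 v - phi1 u"]
          by simp
        finally show "norm (d v - d u) \<le> 2 * (norm ((phi1 v, phi2 v) - (phi1 u, phi2 u)) + (v - u))"
          using \<open>u \<le> v\<close> by simp
      qed simp
      have "d \<tau> - d \<sigma> \<le> 0 * (\<tau> - \<sigma>)"
      proof (rule abs_cont_increment_le[OF acd])
        have A1: "AE t in lebesgue. t \<in> {0..T} \<longrightarrow>
            (\<exists>v. (phi1 has_vector_derivative v) (at t) \<and> (\<forall>k. 0 \<le> v $ k \<and> q1 t $ k * v $ k = 0))"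
          and A2: "AE t in lebesgue. t \<in> {0..T} \<longrightarrow>
            (\<exists>v. (phi2 has_vector_derivative v) (at t) \<and> (\<forall>k. 0 \<le> v $ k \<and> q2 t $ k * v $ k = 0))"
          by (rule solves_reflectionD(5)[OF 1], rule solves_reflectionD(5)[OF 2])
        from A1 A2 show "AE t in lebesgue. t \<in> {\<sigma>..\<tau>} \<longrightarrow> (\<exists>D. (d has_vector_derivative D) (at t) \<and> D \<le> 0)"
        proof eventually_elim
          case (elim t)
          show ?case
          proof
            assume t: "t \<in> {\<sigma>..\<tau>}"
            then have "t \<in> {0..T}" using sub by blast
            then obtain v1 v2 where v: "(phi1 has_vector_derivative v1) (at t)" "q1 t $ k * v1 $ k = 0"
              "(phi2 has_vector_derivative v2) (at t)" "0 \<le> v2 $ k"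
              using elim by blast
            have "(d has_vector_derivative (v1 $ k - v2 $ k)) (at t)"
              unfolding d_def by (intro has_vector_derivative_diff
                  bounded_linear.has_vector_derivative[OF bounded_linear_vec_nth] v)
            moreover have "v1 $ k = 0" using v(2) qpos[OF t] by simp
            ultimately show "\<exists>D. (d has_vector_derivative D) (at t) \<and> D \<le> 0" using v(4) by auto
          qed
        qed
      qed (use \<sigma> in simp)
      moreover have "d \<sigma> \<le> d t0" using t0(2)[of \<sigma>] sub \<sigma> by auto
      ultimately have "\<sigma> \<in> A" using \<tau>T sub \<sigma> by (auto simp: A_def)
      then show False using \<tau>(2)[of \<sigma>] \<sigma> by simp
    qed
    \<comment> \<open>The sign of coordinate k of q1 - q2, the image of e under
      \<open>reflection\<close>, bounds e_k / \<nu>_k by coordinate k of P (e / \<nu>), and e <= M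
      coordinatewise.\<close>
    define e where "e = phi1 \<tau> - phi2 \<tau>"
    have "q2 \<tau> \<in> nonneg_orthant" by (rule solves_reflectionD(4)[OF 2 \<tau>T(1)])
    then have "(q1 \<tau> - q2 \<tau>) $ k \<le> 0" using q1 by (simp add: nonneg_orthant_def)
    moreover have "q1 \<tau> - q2 \<tau> = reflection *v e"
      unfolding solves_reflectionD(3)[OF 1 \<tau>T(1)] solves_reflectionD(3)[OF 2 \<tau>T(1)]
      by (simp add: e_def matrix_vector_mult_diff_distrib)
    ultimately have "\<nu> $ k * (e $ k / \<nu> $ k - (P *v (\<chi> l. e $ l / \<nu> $ l)) $ k) \<le> 0"
      by (simp add: reflection_apply)
    then have "e $ k \<le> \<nu> $ k * (P *v (\<chi> l. e $ l / \<nu> $ l)) $ k"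
      using nu_pos[of k] by (simp add: right_diff_distrib)
    also have "\<dots> \<le> \<nu> $ k * (P *v (\<chi> l. M l / \<nu> $ l)) $ k"
    proof (intro mult_left_mono P_mono)
      fix l show "(\<chi> l. e $ l / \<nu> $ l) $ l \<le> (\<chi> l. M l / \<nu> $ l) $ l"
        using M[OF \<tau>T(1), of l] nu_pos[of l] by (simp add: e_def divide_right_mono)
    qed (use nu_pos[of k] in simp)
    finally have "d t0 \<le> \<nu> $ k * (P *v (\<chi> l. M l / \<nu> $ l)) $ k" using \<tau>T(2) by (simp add: e_def d_def)
    then show ?thesis using t0(2)[OF s] by (simp add: d_def)
  qed
qed

text \<open>With M the coordinatewise maxima of the modulus of phi1 - phi2, the comparison in both
  orders makes M / \<nu> subharmonic; the minimum principle for its negative forces M <= 0.\<close>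

lemma reflection_unique:
  assumes 1: "solves_reflection T r q1 phi1" and 2: "solves_reflection T r q2 phi2"
    and t: "t \<in> {0..T}"
  shows "q1 t = q2 t"
proof -
  have "\<exists>s\<in>{0..T}. \<forall>t\<in>{0..T}. \<bar>phi1 t $ l - phi2 t $ l\<bar> \<le> \<bar>phi1 s $ l - phi2 s $ l\<bar>" for l
  proof (rule continuous_attains_sup)
    show "{0..T} \<noteq> {}" using t by blast
    show "continuous_on {0..T} (\<lambda>t. \<bar>phi1 t $ l - phi2 t $ l\<bar>)"
      by (intro continuous_intros abs_cont_on_imp_continuous_on
          solves_reflectionD(2)[OF 1] solves_reflectionD(2)[OF 2])
  qed simp
  then obtain s where s: "\<And>l. s l \<in> {0..T}"
    "\<And>l t. t \<in> {0..T} \<Longrightarrow> \<bar>phi1 t $ l - phi2 t $ l\<bar> \<le> \<bar>phi1 (s l) $ l - phi2 (s l) $ l\<bar>"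
    by metis
  define M where "M l = \<bar>phi1 (s l) $ l - phi2 (s l) $ l\<bar>" for l
  define y where "y = (\<chi> l. M l / \<nu> $ l)"
  have le: "M k \<le> \<nu> $ k * (P *v y) $ k" for k
    using reflection_comparison[OF 1 2, of M "s k" k] reflection_comparison[OF 2 1, of M "s k" k] s
    by (auto simp: M_def y_def abs_minus_commute)
  have "0 \<le> (- y) $ k" for k
  proof (rule minimum_principle[of UNIV])
    fix k
    have "y $ k \<le> (P *v y) $ k"
      using le[of k] nu_pos[of k] by (simp add: y_def divide_le_eq mult.commute)
    then show "(P *v (- y)) $ k \<le> (- y) $ k"
      using matrix_vector_mult_scaleR[of P "-1" y] by simp
  qed simp
  then have "M k \<le> 0" for k
    using nu_pos[of k] by (simp add: y_def divide_le_0_iff) (metis less_le_not_le)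
  then have "phi1 t $ k = phi2 t $ k" for k using s(2)[OF t, of k] unfolding M_def by force
  then have "phi1 t = phi2 t" by (simp add: vec_eq_iff)
  then show ?thesis using solves_reflectionD(3)[OF 1 t] solves_reflectionD(3)[OF 2 t] by simp
qed

section \<open>Velocity and extinction of the dual fluid\<close>

abbreviation zeros :: "real^'n \<Rightarrow> 'n set" where "zeros x \<equiv> {k. x $ k = 0}"

text \<open>Tangency to the face and complementarity of the nonnegative push are the hypotheses of
  \<open>fluid_velocity\<close>, so the face alone determines the velocity.\<close>

lemma reflection_velocity:
  assumes sol: "solves_reflection T r q phi"
  shows "AE t in lebesgue. t \<in> {0..T} \<longrightarrow>
    (q has_vector_derivative - yface (zeros (q t))) (at t) \<and>
    yface (zeros (q t)) \<in> subdifferential (H P lam mu (zeros (q t))) (theta_face P lam mu (zeros (q t)))"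
proof -
  have "AE t in lebesgue. t \<in> {0..T} \<longrightarrow>
        (\<exists>v. (phi has_vector_derivative v) (at t) \<and> (\<forall>k. 0 \<le> v $ k \<and> q t $ k * v $ k = 0))"
    by (rule solves_reflectionD(5)[OF sol])
  with AE_lebesgue_interior[of 0 T] show ?thesis
  proof eventually_elim
    case (elim t)
    show ?case
    proof
      assume "t \<in> {0..T}"
      with elim obtain w where t: "t \<in> {0<..<T}" and w: "(phi has_vector_derivative w) (at t)"
        "\<And>k. 0 \<le> w $ k" "\<And>k. q t $ k * w $ k = 0" by blast
      have "((\<lambda>t. r + t *\<^sub>R drift + reflection *v phi t) has_vector_derivative (drift + reflection *v w)) (at t)"
        by (auto intro!: derivative_eq_intros
            bounded_linear.has_vector_derivative[OF matrix_vector_mul_bounded_linear w(1)])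
      then have qd: "(q has_vector_derivative (drift + reflection *v w)) (at t)"
        by (rule has_vector_derivative_transform_within_open[of _ _ _ "{0<..<T}"])
          (use t in \<open>auto intro!: solves_reflectionD(3)[OF sol, symmetric]\<close>)
      have "q ` {0..T} \<subseteq> nonneg_orthant" by (intro image_subsetI solves_reflectionD(4)[OF sol])
      then have "(drift + reflection *v w) $ k = 0" if "k \<in> zeros (q t)" for k
        using deriv_zero_on_face[OF _ t qd, of k] that by simp
      moreover have "w $ k = 0" if "k \<notin> zeros (q t)" for k using w(3)[of k] that by simp
      ultimately have "drift + reflection *v w = - yface (zeros (q t))"
        "yface (zeros (q t)) \<in> subdifferential (H P lam mu (zeros (q t))) (theta_face P lam mu (zeros (q t)))"
        using fluid_velocity[of w "zeros (q t)"] w(2) by blast+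
      then show "(q has_vector_derivative - yface (zeros (q t))) (at t) \<and>
         yface (zeros (q t)) \<in> subdifferential (H P lam mu (zeros (q t))) (theta_face P lam mu (zeros (q t)))"
        using qd by simp
    qed
  qed
qed

lemma fluid_trajectory_solves:
  assumes "fluid_trajectory (dual_routing P lam) (dual_arrival P lam) mu r q"
  obtains phi where "\<And>T. 0 \<le> T \<Longrightarrow> solves_reflection T r q phi"
proof -
  obtain phi :: "real \<Rightarrow> real^'n" where phi: "phi 0 = 0" "\<And>T. 0 \<le> T \<Longrightarrow> abs_cont_on {0..T} phi"
    "\<And>k. mono_on {0..} (\<lambda>t. phi t $ k)"
    "\<And>t. 0 \<le> t \<Longrightarrow> q t = r + t *\<^sub>R drift + reflection *v phi t \<and> q t \<in> nonneg_orthant"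
    "AE t in lebesgue. 0 \<le> t \<longrightarrow> (\<exists>v. (phi has_vector_derivative v) (at t) \<and> (\<forall>k. q t $ k * v $ k = 0))"
    using assms unfolding fluid_trajectory_def drift_def reflection_def by blast
  show thesis
  proof (rule that)
    fix T :: real assume "0 \<le> T"
    have "AE t in lebesgue. t \<in> {0..T} \<longrightarrow>
        (\<exists>v. (phi has_vector_derivative v) (at t) \<and> (\<forall>k. 0 \<le> v $ k \<and> q t $ k * v $ k = 0))"
      using phi(5) AE_lebesgue_interior[of 0 T]
    proof eventually_elim
      case (elim t)
      show ?case
      proof
        assume "t \<in> {0..T}"
        with elim obtain v where t: "0 < t" and v: "(phi has_vector_derivative v) (at t)" "\<forall>k. q t $ k * v $ k = 0"
          by auto
        have "0 \<le> v $ k" for k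
        proof (rule mono_on_imp_deriv_nonneg[OF phi(3)])
          show "((\<lambda>t. phi t $ k) has_real_derivative v $ k) (at t)"
            using bounded_linear.has_vector_derivative[OF bounded_linear_vec_nth v(1)]
            by (simp add: has_real_derivative_iff_has_vector_derivative)
          show "t \<in> interior {0..}" using t by simp
        qed
        then show "\<exists>v. (phi has_vector_derivative v) (at t) \<and> (\<forall>k. 0 \<le> v $ k \<and> q t $ k * v $ k = 0)"
          using v by blast
      qed
    qed
    then show "solves_reflection T r q phi"
      unfolding solves_reflection_def using phi(1,2,4) \<open>0 \<le> T\<close> by (meson atLeastAtMost_iff)
  qed
qed

text \<open>Used with a positive c as long as the fluid avoids the origin, and with c = 0 to show
  that it stays there.\<close>

lemma reflection_mass_decreasing:
  assumes sol: "solves_reflection T r q phi" and st: "0 \<le> s" "s \<le> t" "t \<le> T"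
    and c: "\<And>u. u \<in> {s..t} \<Longrightarrow> c \<le> lam \<bullet> xface (zeros (q u))"
  shows "(\<Sum>k\<in>UNIV. q t $ k) - (\<Sum>k\<in>UNIV. q s $ k) \<le> - c * (t - s)"
proof -
  have bl: "bounded_linear (\<lambda>x :: real^'n. \<Sum>k\<in>UNIV. x $ k)"
    by (intro bounded_linear_sum bounded_linear_vec_nth)
  have sub: "{s..t} \<subseteq> {0..T}" using st by auto
  show ?thesis
  proof (rule abs_cont_increment_le[OF _ st(2)])
    show "abs_cont_on {s..t} (\<lambda>t. \<Sum>k\<in>UNIV. q t $ k)"
      by (rule abs_cont_on_linear_image[OF bl abs_cont_on_subset[OF solves_reflection_abs_cont[OF sol] sub]])
    show "AE u in lebesgue. u \<in> {s..t} \<longrightarrow>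
        (\<exists>D. ((\<lambda>t. \<Sum>k\<in>UNIV. q t $ k) has_vector_derivative D) (at u) \<and> D \<le> - c)"
      using reflection_velocity[OF sol]
    proof eventually_elim
      case (elim u)
      show ?case
      proof
        assume u: "u \<in> {s..t}"
        then have "(q has_vector_derivative - yface (zeros (q u))) (at u)" using elim sub by blast
        then have "((\<lambda>t. \<Sum>k\<in>UNIV. q t $ k) has_vector_derivative (\<Sum>k\<in>UNIV. (- yface (zeros (q u))) $ k)) (at u)"
          by (rule bounded_linear.has_vector_derivative[OF bl])
        moreover have "(\<Sum>k\<in>UNIV. (- yface (zeros (q u))) $ k) \<le> - c"
          using c[OF u] sum_yface[of "zeros (q u)"] by (simp add: sum_negf)
        ultimately show "\<exists>D. ((\<lambda>t. \<Sum>k\<in>UNIV. q t $ k) has_vector_derivative D) (at u) \<and> D \<le> - c" by blast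
      qed
    qed
  qed
qed

lemma nonneg_orthant_sum_zero:
  assumes "x \<in> nonneg_orthant" "(\<Sum>k\<in>UNIV. x $ k) \<le> 0"
  shows "x = (0 :: real^'n)"
proof -
  have nn: "\<And>k. 0 \<le> x $ k" using assms(1) by (simp add: nonneg_orthant_def)
  then have "(\<Sum>k\<in>UNIV. x $ k) = 0" using assms(2) sum_nonneg[of UNIV "\<lambda>k. x $ k"] by force
  then show ?thesis using nn by (simp add: sum_nonneg_eq_0_iff vec_eq_iff)
qed

lemma fluid_reaches_origin:
  assumes q: "fluid_trajectory (dual_routing P lam) (dual_arrival P lam) mu r q"
  shows "0 \<le> first_time_at_origin q" and "q (first_time_at_origin q) = 0"
    and "\<And>t. first_time_at_origin q \<le> t \<Longrightarrow> q t = 0"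
    and "\<And>t. 0 \<le> t \<Longrightarrow> q t = 0 \<Longrightarrow> first_time_at_origin q \<le> t"
proof -
  obtain phi where sol: "\<And>T. 0 \<le> T \<Longrightarrow> solves_reflection T r q phi"
    by (rule fluid_trajectory_solves[OF q]) blast
  have orth: "q t \<in> nonneg_orthant" if "0 \<le> t" for t
    by (rule solves_reflectionD(4)[OF sol[OF that]]) (use that in simp)
  have mass0: "0 \<le> lam \<bullet> xface J" for J
    unfolding inner_vec_def
    by (rule sum_nonneg) (use lam_pos xface_nonneg in \<open>auto simp: less_imp_le\<close>)
  \<comment> \<open>Off the origin some coordinate k is nonzero and contributes lam_k (1 / rho_k -
    1) to the rate of loss; c is the least such contribution.\<close>
  obtain i where i: "\<And>k. lam $ i * (1 / rho P lam mu i - 1) \<le> lam $ k * (1 / rho P lam mu k - 1)"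
    using finite_type_minimum[of "\<lambda>k. lam $ k * (1 / rho P lam mu k - 1)"] by blast
  define c where "c = lam $ i * (1 / rho P lam mu i - 1)"
  have "c > 0" using lam_pos[of i] rho_pos[of i] rho_lt_1[of i] by (simp add: c_def)
  have rate: "c \<le> lam \<bullet> xface (zeros x)" if "x \<noteq> 0" for x :: "real^'n"
  proof -
    obtain k where k: "k \<notin> zeros x" using \<open>x \<noteq> 0\<close> by (auto simp: vec_eq_iff)
    have "c \<le> lam $ k * xface (zeros x) $ k" using i[of k] xface(2)[OF k] by (simp add: c_def)
    also have "\<dots> \<le> (\<Sum>l\<in>UNIV. lam $ l * xface (zeros x) $ l)"
      by (rule member_le_sum) (use lam_pos xface_nonneg in \<open>auto simp: less_imp_le\<close>)
    finally show ?thesis by (simp add: inner_vec_def)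
  qed
  define Z where "Z = {t. 0 \<le> t \<and> q t = 0}"
  have "\<exists>t\<ge>0. q t = 0"
  proof (rule ccontr)
    assume none: "\<not> ?thesis"
    define S where "S = (\<Sum>k\<in>UNIV. q 0 $ k)"
    have S0: "0 \<le> S" using orth[of 0] by (auto simp: S_def nonneg_orthant_def intro: sum_nonneg)
    \<comment> \<open>Past time S / c the total mass would be negative.\<close>
    define T where "T = S / c + 1"
    have T: "0 \<le> T" "c * T > S" using S0 \<open>c > 0\<close> by (auto simp: T_def field_simps)
    have "(\<Sum>k\<in>UNIV. q T $ k) - S \<le> - c * (T - 0)"
      unfolding S_def
      by (rule reflection_mass_decreasing[OF sol[OF T(1)]]) (use none T rate in auto)
    moreover have "0 \<le> (\<Sum>k\<in>UNIV. q T $ k)"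
      using orth[OF T(1)] by (auto simp: nonneg_orthant_def intro: sum_nonneg)
    ultimately show False using T(2) by simp
  qed
  then obtain t0 where t0: "0 \<le> t0" "q t0 = 0" by blast
  have bdd: "bdd_below Z" by (auto simp: Z_def intro: bdd_belowI[of _ 0])
  \<comment> \<open>The zero set is closed, so the infimum in \<open>first_time_at_origin\<close> is
    attained.\<close>
  have "continuous_on {0..t0} q"
    by (rule abs_cont_on_imp_continuous_on[OF solves_reflection_abs_cont[OF sol[OF t0(1)]]])
  then have "closed {t\<in>{0..t0}. q t = 0}"
    by (rule continuous_closed_preimage_constant) simp
  then have "compact {t\<in>{0..t0}. q t = 0}"
    by (metis (no_types, lifting) bounded_closed_interval bounded_subset compact_eq_bounded_closed mem_Collect_eq subsetI)
  moreover have "{t\<in>{0..t0}. q t = 0} \<noteq> {}" using t0 by auto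
  ultimately obtain m where m: "m \<in> {t\<in>{0..t0}. q t = 0}" "\<And>t. t \<in> {t\<in>{0..t0}. q t = 0} \<Longrightarrow> m \<le> t"
    using compact_attains_inf[of "{t\<in>{0..t0}. q t = 0}"] by blast
  have mZ: "m \<in> Z" using m(1) by (simp add: Z_def)
  have "m \<le> t" if "t \<in> Z" for t
    using that m(2)[of t] m(1) by (cases "t \<le> t0") (auto simp: Z_def)
  then have "Inf Z = m" using mZ by (intro cInf_eq_minimum) auto
  then have fm: "first_time_at_origin q = m" by (simp add: first_time_at_origin_def Z_def)
  show "0 \<le> first_time_at_origin q" "q (first_time_at_origin q) = 0" using mZ by (auto simp: fm Z_def)
  show "first_time_at_origin q \<le> t" if "0 \<le> t" "q t = 0" for t
    unfolding fm \<open>Inf Z = m\<close>[symmetric] by (rule cInf_lower[OF _ bdd]) (simp add: Z_def that)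
  show "q t = 0" if "first_time_at_origin q \<le> t" for t
  proof (rule nonneg_orthant_sum_zero)
    have t: "0 \<le> m" "m \<le> t" "q m = 0" using that mZ by (auto simp: fm Z_def)
    show "q t \<in> nonneg_orthant" by (rule orth) (use t in simp)
    have "(\<Sum>k\<in>UNIV. q t $ k) - (\<Sum>k\<in>UNIV. q m $ k) \<le> - 0 * (t - m)"
      by (rule reflection_mass_decreasing[OF sol[of t]]) (use t mass0 in auto)
    then show "(\<Sum>k\<in>UNIV. q t $ k) \<le> 0" using t by simp
  qed
qed

end

section \<open>The variational problem\<close>

lemma face_borel: "face J \<in> sets (borel :: (real^'n) measure)"
proof -
  have eq: "face J = (\<Inter>i\<in>J. {x :: real^'n. x $ i = 0}) \<inter> (\<Inter>i\<in>-J. {x. 0 < x $ i})"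
    by (auto simp: face_def)
  show ?thesis unfolding eq
    by (intro sets.Int borel_closed borel_open closed_INT open_INT ballI closed_Collect_eq open_Collect_less
        continuous_intros) auto
qed

lemma face_iff:
  assumes "x \<in> nonneg_orthant"
  shows "x \<in> face J \<longleftrightarrow> J = {k. x $ k = 0}"
  using assms by (force simp: face_def nonneg_orthant_def order_less_le)

lemma L_face_ge: "ereal (th \<bullet> y - H P lam mu J th) \<le> L_face P lam mu J y"
  unfolding L_face_def by (rule SUP_upper) simp

lemma L_face_nonneg: "0 \<le> L_face P lam mu J y"
proof -
  have "H P lam mu J 0 = 0" by (simp add: H_def h_def)
  then show ?thesis using L_face_ge[of 0 y P lam mu J] by (simp flip: zero_ereal_def)
qed

text \<open>A supremum of uncountably many affine functions: measurability comes from lower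
  semicontinuity, the sets where it exceeds a constant being open.\<close>

lemma L_face_borel: "L_face P lam mu J \<in> borel_measurable borel"
proof (rule borel_measurableI_greater)
  fix c
  have "{y. c < L_face P lam mu J y} = (\<Union>th. {y. c < ereal (th \<bullet> y - H P lam mu J th)})"
    by (auto simp: L_face_def less_SUP_iff)
  also have "open \<dots>"
    by (intro open_UN ballI open_Collect_less continuous_intros)
  finally show "{y \<in> space borel. c < L_face P lam mu J y} \<in> sets borel" by simp
qed

lemma Lagrangian_eq_L_face:
  assumes "x \<in> nonneg_orthant"
  shows "Lagrangian P lam mu x y = L_face P lam mu {k. x $ k = 0} y"
proof -
  have "Lagrangian P lam mu x y = (\<Sum>J\<in>UNIV. if J = {k. x $ k = 0} then L_face P lam mu J y else 0)"
    unfolding Lagrangian_def by (rule sum.cong) (auto simp: indicator_def face_iff[OF assms])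
  then show ?thesis by simp
qed

lemma Lagrangian_borel:
  assumes "q \<in> borel_measurable M" "v \<in> borel_measurable M"
  shows "(\<lambda>t. Lagrangian P lam mu (q t) (v t)) \<in> borel_measurable M"
proof -
  have "(\<lambda>t. indicator (face J) (q t) * L_face P lam mu J (v t)) \<in> borel_measurable M" for J
    by (intro borel_measurable_ereal_times measurable_compose[OF assms(1)] measurable_compose[OF assms(2)]
        borel_measurable_indicator face_borel L_face_borel)
  then show ?thesis unfolding Lagrangian_def by (intro borel_measurable_ereal_sum) auto
qed

lemma admissible_derivative:
  fixes q :: "real \<Rightarrow> real^'n"
  assumes "admissible r T q"
  shows "AE t in lebesgue. t \<in> {0..T} \<longrightarrow>
    (q has_vector_derivative vector_derivative q (at t)) (at t) \<and> q t \<in> nonneg_orthant \<and>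
    (\<forall>k. q t $ k = 0 \<longrightarrow> vector_derivative q (at t) $ k = 0)"
proof -
  have q: "abs_cont_on {0..T} q" "q ` {0..T} \<subseteq> nonneg_orthant" using assms by (simp_all add: admissible_def)
  show ?thesis
    using abs_cont_differentiable_AE[OF q(1)] AE_lebesgue_interior[of 0 T]
    by eventually_elim (use deriv_zero_on_face[OF q(2)] q(2) in blast)
qed

text \<open>The value depends on the end points only, which gives a bound common to all paths; with
  unit vectors for c it also yields measurability of the derivative.\<close>

lemma admissible_integral:
  fixes q :: "real \<Rightarrow> real^'n"
  assumes "admissible r T q"
  shows "((\<lambda>t. c \<bullet> vector_derivative q (at t)) has_integral c \<bullet> r) {0..T}"
proof -
  have q: "abs_cont_on {0..T} q" "0 \<le> T" "q 0 = 0" "q T = r" using assms by (simp_all add: admissible_def)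
  obtain N where N: "negligible N"
    "\<And>t. t \<notin> N \<Longrightarrow> t \<in> {0..T} \<longrightarrow> (q has_vector_derivative vector_derivative q (at t)) (at t)"
    by (rule AE_lebesgue_negligible[OF abs_cont_differentiable_AE[OF q(1)]]) blast
  have "((\<lambda>t. c \<bullet> vector_derivative q (at t)) has_integral c \<bullet> q T - c \<bullet> q 0) {0..T}"
  proof (rule abs_cont_FTC[OF abs_cont_on_linear_image[OF bounded_linear_inner_right q(1)] q(2) N(1)])
    fix t assume "t \<in> {0..T}" "t \<notin> N"
    then show "((\<lambda>t. c \<bullet> q t) has_vector_derivative c \<bullet> vector_derivative q (at t)) (at t)"
      using N(2)[of t] by (intro bounded_linear.has_vector_derivative[OF bounded_linear_inner_right]) simp
  qed
  then show ?thesis using q by simp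
qed

lemma admissible_Lagrangian_measurable:
  fixes q :: "real \<Rightarrow> real^'n"
  assumes adm: "admissible r T q"
  shows "(\<lambda>t. e2ennreal (Lagrangian P lam mu (q t) (vector_derivative q (at t))) * indicator {0..T} t)
    \<in> borel_measurable lebesgue"
proof -
  have q: "abs_cont_on {0..T} q" "0 \<le> T" using adm by (simp_all add: admissible_def)
  \<comment> \<open>Clamping time to [0, T] makes the path continuous on the whole line, and cutting
    off the derivative removes its arbitrary values outside [0, T].\<close>
  define q' where "q' t = q (max 0 (min T t))" for t
  define v where "v t = (\<chi> k. vector_derivative q (at t) $ k * indicator {0..T} t)" for t
  have "continuous_on UNIV q'"
    unfolding q'_def
    by (rule continuous_on_compose2[OF abs_cont_on_imp_continuous_on[OF q(1)]])
      (use q(2) in \<open>auto intro!: continuous_intros\<close>)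
  then have q'm: "q' \<in> borel_measurable lebesgue"
    by (intro measurable_completion) (simp add: borel_measurable_continuous_onI)
  have vm: "v \<in> borel_measurable lebesgue"
  proof (subst borel_measurable_euclidean_space, intro ballI)
    fix b :: "real^'n" assume "b \<in> Basis"
    then obtain k where b: "b = axis k 1" by (auto simp: Basis_vec_def)
    have "(\<lambda>t. axis k 1 \<bullet> vector_derivative q (at t) * indicator {0..T} t) \<in> borel_measurable lebesgue"
      by (rule has_integral_implies_lebesgue_measurable_real[OF admissible_integral[OF adm]])
    then show "(\<lambda>t. v t \<bullet> b) \<in> borel_measurable lebesgue"
      by (simp add: b v_def inner_axis inner_axis')
  qed
  have "(\<lambda>t. e2ennreal (Lagrangian P lam mu (q' t) (v t)) * indicator {0..T} t) \<in> borel_measurable lebesgue"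
  proof -
    have "(\<lambda>t. e2ennreal (Lagrangian P lam mu (q' t) (v t))) \<in> borel_measurable lebesgue"
      by (rule measurable_compose[OF Lagrangian_borel[OF q'm vm]]) measurable
    moreover have "indicator {0..T} \<in> borel_measurable (lebesgue :: real measure)"
      by (intro borel_measurable_indicator) simp
    ultimately show ?thesis by (rule borel_measurable_times_ennreal)
  qed
  also have "(\<lambda>t. e2ennreal (Lagrangian P lam mu (q' t) (v t)) * indicator {0..T} t)
      = (\<lambda>t. e2ennreal (Lagrangian P lam mu (q t) (vector_derivative q (at t))) * indicator {0..T} t)"
  proof
    fix t
    show "e2ennreal (Lagrangian P lam mu (q' t) (v t)) * indicator {0..T} t
      = e2ennreal (Lagrangian P lam mu (q t) (vector_derivative q (at t))) * indicator {0..T} t"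
    proof (cases "t \<in> {0..T}")
      case True
      then have "q' t = q t" "v t = vector_derivative q (at t)"
        by (auto simp: q'_def v_def vec_eq_iff)
      then show ?thesis by simp
    qed simp
  qed
  finally show ?thesis .
qed

section \<open>The lower bound and its equality case\<close>

context jackson_network
begin

text \<open>The Fenchel-Young inequality at the face momentum, where H vanishes; tangency lets
  \<open>theta_star\<close> replace that momentum in the pairing.\<close>

lemma L_face_tangential:
  assumes y: "\<And>k. k \<in> J \<Longrightarrow> y $ k = 0"
  shows "ereal (theta_star P lam mu \<bullet> y) \<le> L_face P lam mu J y"
    and "L_face P lam mu J y = ereal (theta_star P lam mu \<bullet> y) \<longleftrightarrow>
      y \<in> subdifferential (H P lam mu J) (theta_face P lam mu J)"
proof -
  let ?t = "theta_face P lam mu J"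
  have ty: "?t \<bullet> y = theta_star P lam mu \<bullet> y" by (rule theta_face_inner[OF y])
  show ge: "ereal (theta_star P lam mu \<bullet> y) \<le> L_face P lam mu J y"
    using L_face_ge[of ?t y P lam mu J] by (simp add: H_theta_face ty)
  have "L_face P lam mu J y \<le> ereal (theta_star P lam mu \<bullet> y)
      \<longleftrightarrow> (\<forall>th. th \<bullet> y - H P lam mu J th \<le> ?t \<bullet> y)"
    unfolding L_face_def SUP_le_iff ty by simp
  also have "\<dots> \<longleftrightarrow> y \<in> subdifferential (H P lam mu J) ?t"
    unfolding subdifferential_def by (auto simp: H_theta_face inner_diff_right inner_commute algebra_simps)
  finally show "L_face P lam mu J y = ereal (theta_star P lam mu \<bullet> y) \<longleftrightarrow>
      y \<in> subdifferential (H P lam mu J) ?t"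
    using ge by (auto simp: antisym)
qed

lemma admissible_Lagrangian_ge:
  assumes adm: "admissible r T q"
  shows "AE t in lebesgue. t \<in> {0..T} \<longrightarrow>
    ennreal (theta_star P lam mu \<bullet> vector_derivative q (at t))
      \<le> e2ennreal (Lagrangian P lam mu (q t) (vector_derivative q (at t)))"
  using admissible_derivative[OF adm]
proof eventually_elim
  case (elim t)
  show ?case
  proof
    assume "t \<in> {0..T}"
    with elim have "ereal (theta_star P lam mu \<bullet> vector_derivative q (at t))
        \<le> Lagrangian P lam mu (q t) (vector_derivative q (at t))"
      by (subst Lagrangian_eq_L_face) (auto intro!: L_face_tangential(1))
    from e2ennreal_mono[OF this]
    show "ennreal (theta_star P lam mu \<bullet> vector_derivative q (at t))
      \<le> e2ennreal (Lagrangian P lam mu (q t) (vector_derivative q (at t)))"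
      by simp
  qed
qed

lemma cost_ge:
  assumes adm: "admissible r T q"
  shows "ereal (theta_star P lam mu \<bullet> r) \<le> cost P lam mu T q"
proof -
  have "ennreal (theta_star P lam mu \<bullet> r)
      \<le> (\<integral>\<^sup>+t\<in>{0..T}. e2ennreal (Lagrangian P lam mu (q t) (vector_derivative q (at t))) \<partial>lebesgue)"
    by (rule has_integral_le_nn_integral[OF admissible_integral[OF adm] admissible_Lagrangian_ge[OF adm]])
  then have "enn2ereal (ennreal (theta_star P lam mu \<bullet> r)) \<le> cost P lam mu T q"
    unfolding cost_def by (simp add: less_eq_ennreal.rep_eq)
  \<comment> \<open>\<open>ennreal\<close> replaces a negative value by 0, which only raises
    it.\<close>
  moreover have "ereal (theta_star P lam mu \<bullet> r) \<le> enn2ereal (ennreal (theta_star P lam mu \<bullet> r))"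
    by (cases "0 \<le> theta_star P lam mu \<bullet> r") (simp_all add: ennreal_neg zero_ennreal.rep_eq)
  ultimately show ?thesis by (rule order_trans[rotated])
qed

text \<open>Ordered integrands with equal finite integrals agree almost everywhere; pointwise,
  equality is the subgradient condition of \<open>L_face_tangential\<close>.\<close>

lemma cost_eq_iff:
  assumes adm: "admissible r T q"
  shows "cost P lam mu T q = ereal (theta_star P lam mu \<bullet> r) \<longleftrightarrow>
    (AE t in lebesgue. t \<in> {0..T} \<longrightarrow> vector_derivative q (at t) \<in>
       subdifferential (H P lam mu (zeros (q t))) (theta_face P lam mu (zeros (q t))))"
    (is "?L \<longleftrightarrow> ?R")
proof -
  let ?D = "\<lambda>t. vector_derivative q (at t)" and ?c = "theta_star P lam mu"
  let ?F = "\<lambda>t. e2ennreal (Lagrangian P lam mu (q t) (?D t))"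
  have int: "((\<lambda>t. ?c \<bullet> ?D t) has_integral ?c \<bullet> r) {0..T}" by (rule admissible_integral[OF adm])
  have Lag: "AE t in lebesgue. t \<in> {0..T} \<longrightarrow> 0 \<le> Lagrangian P lam mu (q t) (?D t) \<and>
     (Lagrangian P lam mu (q t) (?D t) = ereal (?c \<bullet> ?D t) \<longleftrightarrow>
      ?D t \<in> subdifferential (H P lam mu (zeros (q t))) (theta_face P lam mu (zeros (q t))))"
    using admissible_derivative[OF adm]
  proof eventually_elim
    case (elim t)
    show ?case
    proof
      assume "t \<in> {0..T}"
      with elim have "q t \<in> nonneg_orthant" "\<And>k. k \<in> zeros (q t) \<Longrightarrow> ?D t $ k = 0" by auto
      then show "0 \<le> Lagrangian P lam mu (q t) (?D t) \<and>
         (Lagrangian P lam mu (q t) (?D t) = ereal (?c \<bullet> ?D t) \<longleftrightarrow>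
          ?D t \<in> subdifferential (H P lam mu (zeros (q t))) (theta_face P lam mu (zeros (q t))))"
        using L_face_nonneg L_face_tangential(2)[of "zeros (q t)" "?D t"] Lagrangian_eq_L_face by metis
    qed
  qed
  show ?thesis
  proof
    assume ?L
    then have eq: "enn2ereal (\<integral>\<^sup>+t\<in>{0..T}. ?F t \<partial>lebesgue) = ereal (?c \<bullet> r)" by (simp add: cost_def)
    have c0: "0 \<le> ?c \<bullet> r" using enn2ereal_nonneg[of "\<integral>\<^sup>+t\<in>{0..T}. ?F t \<partial>lebesgue"] unfolding eq by simp
    have "(\<integral>\<^sup>+t\<in>{0..T}. ?F t \<partial>lebesgue) = ennreal (?c \<bullet> r)"
      using arg_cong[OF eq, of e2ennreal] by simp
    from nn_integral_eq_has_integral_AE_eq[OF int admissible_Lagrangian_ge[OF adm]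
        admissible_Lagrangian_measurable[OF adm] this c0] Lag
    show ?R
    proof eventually_elim
      case (elim t)
      show ?case
      proof
        assume t: "t \<in> {0..T}"
        then have "?F t = ennreal (?c \<bullet> ?D t)" "0 \<le> ?c \<bullet> ?D t" "0 \<le> Lagrangian P lam mu (q t) (?D t)"
          using elim by auto
        then have "Lagrangian P lam mu (q t) (?D t) = ereal (?c \<bullet> ?D t)"
          by (metis enn2ereal_e2ennreal enn2ereal_ennreal)
        then show "?D t \<in> subdifferential (H P lam mu (zeros (q t))) (theta_face P lam mu (zeros (q t)))"
          using elim t by blast
      qed
    qed
  next
    assume ?R
    with Lag have eq: "AE t in lebesgue. t \<in> {0..T} \<longrightarrow> ?F t = ennreal (?c \<bullet> ?D t) \<and> 0 \<le> ?c \<bullet> ?D t"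
    proof eventually_elim
      case (elim t)
      then show ?case by (metis e2ennreal_ereal ereal_less_eq(5))
    qed
    have "(\<integral>\<^sup>+t\<in>{0..T}. ?F t \<partial>lebesgue) = (\<integral>\<^sup>+t\<in>{0..T}. ennreal (?c \<bullet> ?D t) \<partial>lebesgue)"
    proof (rule nn_integral_cong_AE)
      show "AE t in lebesgue. ?F t * indicator {0..T} t = ennreal (?c \<bullet> ?D t) * indicator {0..T} t"
        using eq by eventually_elim (simp add: indicator_def)
    qed
    moreover have nn: "AE t in lebesgue. t \<in> {0..T} \<longrightarrow> 0 \<le> ?c \<bullet> ?D t" using eq by eventually_elim simp
    ultimately show ?L
      using nn_integral_has_integral_AE_nonneg[OF int nn] by (simp add: cost_def)
  qed
qed

lemma reflection_invertible:
  obtains G where "bounded_linear G" "\<And>u. G (reflection *v u) = u" "\<And>u. reflection *v G u = u"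
proof -
  have "inj ((*v) reflection)" using reflection_inj by (rule injI)
  then obtain G where "linear G" "\<forall>x. G (reflection *v x) = x" "\<forall>x. reflection *v G x = x"
    using linear_injective_isomorphism[OF matrix_vector_mul_linear] by blast
  then show thesis using that linear_conv_bounded_linear by blast
qed

text \<open>\<open>phi\<close> is obtained by solving the trajectory equation for it. Its derivative
  is then identified with the push rate w that \<open>subgradient_fluid_velocity\<close> extracts
  from the optimality condition.\<close>

lemma reversed_solves_reflection:
  assumes adm: "admissible r T q"
    and opt: "AE t in lebesgue. t \<in> {0..T} \<longrightarrow> vector_derivative q (at t) \<in>
       subdifferential (H P lam mu (zeros (q t))) (theta_face P lam mu (zeros (q t)))"
  obtains phi where "solves_reflection T r (\<lambda>t. q (T - t)) phi"
proof -
  have q: "abs_cont_on {0..T} q" "0 \<le> T" "q 0 = 0" "q T = r" "q ` {0..T} \<subseteq> nonneg_orthant"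
    using adm by (simp_all add: admissible_def)
  obtain G where G: "bounded_linear G" "\<And>u. G (reflection *v u) = u" "\<And>u. reflection *v G u = u"
    using reflection_invertible by blast
  define phi where "phi t = G (q (T - t) - r - t *\<^sub>R drift)" for t
  have phi_alt: "phi t = - G r + t *\<^sub>R (- G drift) + G (q (T - t))" for t
    using bounded_linear.linear[OF G(1)] by (simp add: phi_def linear_diff linear_scale)
  have "AE t in lebesgue. t \<in> {0..T} \<longrightarrow>
      (\<exists>w. (phi has_vector_derivative w) (at t) \<and> (\<forall>k. 0 \<le> w $ k \<and> q (T - t) $ k * w $ k = 0))"
    using AE_lebesgue_reverse[OF opt, of T] AE_lebesgue_reverse[OF admissible_derivative[OF adm], of T]
  proof eventually_elim
    case (elim t)
    show ?case
    proof
      assume "t \<in> {0..T}"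
      then have "T - t \<in> {0..T}" by auto
      define D where "D = vector_derivative q (at (T - t))"
      have D: "(q has_vector_derivative D) (at (T - t))"
        "D \<in> subdifferential (H P lam mu (zeros (q (T - t)))) (theta_face P lam mu (zeros (q (T - t))))"
        "\<And>k. k \<in> zeros (q (T - t)) \<Longrightarrow> D $ k = 0"
        using elim \<open>T - t \<in> {0..T}\<close> by (auto simp: D_def)
      obtain w where w: "\<And>k. 0 \<le> w $ k" "\<And>k. k \<notin> zeros (q (T - t)) \<Longrightarrow> w $ k = 0" "- D = drift + reflection *v w"
        using subgradient_fluid_velocity[OF D(2,3)] by blast
      have "((\<lambda>t. T - t) has_vector_derivative - 1) (at t)"
        by (auto intro!: derivative_eq_intros)
      from vector_diff_chain_at[OF this, of q D] D(1)
      have "((\<lambda>t. q (T - t)) has_vector_derivative - D) (at t)" by (simp add: o_def)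
      then have "(phi has_vector_derivative (- G drift + G (- D))) (at t)"
        unfolding phi_alt
        by (auto intro!: derivative_eq_intros bounded_linear.has_vector_derivative[OF G(1)])
      also have "- G drift + G (- D) = w"
        unfolding w(3) using bounded_linear.linear[OF G(1)] by (simp add: linear_add G(2))
      finally have "(phi has_vector_derivative w) (at t)" .
      then show "\<exists>w. (phi has_vector_derivative w) (at t) \<and> (\<forall>k. 0 \<le> w $ k \<and> q (T - t) $ k * w $ k = 0)"
        using w by (intro exI[of _ w]) auto
    qed
  qed
  moreover have "phi 0 = 0" using q bounded_linear.linear[OF G(1)] by (simp add: phi_def linear_0)
  moreover have "abs_cont_on {0..T} phi"
    unfolding phi_alt by (rule abs_cont_on_bounded_linear[OF G(1) abs_cont_on_reverse[OF q(1)]])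
  moreover have "q (T - t) = r + t *\<^sub>R drift + reflection *v phi t" for t
    by (simp add: phi_def G(3))
  moreover have "q (T - t) \<in> nonneg_orthant" if "t \<in> {0..T}" for t
    using q(5) that by (auto intro!: subsetD[OF q(5)])
  ultimately have "solves_reflection T r (\<lambda>t. q (T - t)) phi"
    unfolding solves_reflection_def by blast
  then show thesis by (rule that)
qed

end

theorem mainTheorem1:
  fixes P :: "real^'n^'n" and lam mu r :: "real^'n"
    and qbar qstar :: "real \<Rightarrow> real^'n" and Tstar :: real
  assumes "substochastic P" and "spectral_radius P < 1"
    and "\<And>k. 0 < lam $ k" and "\<And>k. 0 < mu $ k"
    and "\<And>k. rho P lam mu k < 1"
    and "r \<in> nonneg_orthant"
    and "fluid_trajectory (dual_routing P lam) (dual_arrival P lam) mu r qbar"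
  defines "Tstar \<equiv> first_time_at_origin qbar"
    and "qstar \<equiv> \<lambda>t. qbar (Tstar - t)"
  shows "(minimizer P lam mu r Tstar qstar \<and>
          (\<forall>T q. minimizer P lam mu r T q \<longrightarrow>
             Tstar \<le> T \<and> (\<forall>t\<in>{0..T - Tstar}. q t = 0) \<and>
             (\<forall>t\<in>{0..Tstar}. q (T - Tstar + t) = qstar t)))
       \<and> (\<forall>J. essential P lam mu J \<longrightarrow>
            (AE t in lebesgue. t \<in> {0..Tstar} \<and> qstar t \<in> face J \<longrightarrow>
               (\<exists>v. (qstar has_vector_derivative v) (at t) \<and>
                    v \<in> subdifferential (H P lam mu J) (theta_face P lam mu J))))
       \<and> cost P lam mu Tstar qstar = ereal (theta_star P lam mu \<bullet> r)"
proof -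
  interpret jackson_network P lam mu by unfold_locales (use assms in auto)
  obtain phi where sol: "\<And>T. 0 \<le> T \<Longrightarrow> solves_reflection T r qbar phi"
    by (rule fluid_trajectory_solves[OF assms(7)]) blast
  note origin = fluid_reaches_origin[OF assms(7), folded Tstar_def]
  have sol': "solves_reflection Tstar r qbar phi" by (rule sol[OF origin(1)])
  have r: "qbar 0 = r"
    using solves_reflectionD(3)[OF sol', of 0] solves_reflectionD(1)[OF sol'] origin(1) by simp
  have adm: "admissible r Tstar qstar"
    unfolding admissible_def qstar_def
  proof (intro conjI)
    show "abs_cont_on {0..Tstar} (\<lambda>t. qbar (Tstar - t))"
      by (rule abs_cont_on_reverse[OF solves_reflection_abs_cont[OF sol']])
    show "(\<lambda>t. qbar (Tstar - t)) ` {0..Tstar} \<subseteq> nonneg_orthant"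
      by (intro image_subsetI solves_reflectionD(4)[OF sol']) auto
  qed (use origin(1,2) r in simp_all)
  have vel: "AE t in lebesgue. t \<in> {0..Tstar} \<longrightarrow>
     (qstar has_vector_derivative yface (zeros (qstar t))) (at t) \<and>
     yface (zeros (qstar t)) \<in> subdifferential (H P lam mu (zeros (qstar t))) (theta_face P lam mu (zeros (qstar t)))"
    using AE_lebesgue_reverse[OF reflection_velocity[OF sol'], of Tstar]
  proof eventually_elim
    case (elim t)
    show ?case
    proof
      assume "t \<in> {0..Tstar}"
      then have "Tstar - t \<in> {0..Tstar}" by auto
      with elim have v: "(qbar has_vector_derivative - yface (zeros (qstar t))) (at (Tstar - t))"
        "yface (zeros (qstar t)) \<in> subdifferential (H P lam mu (zeros (qstar t))) (theta_face P lam mu (zeros (qstar t)))"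
        by (auto simp: qstar_def)
      have "((\<lambda>t. Tstar - t) has_vector_derivative - 1) (at t)"
        by (auto intro!: derivative_eq_intros)
      from vector_diff_chain_at[OF this v(1)]
      have "(qstar has_vector_derivative yface (zeros (qstar t))) (at t)" by (simp add: o_def qstar_def)
      with v(2) show "(qstar has_vector_derivative yface (zeros (qstar t))) (at t) \<and>
        yface (zeros (qstar t)) \<in> subdifferential (H P lam mu (zeros (qstar t))) (theta_face P lam mu (zeros (qstar t)))"
        by blast
    qed
  qed
  have cost: "cost P lam mu Tstar qstar = ereal (theta_star P lam mu \<bullet> r)"
  proof (subst cost_eq_iff[OF adm])
    show "AE t in lebesgue. t \<in> {0..Tstar} \<longrightarrow> vector_derivative qstar (at t) \<in>
       subdifferential (H P lam mu (zeros (qstar t))) (theta_face P lam mu (zeros (qstar t)))"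
      using vel by eventually_elim (auto simp: vector_derivative_at)
  qed
  have min: "minimizer P lam mu r Tstar qstar"
    unfolding minimizer_def cost using adm cost_ge by blast
  have unique: "Tstar \<le> T \<and> (\<forall>t\<in>{0..T - Tstar}. q t = 0) \<and> (\<forall>t\<in>{0..Tstar}. q (T - Tstar + t) = qstar t)"
    if mq: "minimizer P lam mu r T q" for T q
  proof -
    have admq: "admissible r T q" and le: "cost P lam mu T q \<le> cost P lam mu Tstar qstar"
      using mq adm by (auto simp: minimizer_def)
    then have T: "0 \<le> T" "q 0 = 0" by (auto simp: admissible_def)
    have "cost P lam mu T q = ereal (theta_star P lam mu \<bullet> r)"
      using le cost_ge[OF admq] unfolding cost by (rule antisym)
    then obtain psi where psi: "solves_reflection T r (\<lambda>t. q (T - t)) psi"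
      using reversed_solves_reflection[OF admq] cost_eq_iff[OF admq] by blast
    \<comment> \<open>The horizon T belongs to the minimizer: its reversal and \<open>qbar\<close>
      both solve the problem on [0, T] from r, and \<open>qbar\<close> rests at the origin after
      \<open>Tstar\<close>, which accounts for the waiting time.\<close>
    have rev: "q t = qbar (T - t)" if "t \<in> {0..T}" for t
      using reflection_unique[OF psi sol[OF T(1)], of "T - t"] that by auto
    have "qbar T = 0" using rev[of 0] T by simp
    then have "Tstar \<le> T" by (rule origin(4)[OF T(1)])
    moreover have "q t = 0" if "t \<in> {0..T - Tstar}" for t
      using rev[of t] origin(1) origin(3)[of "T - t"] that by auto
    moreover have "q (T - Tstar + t) = qstar t" if "t \<in> {0..Tstar}" for t
      using rev[of "T - Tstar + t"] \<open>Tstar \<le> T\<close> that by (simp add: qstar_def)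
    ultimately show ?thesis by blast
  qed
  have "AE t in lebesgue. t \<in> {0..Tstar} \<and> qstar t \<in> face J \<longrightarrow>
       (\<exists>v. (qstar has_vector_derivative v) (at t) \<and>
            v \<in> subdifferential (H P lam mu J) (theta_face P lam mu J))" for J
    using vel
  proof eventually_elim
    case (elim t)
    show ?case
    proof
      assume t: "t \<in> {0..Tstar} \<and> qstar t \<in> face J"
      then have "qstar t \<in> nonneg_orthant" using adm by (auto simp: admissible_def)
      then have "J = zeros (qstar t)" using t face_iff by blast
      then show "\<exists>v. (qstar has_vector_derivative v) (at t) \<and>
            v \<in> subdifferential (H P lam mu J) (theta_face P lam mu J)"
        using elim t by blast
    qed
  qed
  then show ?thesis using min unique cost by blast
qed

end
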